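(* Let $\Gamma$ be a tropical curve and let $K$ be its canonical divisor. If $K$ is not very ample, then $\Gamma$ is hyperelliptic.
   Context: A tropical curve $\Gamma$ is a compact connected metric graph whose leaf edges may have infinite length (with a point at infinity added for each unbounded edge). Divisors are finite formal $\mathbb Z$-combinations of points; the degree is the sum of the coefficients; $D\ge 0$ means that all coefficients are non-negative (effective). A rational function is a continuous function on $\Gamma$, piecewise linear with finitely many pieces and integer slopes (real-valued, except possibly $\pm\infty$ at points at infinity); $(f)=\sum_x\mathrm{ord}_x(f)\cdot x$, where $\mathrm{ord}_x(f)$ is the sum of outgoing slopes of $f$ at $x$. $R(D)=\{f:D+(f)\ge0\}$, $|D|=\{D+(f):f\in R(D)\}$. The canonical divisor is $K=\sum_{x\in\Gamma}(\mathrm{val}(x)-2)\cdot x$, where $\mathrm{val}(x)$ is the valence of $x$. A divisor $D\ge 0$ is very ample if $R(D)$ separates points, that is, if for every $x\ne x'$ in $\Gamma$ there are $f,f'\in R(D)$ with $f(x)-f(x')\ne f'(x)-f'(x')$. The rank $r(D)$ is the maximum integer $r$ such that $|D-E|\ne\emptyset$ for all effective divisors $E$ of degree $r$ (with $r(D)=-1$ if $|D|=\emptyset$). $\Gamma$ is hyperelliptic if there is a linear system $|D|$ with $\deg D=2$ and $r(D)=1$ (in particular, a hyperelliptic curve is not a tree).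
   Formalization: Γ is assumed not to be a tree (genus at least 1), since for trees R(K) is empty and the claim fails; very ampleness of K means that R(K) separates points, also when K is not effective, with f − f' extended by continuity to points at infinity. *)

theory Defs
  imports "HOL-Analysis.Analysis" "Graph_Theory.Graph_Theory"
begin

text \<open>
  A tropical curve is given by a finite connected multigraph (loops and parallel arcs are
  allowed) with an edge length in \<open>(0,\<infinity>]\<close> for every arc. The direction of an arc only fixes
  a parametrisation of the corresponding edge. An edge of infinite length is parametrised
  towards its point at infinity: this is the head of the arc, and it has to be a leaf.
  A curve with an edge that is infinite at both ends is represented after subdividing that edge.
\<close>

record ('v, 'e) metric_graph =
  graph :: "('v, 'e) pre_digraph"
  len :: "'e \<Rightarrow> ereal"

text \<open>Every loop at \<open>v\<close> contributes 2.\<close>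
definition vertex_valence :: "('v, 'e) metric_graph \<Rightarrow> 'v \<Rightarrow> nat" where
  "vertex_valence \<Gamma> v = in_degree (graph \<Gamma>) v + out_degree (graph \<Gamma>) v"

definition tropical_curve :: "('v, 'e) metric_graph \<Rightarrow> bool" where
  "tropical_curve \<Gamma> \<longleftrightarrow>
     fin_digraph (graph \<Gamma>) \<and>
     Digraph_Component.connected (graph \<Gamma>) \<and>
     (\<forall>e \<in> arcs (graph \<Gamma>). 0 < len \<Gamma> e) \<and>
     (\<forall>e \<in> arcs (graph \<Gamma>). len \<Gamma> e = \<infinity> \<longrightarrow> vertex_valence \<Gamma> (head (graph \<Gamma>) e) = 1)"

text \<open>
  The first Betti number. The curve is a tree iff it is 0. (The predicate \<open>tree\<close> of the graph
  library only excludes directed cycles, which is not what is meant here.)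
\<close>
definition genus :: "('v, 'e) metric_graph \<Rightarrow> int" where
  "genus \<Gamma> = int (card (arcs (graph \<Gamma>))) - int (card (verts (graph \<Gamma>))) + 1"

text \<open>\<open>Inner e t\<close> is the point of the open edge \<open>e\<close> at distance \<open>t\<close> from the tail of \<open>e\<close>.\<close>
datatype ('v, 'e) point = Vertex 'v | Inner 'e real

definition points :: "('v, 'e) metric_graph \<Rightarrow> ('v, 'e) point set" where
  "points \<Gamma> = Vertex ` verts (graph \<Gamma>) \<union>
     {Inner e t | e t. e \<in> arcs (graph \<Gamma>) \<and> 0 < t \<and> ereal t < len \<Gamma> e}"

definition points_at_infinity :: "('v, 'e) metric_graph \<Rightarrow> ('v, 'e) point set" where
  "points_at_infinity \<Gamma> =
     {Vertex (head (graph \<Gamma>) e) | e. e \<in> arcs (graph \<Gamma>) \<and> len \<Gamma> e = \<infinity>}"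

text \<open>The parametrisation of the closed edge \<open>e\<close> by \<open>{0..len \<Gamma> e}\<close>, starting at its tail.\<close>
definition edge_point :: "('v, 'e) metric_graph \<Rightarrow> 'e \<Rightarrow> ereal \<Rightarrow> ('v, 'e) point" where
  "edge_point \<Gamma> e s =
     (if s = 0 then Vertex (tail (graph \<Gamma>) e)
      else if s = len \<Gamma> e then Vertex (head (graph \<Gamma>) e)
      else Inner e (real_of_ereal s))"

definition valence :: "('v, 'e) metric_graph \<Rightarrow> ('v, 'e) point \<Rightarrow> nat" where
  "valence \<Gamma> x = (case x of Vertex v \<Rightarrow> vertex_valence \<Gamma> v | Inner e t \<Rightarrow> 2)"


text \<open>
  Functions on the curve are total functions on the type of points; only their values on
  \<open>points \<Gamma>\<close> matter. The set \<open>B\<close> below consists of the breakpoints on the edge \<open>e\<close>; on each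
  open subinterval without breakpoints the function is affine with integer slope.
\<close>
definition rational_function ::
    "('v, 'e) metric_graph \<Rightarrow> (('v, 'e) point \<Rightarrow> ereal) \<Rightarrow> bool" where
  "rational_function \<Gamma> f \<longleftrightarrow>
     (\<forall>x \<in> points \<Gamma> - points_at_infinity \<Gamma>. \<bar>f x\<bar> \<noteq> \<infinity>) \<and>
     (\<forall>e \<in> arcs (graph \<Gamma>).
        continuous_on {0..len \<Gamma> e} (\<lambda>s. f (edge_point \<Gamma> e s)) \<and>
        (\<exists>B :: ereal set. finite B \<and>
           (\<forall>a b. 0 \<le> a \<longrightarrow> a < b \<longrightarrow> b \<le> len \<Gamma> e \<longrightarrow> {a<..<b} \<inter> B = {} \<longrightarrow>
              (\<exists>(m::int) (c::real). \<forall>t::real. a < ereal t \<longrightarrow> ereal t < b \<longrightarrow>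
                 f (edge_point \<Gamma> e (ereal t)) = ereal (of_int m * t + c)))))"

text \<open>
  One-sided slopes along the edge \<open>e\<close>, both in the direction of increasing parameter. For
  \<open>s = \<infinity>\<close> the filter \<open>at_left s\<close> describes the behaviour near the point at infinity.
\<close>
definition slope_after ::
    "('v, 'e) metric_graph \<Rightarrow> (('v, 'e) point \<Rightarrow> ereal) \<Rightarrow> 'e \<Rightarrow> ereal \<Rightarrow> int" where
  "slope_after \<Gamma> f e s = (THE m. \<exists>c::real. \<forall>\<^sub>F t in at_right s.
     f (edge_point \<Gamma> e t) = ereal (of_int m * real_of_ereal t + c))"

definition slope_before ::
    "('v, 'e) metric_graph \<Rightarrow> (('v, 'e) point \<Rightarrow> ereal) \<Rightarrow> 'e \<Rightarrow> ereal \<Rightarrow> int" where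
  "slope_before \<Gamma> f e s = (THE m. \<exists>c::real. \<forall>\<^sub>F t in at_left s.
     f (edge_point \<Gamma> e t) = ereal (of_int m * real_of_ereal t + c))"

text \<open>
  The sum of the outgoing slopes. Going against the parametrisation reverses the sign of a slope.
\<close>
definition ord_at ::
    "('v, 'e) metric_graph \<Rightarrow> (('v, 'e) point \<Rightarrow> ereal) \<Rightarrow> ('v, 'e) point \<Rightarrow> int" where
  "ord_at \<Gamma> f x = (case x of
       Vertex v \<Rightarrow> (\<Sum>e \<in> out_arcs (graph \<Gamma>) v. slope_after \<Gamma> f e 0)
                 - (\<Sum>e \<in> in_arcs (graph \<Gamma>) v. slope_before \<Gamma> f e (len \<Gamma> e))
     | Inner e t \<Rightarrow> slope_after \<Gamma> f e (ereal t) - slope_before \<Gamma> f e (ereal t))"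


text \<open>A divisor is represented by its coefficient function.\<close>
definition divisor :: "('v, 'e) metric_graph \<Rightarrow> (('v, 'e) point \<Rightarrow> int) \<Rightarrow> bool" where
  "divisor \<Gamma> D \<longleftrightarrow> finite {x. D x \<noteq> 0} \<and> {x. D x \<noteq> 0} \<subseteq> points \<Gamma>"

definition divisor_degree :: "(('v, 'e) point \<Rightarrow> int) \<Rightarrow> int" where
  "divisor_degree D = (\<Sum>x | D x \<noteq> 0. D x)"

definition effective :: "(('v, 'e) point \<Rightarrow> int) \<Rightarrow> bool" where
  "effective D \<longleftrightarrow> (\<forall>x. 0 \<le> D x)"

definition principal_divisor ::
    "('v, 'e) metric_graph \<Rightarrow> (('v, 'e) point \<Rightarrow> ereal) \<Rightarrow> ('v, 'e) point \<Rightarrow> int" where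
  "principal_divisor \<Gamma> f x = (if x \<in> points \<Gamma> then ord_at \<Gamma> f x else 0)"

definition canonical :: "('v, 'e) metric_graph \<Rightarrow> ('v, 'e) point \<Rightarrow> int" where
  "canonical \<Gamma> x = (if x \<in> points \<Gamma> then int (valence \<Gamma> x) - 2 else 0)"

definition RR ::
    "('v, 'e) metric_graph \<Rightarrow> (('v, 'e) point \<Rightarrow> int) \<Rightarrow> (('v, 'e) point \<Rightarrow> ereal) set" where
  "RR \<Gamma> D = {f. rational_function \<Gamma> f \<and> effective (\<lambda>x. D x + principal_divisor \<Gamma> f x)}"

definition linear_system ::
    "('v, 'e) metric_graph \<Rightarrow> (('v, 'e) point \<Rightarrow> int) \<Rightarrow> (('v, 'e) point \<Rightarrow> int) set" where
  "linear_system \<Gamma> D = (\<lambda>f x. D x + principal_divisor \<Gamma> f x) ` RR \<Gamma> D"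

definition divisor_rank :: "('v, 'e) metric_graph \<Rightarrow> (('v, 'e) point \<Rightarrow> int) \<Rightarrow> int" where
  "divisor_rank \<Gamma> D =
     (if linear_system \<Gamma> D = {} then -1
      else int (GREATEST r::nat. \<forall>E. divisor \<Gamma> E \<longrightarrow> effective E \<longrightarrow> divisor_degree E = int r \<longrightarrow>
                  linear_system \<Gamma> (\<lambda>x. D x - E x) \<noteq> {}))"

definition hyperelliptic :: "('v, 'e) metric_graph \<Rightarrow> bool" where
  "hyperelliptic \<Gamma> \<longleftrightarrow> (\<exists>D. divisor \<Gamma> D \<and> divisor_degree D = 2 \<and> divisor_rank \<Gamma> D = 1)"


text \<open>
  \<open>h\<close> is the rational function \<open>f - f'\<close>. At a point at infinity both \<open>f\<close> and \<open>f'\<close> may be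
  infinite, and then the value of \<open>f - f'\<close> is determined by continuity.
\<close>
definition is_difference ::
    "('v, 'e) metric_graph \<Rightarrow> (('v, 'e) point \<Rightarrow> ereal) \<Rightarrow> (('v, 'e) point \<Rightarrow> ereal) \<Rightarrow>
     (('v, 'e) point \<Rightarrow> ereal) \<Rightarrow> bool" where
  "is_difference \<Gamma> f f' h \<longleftrightarrow> rational_function \<Gamma> h \<and>
     (\<forall>y \<in> points \<Gamma> - points_at_infinity \<Gamma>. h y = f y - f' y)"

text \<open>
  The condition \<open>f x - f x' \<noteq> f' x - f' x'\<close> is written as \<open>(f - f') x \<noteq> (f - f') x'\<close>. This makes
  no difference for real values (lemma \<open>very_ample_iff\<close> below) and gives the condition a meaning
  at points at infinity. There the subtraction of type \<open>ereal\<close> would not do: if all functions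
  of \<open>RR \<Gamma> D\<close> have the value \<open>-\<infinity>\<close> at \<open>x'\<close>, then \<open>f x - f x' = \<infinity>\<close> for all of them and every
  real \<open>f x\<close>. Effectivity of \<open>D\<close> is not part of the definition, so that it applies to the
  canonical divisor of a curve with leaves.
\<close>
definition very_ample :: "('v, 'e) metric_graph \<Rightarrow> (('v, 'e) point \<Rightarrow> int) \<Rightarrow> bool" where
  "very_ample \<Gamma> D \<longleftrightarrow>
     (\<forall>x \<in> points \<Gamma>. \<forall>x' \<in> points \<Gamma>. x \<noteq> x' \<longrightarrow>
        (\<exists>f \<in> RR \<Gamma> D. \<exists>f' \<in> RR \<Gamma> D. \<exists>h. is_difference \<Gamma> f f' h \<and> h x \<noteq> h x'))"


text \<open>
  For effective \<open>canonical \<Gamma>\<close> the curve is not a tree, and \<open>very_ample\<close> for \<open>canonical \<Gamma>\<close> is the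
  literal condition \<open>f x - f x' \<noteq> f' x - f' x'\<close>.
\<close>
lemma canonical_effective_imp:
  assumes "tropical_curve \<Gamma>" and "effective (canonical \<Gamma>)"
  shows "1 \<le> genus \<Gamma>" and "points_at_infinity \<Gamma> = {}"
proof -
  interpret fin_digraph "graph \<Gamma>" using assms(1) by (simp add: tropical_curve_def)
  let ?G = "graph \<Gamma>"
  have 1: "(\<Sum>v\<in>verts ?G. in_degree ?G v) = card (arcs ?G)"
    unfolding in_degree_def in_arcs_def
    by (subst card_UN_disjoint[symmetric]) (auto intro!: arg_cong[where f=card])
  have 2: "(\<Sum>v\<in>verts ?G. out_degree ?G v) = card (arcs ?G)"
    unfolding out_degree_def out_arcs_def
    by (subst card_UN_disjoint[symmetric]) (auto intro!: arg_cong[where f=card])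
  have val: "2 \<le> vertex_valence \<Gamma> v" if "v \<in> verts ?G" for v
    using assms(2) that unfolding effective_def canonical_def points_def valence_def
    by (auto dest!: spec[of _ "Vertex v"])
  show "points_at_infinity \<Gamma> = {}"
  proof -
    have "len \<Gamma> e \<noteq> \<infinity>" if "e \<in> arcs ?G" for e
    proof
      assume "len \<Gamma> e = \<infinity>"
      then have "vertex_valence \<Gamma> (head ?G e) = 1"
        using assms(1) that unfolding tropical_curve_def by blast
      then show False using val[OF head_in_verts[OF that]] by simp
    qed
    then show ?thesis unfolding points_at_infinity_def by blast
  qed
  have "(\<Sum>v\<in>verts ?G. 2) \<le> (\<Sum>v\<in>verts ?G. vertex_valence \<Gamma> v)"
    using val by (intro sum_mono) auto
  also have "\<dots> = 2 * card (arcs ?G)" by (simp add: vertex_valence_def sum.distrib 1 2)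
  finally show "1 \<le> genus \<Gamma>" by (simp add: genus_def)
qed

lemma edge_point_in_points:
  assumes "tropical_curve \<Gamma>" "e \<in> arcs (graph \<Gamma>)" "s \<in> {0..len \<Gamma> e}"
  shows "edge_point \<Gamma> e s \<in> points \<Gamma>"
proof -
  interpret fin_digraph "graph \<Gamma>" using assms(1) by (simp add: tropical_curve_def)
  show ?thesis using assms(2,3)
    by (cases s) (auto simp: edge_point_def points_def)
qed

lemma rational_function_finite:
  assumes "rational_function \<Gamma> f" "x \<in> points \<Gamma>" "x \<notin> points_at_infinity \<Gamma>"
  shows "\<bar>f x\<bar> \<noteq> \<infinity>"
proof -
  have "\<forall>x \<in> points \<Gamma> - points_at_infinity \<Gamma>. \<bar>f x\<bar> \<noteq> \<infinity>"
    using assms(1) unfolding rational_function_def by (rule conjunct1)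
  with assms(2,3) show ?thesis by simp
qed

lemma rational_function_diff:
  assumes G: "tropical_curve \<Gamma>" and fin: "points_at_infinity \<Gamma> = {}"
    and f: "rational_function \<Gamma> f" and g: "rational_function \<Gamma> g"
  shows "rational_function \<Gamma> (\<lambda>x. f x - g x)"
  unfolding rational_function_def
proof (intro conjI ballI)
  fix x assume "x \<in> points \<Gamma> - points_at_infinity \<Gamma>"
  then have "\<bar>f x\<bar> \<noteq> \<infinity>" "\<bar>g x\<bar> \<noteq> \<infinity>"
    by (intro rational_function_finite[OF f] rational_function_finite[OF g]; simp)+
  then show "\<bar>f x - g x\<bar> \<noteq> \<infinity>" by (cases "f x"; cases "g x") auto
next
  fix e assume e: "e \<in> arcs (graph \<Gamma>)"
  show "continuous_on {0..len \<Gamma> e} (\<lambda>s. f (edge_point \<Gamma> e s) - g (edge_point \<Gamma> e s))"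
    unfolding continuous_on_def
  proof
    fix s assume s: "s \<in> {0..len \<Gamma> e}"
    have fs: "\<bar>f (edge_point \<Gamma> e s)\<bar> \<noteq> \<infinity>" and gs: "\<bar>g (edge_point \<Gamma> e s)\<bar> \<noteq> \<infinity>"
      using rational_function_finite[OF f edge_point_in_points[OF G e s]]
        rational_function_finite[OF g edge_point_in_points[OF G e s]] fin by simp_all
    have cf: "continuous_on {0..len \<Gamma> e} (\<lambda>s. f (edge_point \<Gamma> e s))"
      and cg: "continuous_on {0..len \<Gamma> e} (\<lambda>s. g (edge_point \<Gamma> e s))"
      using f g e unfolding rational_function_def by auto
    show "((\<lambda>s. f (edge_point \<Gamma> e s) - g (edge_point \<Gamma> e s)) \<longlongrightarrow>
        f (edge_point \<Gamma> e s) - g (edge_point \<Gamma> e s)) (at s within {0..len \<Gamma> e})"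
      by (rule tendsto_diff_ereal[OF fs gs cf[unfolded continuous_on_def, rule_format, OF s]
            cg[unfolded continuous_on_def, rule_format, OF s]])
  qed
  obtain B where B: "finite B" "\<And>a b. 0 \<le> a \<Longrightarrow> a < b \<Longrightarrow> b \<le> len \<Gamma> e \<Longrightarrow> {a<..<b} \<inter> B = {} \<Longrightarrow>
      (\<exists>(m::int) (c::real). \<forall>t::real. a < ereal t \<longrightarrow> ereal t < b \<longrightarrow>
         f (edge_point \<Gamma> e (ereal t)) = ereal (of_int m * t + c))"
    using f e unfolding rational_function_def by metis
  obtain C where C: "finite C" "\<And>a b. 0 \<le> a \<Longrightarrow> a < b \<Longrightarrow> b \<le> len \<Gamma> e \<Longrightarrow> {a<..<b} \<inter> C = {} \<Longrightarrow>
      (\<exists>(m::int) (c::real). \<forall>t::real. a < ereal t \<longrightarrow> ereal t < b \<longrightarrow>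
         g (edge_point \<Gamma> e (ereal t)) = ereal (of_int m * t + c))"
    using g e unfolding rational_function_def by metis
  show "\<exists>B. finite B \<and> (\<forall>a b. 0 \<le> a \<longrightarrow> a < b \<longrightarrow> b \<le> len \<Gamma> e \<longrightarrow> {a<..<b} \<inter> B = {} \<longrightarrow>
      (\<exists>(m::int) (c::real). \<forall>t::real. a < ereal t \<longrightarrow> ereal t < b \<longrightarrow>
         f (edge_point \<Gamma> e (ereal t)) - g (edge_point \<Gamma> e (ereal t)) = ereal (of_int m * t + c)))"
  proof (intro exI[of _ "B \<union> C"] conjI allI impI)
    fix a b assume ab: "0 \<le> a" "a < b" "b \<le> len \<Gamma> e" "{a<..<b} \<inter> (B \<union> C) = {}"
    obtain m c where mc: "\<And>t::real. a < ereal t \<Longrightarrow> ereal t < b \<Longrightarrow>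
         f (edge_point \<Gamma> e (ereal t)) = ereal (of_int m * t + c)" using B(2)[of a b] ab by blast
    obtain n d where nd: "\<And>t::real. a < ereal t \<Longrightarrow> ereal t < b \<Longrightarrow>
         g (edge_point \<Gamma> e (ereal t)) = ereal (of_int n * t + d)" using C(2)[of a b] ab by blast
    show "\<exists>(m::int) (c::real). \<forall>t::real. a < ereal t \<longrightarrow> ereal t < b \<longrightarrow>
         f (edge_point \<Gamma> e (ereal t)) - g (edge_point \<Gamma> e (ereal t)) = ereal (of_int m * t + c)"
      by (intro exI[of _ "m - n"] exI[of _ "c - d"]) (auto simp: mc nd algebra_simps)
  qed (use B C in auto)
qed

lemma very_ample_iff:
  assumes G: "tropical_curve \<Gamma>" and fin: "points_at_infinity \<Gamma> = {}"
  shows "very_ample \<Gamma> D \<longleftrightarrow>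
     (\<forall>x \<in> points \<Gamma>. \<forall>x' \<in> points \<Gamma>. x \<noteq> x' \<longrightarrow>
        (\<exists>f \<in> RR \<Gamma> D. \<exists>f' \<in> RR \<Gamma> D. f x - f x' \<noteq> f' x - f' x'))"
proof -
  have "(\<exists>h. is_difference \<Gamma> f f' h \<and> h x \<noteq> h x') \<longleftrightarrow> f x - f x' \<noteq> f' x - f' x'"
    if x: "x \<in> points \<Gamma>" "x' \<in> points \<Gamma>" and f: "f \<in> RR \<Gamma> D" "f' \<in> RR \<Gamma> D" for x x' f f'
  proof -
    have rat: "rational_function \<Gamma> f" "rational_function \<Gamma> f'" using f by (auto simp: RR_def)
    have "\<bar>f x\<bar> \<noteq> \<infinity>" "\<bar>f' x\<bar> \<noteq> \<infinity>" "\<bar>f x'\<bar> \<noteq> \<infinity>" "\<bar>f' x'\<bar> \<noteq> \<infinity>"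
      using rational_function_finite[OF rat(1) x(1)] rational_function_finite[OF rat(2) x(1)]
        rational_function_finite[OF rat(1) x(2)] rational_function_finite[OF rat(2) x(2)] fin
      by simp_all
    hence "f x - f' x \<noteq> f x' - f' x' \<longleftrightarrow> f x - f x' \<noteq> f' x - f' x'"
      by (cases "f x"; cases "f' x"; cases "f x'"; cases "f' x'") auto
    moreover have "is_difference \<Gamma> f f' (\<lambda>y. f y - f' y)"
      using rational_function_diff[OF G fin rat] by (simp add: is_difference_def)
    moreover have "h x = f x - f' x" "h x' = f x' - f' x'" if "is_difference \<Gamma> f f' h" for h
      using that x fin unfolding is_difference_def by simp_all
    ultimately show ?thesis by metis
  qed
  then show ?thesis unfolding very_ample_def by (simp cong: ball_cong bex_cong)
qed

end

theory Submission
  imports Defs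
begin

text \<open>
  The infinite edges are cut off first. What remains is a compact metric graph, the core, on which
  the part of the Riemann--Roch theory that is needed is developed as follows. A function
  \<open>\<phi>\<close> without horizontal edges orients the core acyclically; let \<open>nu \<phi>\<close> be
  the divisor of indegrees minus 1. It has degree \<open>g - 1\<close>, it is not equivalent to an effective
  divisor, and \<open>K - nu \<phi> = nu (- \<phi>)\<close>. By reduced divisors and Dhar's burning algorithm, every
  divisor that is not equivalent to an effective one is equivalent to a divisor below some \<open>nu \<phi>\<close>.

  If no \<open>x + x'\<close> has positive rank, say \<open>x + x' - y\<close> is not equivalent to an effective
  divisor, then \<open>x + x' - y + F\<close> is equivalent to \<open>nu \<phi>\<close> for some effective \<open>F\<close>, and it follows
  that \<open>K - F - x\<close> and \<open>K - F - x'\<close> are equivalent to effective divisors while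
  \<open>K - F - x - x'\<close> is not. If \<open>f\<close> and \<open>f'\<close> realise the first two equivalences and
  \<open>f - f'\<close> had the same value \<open>c\<close> at \<open>x\<close> and \<open>x'\<close>, then \<open>max f (f' + c)\<close> would
  realise the third. Points on an infinite edge with base point \<open>b\<close> are separated by moving a chip
  of a divisor in \<open>|K - b| + b\<close> to infinity. If on the other hand \<open>x + x'\<close> has positive rank
  for some \<open>x\<close>, \<open>x'\<close>, then it defines a hyperelliptic structure.
\<close>

section \<open>Compact metric graphs and their rational functions\<close>

text \<open>Cutting off the infinite edges buys compactness and costs only bookkeeping: each of them
  adds a chip to the canonical divisor at its base and takes one away at its end. On the core,
  lengths are arbitrary reals while slopes must be integers, and this is the obstacle that shapes
  the proof. Repeated firing does not terminate by a counting argument, so a reduced divisor is read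
  off from the greatest function of a bounded family. Values prescribed at finitely many nodes
  cannot in general be joined by affine functions, so they are joined by convex functions with
  rounded slopes, whose kinks only add chips. Functions are described by germs, and the global facts
  along an edge (finite support, degree 0, supporting lines, Lipschitz bounds) come from one
  bisection argument. The full Riemann-Roch formula is avoided: the duality that is needed comes
  from degree \<open>g - 1\<close>, where nothing is left over below \<open>nu \<phi>\<close>.
  Positive genus enters when the rank is bounded by 1: on a tree all points are equivalent, and a
  divisor of degree 2 has rank 2.\<close>

locale metric_network =
  fixes V :: "'v set" and A :: "'e set" and src tgt :: "'e \<Rightarrow> 'v" and L :: "'e \<Rightarrow> real"
  assumes finite_V: "finite V" and finite_A: "finite A" and V_ne: "V \<noteq> {}"
    and src_in: "e \<in> A \<Longrightarrow> src e \<in> V" and tgt_in: "e \<in> A \<Longrightarrow> tgt e \<in> V"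
    and L_pos: "e \<in> A \<Longrightarrow> 0 < L e"
    and conn: "W \<subseteq> V \<Longrightarrow> W \<noteq> {} \<Longrightarrow> (\<And>e. e \<in> A \<Longrightarrow> src e \<in> W \<longleftrightarrow> tgt e \<in> W) \<Longrightarrow> W = V"
begin

definition ep :: "'e \<Rightarrow> real \<Rightarrow> ('v, 'e) point" where
  "ep e t = (if t = 0 then Vertex (src e) else if t = L e then Vertex (tgt e) else Inner e t)"

definition pts :: "('v, 'e) point set" where
  "pts = Vertex ` V \<union> {Inner e t | e t. e \<in> A \<and> 0 < t \<and> t < L e}"

text \<open>Parameter and sign are both recorded, so the two ends of a loop are different directions
  at the same vertex, and \<open>dirs\<close> counts a loop twice.\<close>

definition valid :: "'e \<Rightarrow> real \<Rightarrow> real \<Rightarrow> bool" where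
  "valid e t \<sigma> \<longleftrightarrow> e \<in> A \<and> 0 \<le> t \<and> t \<le> L e \<and> (\<sigma> = 1 \<and> t < L e \<or> \<sigma> = -1 \<and> 0 < t)"

text \<open>The triple \<open>(e, t, \<sigma>)\<close> is the tangent direction at the point \<open>ep e t\<close> in which the
  parameter of \<open>e\<close> increases (\<open>\<sigma> = 1\<close>) or decreases (\<open>\<sigma> = -1\<close>).\<close>
definition dirs :: "('v, 'e) point \<Rightarrow> ('e \<times> real \<times> real) set" where
  "dirs p = {(e, t, \<sigma>). valid e t \<sigma> \<and> ep e t = p}"

text \<open>A single eventual equation expresses both that the germ is affine and that it is
  continuous at the point along this direction.\<close>

definition has_slope :: "(('v, 'e) point \<Rightarrow> real) \<Rightarrow> 'e \<times> real \<times> real \<Rightarrow> real \<Rightarrow> bool" where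
  "has_slope f d m \<longleftrightarrow> (case d of (e, t, \<sigma>) \<Rightarrow>
     \<forall>\<^sub>F s in at_right 0. f (ep e (t + \<sigma> * s)) = f (ep e t) + m * s)"

text \<open>Piecewise linearity is demanded germ by germ. Finiteness of the set of kinks is then a
  consequence of compactness (\<open>finite_ord\<close>), and closure under sums and maxima becomes
  a purely local matter.\<close>

definition rat :: "(('v, 'e) point \<Rightarrow> real) \<Rightarrow> bool" where
  "rat f \<longleftrightarrow> (\<forall>e t \<sigma>. valid e t \<sigma> \<longrightarrow> (\<exists>m::int. has_slope f (e, t, \<sigma>) m))"

definition slope :: "(('v, 'e) point \<Rightarrow> real) \<Rightarrow> 'e \<times> real \<times> real \<Rightarrow> int" where
  "slope f d = (THE m. has_slope f d (real_of_int m))"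

definition ord :: "(('v, 'e) point \<Rightarrow> real) \<Rightarrow> ('v, 'e) point \<Rightarrow> int" where
  "ord f p = (\<Sum>d \<in> dirs p. slope f d)"

lemma ep_0[simp]: "ep e 0 = Vertex (src e)"
  by (simp add: ep_def)

lemma ep_L[simp]: "e \<in> A \<Longrightarrow> ep e (L e) = Vertex (tgt e)"
  using L_pos[of e] by (simp add: ep_def)

lemma ep_Inner: "0 < t \<Longrightarrow> t < L e \<Longrightarrow> ep e t = Inner e t"
  by (simp add: ep_def)

lemma ep_eq_Inner: "ep e t = Inner e' t' \<longleftrightarrow> e = e' \<and> t = t' \<and> t \<noteq> 0 \<and> t \<noteq> L e"
  by (auto simp: ep_def)

lemma ep_eq_Vertex:
  "e \<in> A \<Longrightarrow> ep e t = Vertex v \<longleftrightarrow> t = 0 \<and> src e = v \<or> t = L e \<and> tgt e = v"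
  using L_pos[of e] by (auto simp: ep_def)

lemma ep_in_pts: "e \<in> A \<Longrightarrow> 0 \<le> t \<Longrightarrow> t \<le> L e \<Longrightarrow> ep e t \<in> pts"
  by (auto simp: ep_def pts_def src_in tgt_in)

lemma Vertex_in_pts[simp]: "Vertex v \<in> pts \<longleftrightarrow> v \<in> V"
  by (auto simp: pts_def)

lemma Inner_in_pts[simp]: "Inner e t \<in> pts \<longleftrightarrow> e \<in> A \<and> 0 < t \<and> t < L e"
  by (auto simp: pts_def)

lemma valid_in_pts: "valid e t \<sigma> \<Longrightarrow> ep e t \<in> pts"
  by (auto simp: valid_def ep_in_pts)

lemma valid_sign: "valid e t \<sigma> \<Longrightarrow> \<sigma> = 1 \<or> \<sigma> = -1"
  by (auto simp: valid_def)

lemma dirs_Vertex: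
  "dirs (Vertex v) = (\<lambda>e. (e, 0, 1)) ` {e \<in> A. src e = v} \<union> (\<lambda>e. (e, L e, -1)) ` {e \<in> A. tgt e = v}"
  using L_pos by (auto simp: dirs_def valid_def ep_eq_Vertex less_imp_le)

lemma dirs_Inner: "e \<in> A \<Longrightarrow> 0 < t \<Longrightarrow> t < L e \<Longrightarrow> dirs (Inner e t) = {(e, t, 1), (e, t, -1)}"
  by (auto simp: dirs_def valid_def ep_eq_Inner)

lemma sum_dirs_Vertex:
  "(\<Sum>d \<in> dirs (Vertex v). g d)
    = (\<Sum>e | e \<in> A \<and> src e = v. g (e, 0, 1)) + (\<Sum>e | e \<in> A \<and> tgt e = v. g (e, L e, -1))"
proof -
  have "(\<Sum>d \<in> dirs (Vertex v). g d) = (\<Sum>d \<in> (\<lambda>e. (e, 0, 1)) ` {e \<in> A. src e = v}. g d)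
      + (\<Sum>d \<in> (\<lambda>e. (e, L e, -1)) ` {e \<in> A. tgt e = v}. g d)"
    unfolding dirs_Vertex using finite_A by (intro sum.union_disjoint) auto
  then show ?thesis by (simp add: sum.reindex inj_on_def)
qed

lemma sum_dirs_Inner:
  "e \<in> A \<Longrightarrow> 0 < t \<Longrightarrow> t < L e \<Longrightarrow> (\<Sum>d \<in> dirs (Inner e t). g d) = g (e, t, 1) + g (e, t, -1)"
  by (simp add: dirs_Inner)

lemma finite_dirs: "p \<in> pts \<Longrightarrow> finite (dirs p)"
  by (cases p) (auto simp: dirs_Vertex dirs_Inner finite_A)

lemma dirsD: "(e, t, \<sigma>) \<in> dirs p \<Longrightarrow> valid e t \<sigma> \<and> ep e t = p"
  by (simp add: dirs_def)

lemma pts_cases: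
  assumes "p \<in> pts"
  obtains v where "p = Vertex v" "v \<in> V" | e t where "p = ep e t" "e \<in> A" "0 < t" "t < L e"
  using assms by (auto simp: pts_def ep_Inner)

lemma eventually_valid:
  assumes "valid e t \<sigma>"
  shows "\<forall>\<^sub>F s in at_right 0. valid e (t + \<sigma> * s) \<sigma> \<and> valid e (t + \<sigma> * s) (-\<sigma>)"
proof -
  define b where "b = (if \<sigma> = 1 then L e - t else t)"
  have "b > 0" using assms by (auto simp: valid_def b_def)
  then show ?thesis unfolding eventually_at_right_field
    by (intro exI[of _ b]) (use assms in \<open>auto simp: valid_def b_def split: if_splits\<close>)
qed

lemma has_slope_unique:
  assumes "has_slope f d m" "has_slope f d m'"
  shows "m = m'"
proof -
  obtain e t \<sigma> where d: "d = (e, t, \<sigma>)" by (cases d)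
  have "\<forall>\<^sub>F s in at_right (0::real). s > 0" by (simp add: eventually_at_right_less)
  moreover have "\<forall>\<^sub>F s in at_right (0::real). f (ep e (t + \<sigma> * s)) = f (ep e t) + m * s"
    "\<forall>\<^sub>F s in at_right (0::real). f (ep e (t + \<sigma> * s)) = f (ep e t) + m' * s"
    using assms by (simp_all add: has_slope_def d)
  ultimately have "\<forall>\<^sub>F s in at_right (0::real). m = m'"
    by eventually_elim auto
  then show ?thesis by simp
qed

lemma slope_eq: "has_slope f d (real_of_int m) \<Longrightarrow> slope f d = m"
  unfolding slope_def by (rule the_equality) (auto dest: has_slope_unique)

lemma rat_slope:
  assumes "rat f" "valid e t \<sigma>"
  shows "has_slope f (e, t, \<sigma>) (slope f (e, t, \<sigma>))"
proof -
  obtain m :: int where m: "has_slope f (e, t, \<sigma>) m" using assms unfolding rat_def by blast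
  then show ?thesis using slope_eq[OF m] by simp
qed

lemma rat_slope': "rat f \<Longrightarrow> d \<in> dirs p \<Longrightarrow> has_slope f d (slope f d)"
  by (cases d) (auto dest!: dirsD intro: rat_slope)

lemma has_slope_const: "has_slope (\<lambda>_. c) d 0"
  by (cases d) (simp add: has_slope_def)

lemma has_slope_add:
  assumes "has_slope f d m" "has_slope g d n"
  shows "has_slope (\<lambda>x. f x + g x) d (m + n)"
proof (cases d)
  case (fields e t \<sigma>)
  from assms show ?thesis unfolding has_slope_def fields prod.case
    by eventually_elim (simp add: algebra_simps)
qed

lemma has_slope_cmult:
  assumes "has_slope f d m"
  shows "has_slope (\<lambda>x. c * f x) d (c * m)"
proof (cases d)
  case (fields e t \<sigma>)
  from assms show ?thesis unfolding has_slope_def fields prod.case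
    by eventually_elim (simp add: algebra_simps)
qed

lemma has_slope_tendsto:
  assumes "has_slope f (e, t, \<sigma>) m"
  shows "((\<lambda>s. f (ep e (t + \<sigma> * s))) \<longlongrightarrow> f (ep e t)) (at_right 0)"
proof -
  have "((\<lambda>s. f (ep e t) + m * s) \<longlongrightarrow> f (ep e t) + m * 0) (at_right 0)"
    by (intro tendsto_intros)
  moreover have "\<forall>\<^sub>F s in at_right 0. f (ep e t) + m * s = f (ep e (t + \<sigma> * s))"
    using assms unfolding has_slope_def by (auto elim: eventually_mono)
  ultimately show ?thesis by (simp add: tendsto_cong)
qed

lemma has_slope_max_greater:
  assumes f: "has_slope f (e, t, \<sigma>) m" and g: "has_slope g (e, t, \<sigma>) n"
    and gt: "f (ep e t) > g (ep e t)"
  shows "has_slope (\<lambda>x. max (f x) (g x)) (e, t, \<sigma>) m"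
proof -
  have "((\<lambda>s. f (ep e (t + \<sigma> * s)) - g (ep e (t + \<sigma> * s))) \<longlongrightarrow> f (ep e t) - g (ep e t)) (at_right 0)"
    by (intro tendsto_intros has_slope_tendsto[OF f] has_slope_tendsto[OF g])
  then have "\<forall>\<^sub>F s in at_right 0. 0 < f (ep e (t + \<sigma> * s)) - g (ep e (t + \<sigma> * s))"
    using gt by (intro order_tendstoD) auto
  with f show ?thesis unfolding has_slope_def prod.case
    by eventually_elim (use gt in auto)
qed

lemma has_slope_max_eq:
  assumes f: "has_slope f (e, t, \<sigma>) m" and g: "has_slope g (e, t, \<sigma>) n"
    and eq: "f (ep e t) = g (ep e t)"
  shows "has_slope (\<lambda>x. max (f x) (g x)) (e, t, \<sigma>) (max m n)"
proof -
  have "\<forall>\<^sub>F s in at_right (0::real). s > 0" by (simp add: eventually_at_right_less)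
  with f g show ?thesis unfolding has_slope_def prod.case
    by eventually_elim (use eq in \<open>auto simp: max_def\<close>)
qed

text \<open>An affine germ is affine on a short interval, so nearby points inherit the slope
  \<open>m\<close> ahead and \<open>-m\<close> behind. The global arguments along an edge start from
  this form.\<close>

lemma has_slope_local:
  assumes v: "valid e t \<sigma>" and f: "has_slope f (e, t, \<sigma>) m"
  shows "\<forall>\<^sub>F s in at_right 0. has_slope f (e, t + \<sigma> * s, \<sigma>) m \<and> has_slope f (e, t + \<sigma> * s, -\<sigma>) (-m)"
proof -
  obtain b where b: "b > 0" "\<And>s. 0 < s \<Longrightarrow> s < b \<Longrightarrow> f (ep e (t + \<sigma> * s)) = f (ep e t) + m * s"
    using f unfolding has_slope_def eventually_at_right_field by auto
  have "has_slope f (e, t + \<sigma> * s, \<sigma>) m \<and> has_slope f (e, t + \<sigma> * s, -\<sigma>) (-m)" if s: "0 < s" "s < b" for s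
  proof -
    have "f (ep e (t + \<sigma> * s + \<sigma> * s')) = f (ep e (t + \<sigma> * s)) + m * s'" if "0 < s'" "s' < b - s" for s'
      using b(2)[of s] b(2)[of "s + s'"] s that by (simp add: algebra_simps)
    moreover have "f (ep e (t + \<sigma> * s + (- \<sigma>) * s')) = f (ep e (t + \<sigma> * s)) + (- m) * s'" if "0 < s'" "s' < s" for s'
      using b(2)[of s] b(2)[of "s - s'"] s that by (simp add: algebra_simps)
    ultimately show ?thesis unfolding has_slope_def eventually_at_right_field
      using s by (auto intro: exI[of _ "b - s"] exI[of _ s])
  qed
  then show ?thesis unfolding eventually_at_right_field using b(1) by blast
qed

lemma rat_const: "rat (\<lambda>_. c)"
  unfolding rat_def using has_slope_const[of c] by (intro allI impI exI[of _ 0]) simp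

lemma rat_add: "rat f \<Longrightarrow> rat g \<Longrightarrow> rat (\<lambda>x. f x + g x)"
  unfolding rat_def
proof (intro allI impI)
  fix e t \<sigma>
  assume h: "\<forall>e t \<sigma>. valid e t \<sigma> \<longrightarrow> (\<exists>m::int. has_slope f (e, t, \<sigma>) m)"
    "\<forall>e t \<sigma>. valid e t \<sigma> \<longrightarrow> (\<exists>m::int. has_slope g (e, t, \<sigma>) m)" "valid e t \<sigma>"
  then obtain m n :: int where "has_slope f (e, t, \<sigma>) m" "has_slope g (e, t, \<sigma>) n" by blast
  then have "has_slope (\<lambda>x. f x + g x) (e, t, \<sigma>) (real_of_int (m + n))"
    using has_slope_add by fastforce
  then show "\<exists>m::int. has_slope (\<lambda>x. f x + g x) (e, t, \<sigma>) m" by blast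
qed

lemma rat_cmult: "rat f \<Longrightarrow> rat (\<lambda>x. real_of_int c * f x)"
  unfolding rat_def
proof (intro allI impI)
  fix e t \<sigma>
  assume h: "\<forall>e t \<sigma>. valid e t \<sigma> \<longrightarrow> (\<exists>m::int. has_slope f (e, t, \<sigma>) m)" "valid e t \<sigma>"
  then obtain m :: int where "has_slope f (e, t, \<sigma>) m" by blast
  then have "has_slope (\<lambda>x. real_of_int c * f x) (e, t, \<sigma>) (real_of_int (c * m))"
    using has_slope_cmult by fastforce
  then show "\<exists>m::int. has_slope (\<lambda>x. real_of_int c * f x) (e, t, \<sigma>) m" by blast
qed

lemma rat_max:
  assumes f: "rat f" and g: "rat g"
  shows "rat (\<lambda>x. max (f x) (g x))"
  unfolding rat_def
proof (intro allI impI)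
  fix e t \<sigma> assume "valid e t \<sigma>"
  then obtain m n :: int where m: "has_slope f (e, t, \<sigma>) m" and n: "has_slope g (e, t, \<sigma>) n"
    using f g unfolding rat_def by meson
  consider "f (ep e t) > g (ep e t)" | "f (ep e t) < g (ep e t)" | "f (ep e t) = g (ep e t)" by linarith
  then show "\<exists>m::int. has_slope (\<lambda>x. max (f x) (g x)) (e, t, \<sigma>) m"
  proof cases
    case 1 then show ?thesis using has_slope_max_greater[OF m n] by blast
  next
    case 2 then show ?thesis using has_slope_max_greater[OF n m] by (auto simp: max.commute)
  next
    case 3 then show ?thesis using has_slope_max_eq[OF m n] unfolding of_int_max[symmetric] by blast
  qed
qed

lemma slope_const: "slope (\<lambda>_. c) d = 0"
  by (rule slope_eq) (simp add: has_slope_const)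

lemma ord_const: "ord (\<lambda>_. c) p = 0"
  by (simp add: ord_def slope_const)

lemma slope_add: "rat f \<Longrightarrow> rat g \<Longrightarrow> d \<in> dirs p \<Longrightarrow> slope (\<lambda>x. f x + g x) d = slope f d + slope g d"
  by (rule slope_eq) (simp add: has_slope_add rat_slope')

lemma ord_add: "rat f \<Longrightarrow> rat g \<Longrightarrow> ord (\<lambda>x. f x + g x) p = ord f p + ord g p"
  unfolding ord_def by (simp add: slope_add sum.distrib[symmetric])

lemma slope_cmult: "rat f \<Longrightarrow> d \<in> dirs p \<Longrightarrow> slope (\<lambda>x. real_of_int c * f x) d = c * slope f d"
  by (rule slope_eq) (simp add: has_slope_cmult rat_slope')

lemma ord_cmult: "rat f \<Longrightarrow> ord (\<lambda>x. real_of_int c * f x) p = c * ord f p"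
  unfolding ord_def by (simp add: slope_cmult sum_distrib_left)

lemma rat_uminus: "rat f \<Longrightarrow> rat (\<lambda>x. - f x)"
  using rat_cmult[of f "-1"] by simp

lemma ord_uminus: "rat f \<Longrightarrow> ord (\<lambda>x. - f x) p = - ord f p"
  using ord_cmult[of f "-1"] by simp

lemma slope_max_greater:
  assumes "rat f" "rat g" "f p > g p" "d \<in> dirs p"
  shows "slope (\<lambda>x. max (f x) (g x)) d = slope f d"
proof (cases d)
  case (fields e t \<sigma>)
  with assms show ?thesis
    by (intro slope_eq) (auto intro!: has_slope_max_greater[OF rat_slope rat_slope] dest!: dirsD)
qed

lemma slope_max_eq:
  assumes "rat f" "rat g" "f p = g p" "d \<in> dirs p"
  shows "slope (\<lambda>x. max (f x) (g x)) d = max (slope f d) (slope g d)"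
proof (cases d)
  case (fields e t \<sigma>)
  with assms show ?thesis
    by (intro slope_eq) (auto simp: of_int_max intro!: has_slope_max_eq[OF rat_slope rat_slope] dest!: dirsD)
qed

lemma ord_max_greater:
  "rat f \<Longrightarrow> rat g \<Longrightarrow> f p > g p \<Longrightarrow> ord (\<lambda>x. max (f x) (g x)) p = ord f p"
  unfolding ord_def by (rule sum.cong[OF refl]) (rule slope_max_greater)

text \<open>At a tie every slope of the maximum is the larger of the two slopes, so the order can
  only grow. Hence the functions \<open>f\<close> with \<open>D + ord f\<close> effective are closed
  under maxima.\<close>

lemma ord_max_ge:
  "rat f \<Longrightarrow> rat g \<Longrightarrow> f p \<ge> g p \<Longrightarrow> ord (\<lambda>x. max (f x) (g x)) p \<ge> ord f p"
  unfolding ord_def using slope_max_greater[of f g p] slope_max_eq[of f g p]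
  by (intro sum_mono) fastforce

lemma ord_max_ge':
  "rat f \<Longrightarrow> rat g \<Longrightarrow> g p \<ge> f p \<Longrightarrow> ord (\<lambda>x. max (f x) (g x)) p \<ge> ord g p"
  using ord_max_ge[of g f p] by (simp add: max.commute)

lemma rat_continuous:
  assumes f: "rat f" and e: "e \<in> A"
  shows "continuous_on {0..L e} (\<lambda>t. f (ep e t))"
  unfolding continuous_on_def
proof
  fix t assume t: "t \<in> {0..L e}"
  have R: "((\<lambda>t. f (ep e t)) \<longlongrightarrow> f (ep e t)) (at_right t)" if "t < L e"
  proof -
    have "valid e t 1" using t that e by (auto simp: valid_def)
    from has_slope_tendsto[OF rat_slope[OF f this]]
    have "((\<lambda>s. f (ep e (s + t))) \<longlongrightarrow> f (ep e t)) (at_right 0)" by (simp add: add.commute)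
    then show ?thesis by (subst at_right_to_0) (simp add: filterlim_filtermap)
  qed
  have Lf: "((\<lambda>t. f (ep e t)) \<longlongrightarrow> f (ep e t)) (at_left t)" if "0 < t"
  proof -
    have "valid e t (-1)" using t that e by (auto simp: valid_def)
    from has_slope_tendsto[OF rat_slope[OF f this]]
    have "((\<lambda>s. f (ep e (t - s))) \<longlongrightarrow> f (ep e t)) (at_right 0)" by simp
    then have "((\<lambda>s. f (ep e (- (s + - t)))) \<longlongrightarrow> f (ep e t)) (at_right 0)" by (simp add: algebra_simps)
    then have "((\<lambda>s. f (ep e (- s))) \<longlongrightarrow> f (ep e t)) (at_right (-t))"
      by (subst at_right_to_0) (simp add: filterlim_filtermap)
    then show ?thesis by (subst at_left_minus) (simp add: filterlim_filtermap)
  qed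
  show "((\<lambda>t. f (ep e t)) \<longlongrightarrow> f (ep e t)) (at t within {0..L e})"
  proof -
    have 1: "((\<lambda>t. f (ep e t)) \<longlongrightarrow> f (ep e t)) (at t within {t..L e})"
    proof (cases "t < L e")
      case True then show ?thesis using R by (simp add: at_within_Icc_at_right)
    next
      case False then have "{t..L e} - {t} = {}" using t by auto
      then show ?thesis unfolding at_within_def by (metis inf_bot_right principal_eq_bot_iff tendsto_bot)
    qed
    have 2: "((\<lambda>t. f (ep e t)) \<longlongrightarrow> f (ep e t)) (at t within {0..t})"
    proof (cases "0 < t")
      case True then show ?thesis using Lf by (simp add: at_within_Icc_at_left)
    next
      case False then have "{0..t} - {t} = {}" using t by auto
      then show ?thesis unfolding at_within_def by (metis inf_bot_right principal_eq_bot_iff tendsto_bot)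
    qed
    have "{0..L e} = {0..t} \<union> {t..L e}" using t by auto
    then show ?thesis using 1 2 by (simp add: Lim_within_Un)
  qed
qed

end

section \<open>Degrees and acyclic orientations\<close>

lemma divisor_degree_eq_sum:
  assumes "finite T" "{p. D p \<noteq> 0} \<subseteq> T"
  shows "divisor_degree D = sum D T"
  unfolding divisor_degree_def using assms by (intro sum.mono_neutral_left) auto

lemma finite_support_add:
  fixes D E :: "'a \<Rightarrow> int"
  assumes "finite {p. D p \<noteq> 0}" "finite {p. E p \<noteq> 0}"
  shows "finite {p. D p + E p \<noteq> 0}"
  by (rule finite_subset[OF _ finite_UnI[OF assms]]) auto

lemma finite_support_diff:
  fixes D E :: "'a \<Rightarrow> int"
  assumes "finite {p. D p \<noteq> 0}" "finite {p. E p \<noteq> 0}"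
  shows "finite {p. D p - E p \<noteq> 0}"
  by (rule finite_subset[OF _ finite_UnI[OF assms]]) auto

lemma divisor_degree_add:
  assumes "finite {p. D p \<noteq> 0}" "finite {p. E p \<noteq> 0}"
  shows "divisor_degree (\<lambda>p. D p + E p) = divisor_degree D + divisor_degree E"
proof -
  let ?T = "{p. D p \<noteq> 0} \<union> {p. E p \<noteq> 0}"
  have "finite ?T" using assms by simp
  then show ?thesis
    by (subst (1 2 3) divisor_degree_eq_sum[of ?T]) (auto simp: sum.distrib)
qed

lemma divisor_degree_uminus: "divisor_degree (\<lambda>p. - D p) = - divisor_degree D"
  by (simp add: divisor_degree_def sum_negf)

lemma divisor_degree_diff:
  assumes "finite {p. D p \<noteq> 0}" "finite {p. E p \<noteq> 0}"
  shows "divisor_degree (\<lambda>p. D p - E p) = divisor_degree D - divisor_degree E"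
  using divisor_degree_add[of D "\<lambda>p. - E p"] assms by (simp add: divisor_degree_uminus)

lemma divisor_degree_nonneg: "(\<And>p. 0 \<le> D p) \<Longrightarrow> 0 \<le> divisor_degree D"
  by (simp add: divisor_degree_def sum_nonneg)

lemma divisor_degree_eq_0D:
  assumes "divisor_degree D = 0" "finite {p. D p \<noteq> 0}" "\<And>p. 0 \<le> D p"
  shows "D p = 0"
  using assms sum_nonneg_eq_0_iff[of "{p. D p \<noteq> 0}" D] unfolding divisor_degree_def by auto

text \<open>Bisection for properties of intervals that survive concatenation. It is enough to treat
  short intervals that begin or end at a given point, because a short interval around
  \<open>x\<close> is cut at \<open>x\<close>.\<close>

lemma local_to_global:
  fixes a b :: real
  assumes fwd: "\<And>x. a \<le> x \<Longrightarrow> x < b \<Longrightarrow> \<forall>\<^sub>F s in at_right (0::real). P x (x + s)"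
    and bwd: "\<And>x. a < x \<Longrightarrow> x \<le> b \<Longrightarrow> \<forall>\<^sub>F s in at_right (0::real). P (x - s) x"
    and trans: "\<And>x y z. a \<le> x \<Longrightarrow> x < y \<Longrightarrow> y < z \<Longrightarrow> z \<le> b \<Longrightarrow> P x y \<Longrightarrow> P y z \<Longrightarrow> P x z"
    and ab: "a < b"
  shows "P a b"
proof -
  \<comment> \<open>\<open>Bolzano\<close> also asks about degenerate intervals and about those
    leaving \<open>{a..b}\<close>; \<open>Q\<close> is vacuously true there.\<close>
  define Q where "Q x y \<longleftrightarrow> (a \<le> x \<longrightarrow> x < y \<longrightarrow> y \<le> b \<longrightarrow> P x y)" for x y
  have "Q a b"
  proof (rule Bolzano)
    show "a \<le> b" using ab by simp
    show "Q x z" if "Q x y" "Q y z" "x \<le> y" "y \<le> z" for x y z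
    proof (cases "x = y \<or> y = z")
      case False
      then show ?thesis using that trans[of x y z] by (auto simp: Q_def)
    qed (use that in auto)
    fix x assume x: "a \<le> x" "x \<le> b"
    obtain r where r: "r > 0" "\<And>s. x < b \<Longrightarrow> 0 < s \<Longrightarrow> s < r \<Longrightarrow> P x (x + s)"
    proof (cases "x < b")
      case True
      then show ?thesis using fwd[OF x(1)] that unfolding eventually_at_right_field by auto
    qed (use that[of 1] in auto)
    obtain l where l: "l > 0" "\<And>s. a < x \<Longrightarrow> 0 < s \<Longrightarrow> s < l \<Longrightarrow> P (x - s) x"
    proof (cases "a < x")
      case True
      then show ?thesis using bwd[OF _ x(2)] that unfolding eventually_at_right_field by auto
    qed (use that[of 1] in auto)
    have "P y z" if yz: "y \<le> x" "x \<le> z" "z - y < min l r" "a \<le> y" "y < z" "z \<le> b" for y z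
    proof -
      have R: "x < z \<Longrightarrow> P x z" using r(2)[of "z - x"] yz by auto
      have L: "y < x \<Longrightarrow> P y x" using l(2)[of "x - y"] yz by auto
      consider "y = x" | "x = z" | "y < x" "x < z" using yz by linarith
      then show ?thesis
      proof cases
        case 3 show ?thesis by (rule trans[OF yz(4) 3 yz(6) L[OF 3(1)] R[OF 3(2)]])
      qed (use R L yz(5) in blast)+
    qed
    then show "\<exists>d>0. \<forall>y z. y \<le> x \<and> x \<le> z \<and> z - y < d \<longrightarrow> Q y z"
      using r(1) l(1) by (intro exI[of _ "min l r"]) (auto simp: Q_def)
  qed
  then show ?thesis using ab by (simp add: Q_def)
qed

text \<open>\<open>R\<close> and \<open>B\<close> give outgoing slopes in the forward and the backward direction.\<close>
lemma telescope_slopes: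
  fixes R B :: "real \<Rightarrow> int"
  assumes fwd: "\<And>t. a \<le> t \<Longrightarrow> t < b \<Longrightarrow> \<forall>\<^sub>F s in at_right 0. R (t + s) = R t \<and> B (t + s) = - R t"
    and bwd: "\<And>t. a < t \<Longrightarrow> t \<le> b \<Longrightarrow> \<forall>\<^sub>F s in at_right 0. B (t - s) = B t \<and> R (t - s) = - B t"
    and ab: "a < b"
  defines "J \<equiv> \<lambda>x y. {t. x < t \<and> t < y \<and> R t + B t \<noteq> 0}"
  shows "finite (J a b) \<and> (\<Sum>t \<in> J a b. R t + B t) = - R a - B b"
proof (rule local_to_global[where P = "\<lambda>x y. finite (J x y) \<and> (\<Sum>t \<in> J x y. R t + B t) = - R x - B y"])
  show "\<forall>\<^sub>F s in at_right 0. finite (J x (x + s)) \<and> (\<Sum>t \<in> J x (x + s). R t + B t) = - R x - B (x + s)"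
    if x: "a \<le> x" "x < b" for x
  proof -
    obtain r where r: "r > 0" "\<And>s. 0 < s \<Longrightarrow> s < r \<Longrightarrow> R (x + s) = R x \<and> B (x + s) = - R x"
      using fwd[OF x] unfolding eventually_at_right_field by auto
    have "J x (x + s) = {}" if "s < r" for s
    proof -
      have "R t + B t = 0" if "x < t" "t < x + s" for t using r(2)[of "t - x"] that \<open>s < r\<close> by simp
      then show ?thesis by (auto simp: J_def)
    qed
    then show ?thesis unfolding eventually_at_right_field using r by (intro exI[of _ r]) auto
  qed
  show "\<forall>\<^sub>F s in at_right 0. finite (J (x - s) x) \<and> (\<Sum>t \<in> J (x - s) x. R t + B t) = - R (x - s) - B x"
    if x: "a < x" "x \<le> b" for x
  proof -
    obtain r where r: "r > 0" "\<And>s. 0 < s \<Longrightarrow> s < r \<Longrightarrow> B (x - s) = B x \<and> R (x - s) = - B x"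
      using bwd[OF x] unfolding eventually_at_right_field by auto
    have "J (x - s) x = {}" if "s < r" for s
    proof -
      have "R t + B t = 0" if "x - s < t" "t < x" for t using r(2)[of "x - t"] that \<open>s < r\<close> by simp
      then show ?thesis by (auto simp: J_def)
    qed
    then show ?thesis unfolding eventually_at_right_field using r by (intro exI[of _ r]) auto
  qed
  fix x y z assume lt: "x < y" "y < z"
    and 1: "finite (J x y) \<and> (\<Sum>t \<in> J x y. R t + B t) = - R x - B y"
    and 2: "finite (J y z) \<and> (\<Sum>t \<in> J y z. R t + B t) = - R y - B z"
  \<comment> \<open>The junction \<open>y\<close> contributes \<open>R y + B y\<close>, which
    cancels the boundary terms \<open>- B y\<close> and \<open>- R y\<close> of the two
    parts.\<close>
  have J: "J x z = (J x y \<union> J y z) \<union> {t \<in> {y}. R t + B t \<noteq> 0}" using lt by (auto simp: J_def)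
  have "{t \<in> {y}. R t + B t \<noteq> 0} = (if R y + B y \<noteq> 0 then {y} else {})" by auto
  then have "(\<Sum>t \<in> {t \<in> {y}. R t + B t \<noteq> 0}. R t + B t) = R y + B y" by simp
  moreover have "(\<Sum>t \<in> J x z. R t + B t) = (\<Sum>t \<in> J x y \<union> J y z. R t + B t)
      + (\<Sum>t \<in> {t \<in> {y}. R t + B t \<noteq> 0}. R t + B t)"
    unfolding J using 1 2 by (intro sum.union_disjoint) (auto simp: J_def)
  moreover have "(\<Sum>t \<in> J x y \<union> J y z. R t + B t) = (\<Sum>t \<in> J x y. R t + B t) + (\<Sum>t \<in> J y z. R t + B t)"
    using 1 2 by (intro sum.union_disjoint) (auto simp: J_def)
  ultimately show "finite (J x z) \<and> (\<Sum>t \<in> J x z. R t + B t) = - R x - B z"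
    using 1 2 J by auto
qed (rule ab)

context metric_network
begin

lemma dirs_outside: "p \<notin> pts \<Longrightarrow> dirs p = {}"
  using valid_in_pts by (auto simp: dirs_def)

lemma ord_outside: "p \<notin> pts \<Longrightarrow> ord f p = 0"
  by (simp add: ord_def dirs_outside)

text \<open>Telescoping along each edge leaves the two end contributions, and the vertex sums
  contain exactly these with the opposite sign. An arbitrary \<open>m\<close> is allowed because the
  result is applied twice: to the slopes, for the degree of \<open>ord f\<close>, and to their
  signs, for the degree of \<open>nu \<phi>\<close>.\<close>

lemma degree_local_slopes:
  fixes m :: "'e \<times> real \<times> real \<Rightarrow> int"
  assumes loc: "\<And>e t \<sigma>. valid e t \<sigma> \<Longrightarrow>
      \<forall>\<^sub>F s in at_right 0. m (e, t + \<sigma> * s, \<sigma>) = m (e, t, \<sigma>) \<and> m (e, t + \<sigma> * s, - \<sigma>) = - m (e, t, \<sigma>)"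
  shows "finite {p. (\<Sum>d \<in> dirs p. m d) \<noteq> 0}" "divisor_degree (\<lambda>p. \<Sum>d \<in> dirs p. m d) = 0"
proof -
  define J where "J e = {t. 0 < t \<and> t < L e \<and> m (e, t, 1) + m (e, t, -1) \<noteq> 0}" for e
  have J: "finite (J e) \<and> (\<Sum>t \<in> J e. m (e, t, 1) + m (e, t, -1)) = - m (e, 0, 1) - m (e, L e, -1)"
    if e: "e \<in> A" for e
    unfolding J_def
  proof (rule telescope_slopes[where R = "\<lambda>t. m (e, t, 1)" and B = "\<lambda>t. m (e, t, -1)"])
    fix t :: real
    show "\<forall>\<^sub>F s in at_right 0. m (e, t + s, 1) = m (e, t, 1) \<and> m (e, t + s, -1) = - m (e, t, 1)"
      if "0 \<le> t" "t < L e"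
      using loc[of e t 1] that e by (simp add: valid_def)
    show "\<forall>\<^sub>F s in at_right 0. m (e, t - s, -1) = m (e, t, -1) \<and> m (e, t - s, 1) = - m (e, t, -1)"
      if "0 < t" "t \<le> L e"
      using loc[of e t "-1"] that e by (simp add: valid_def)
  qed (use L_pos e in auto)
  define D where "D p = (\<Sum>d \<in> dirs p. m d)" for p
  define I where "I = (\<lambda>(e, t). Inner e t :: ('v, 'e) point) ` (SIGMA e:A. J e)"
  have fI: "finite I" using J finite_A by (auto simp: I_def)
  have supp: "{p. D p \<noteq> 0} \<subseteq> Vertex ` V \<union> I"
  proof
    fix p assume "p \<in> {p. D p \<noteq> 0}"
    then have p: "D p \<noteq> 0" by simp
    then have "p \<in> pts" by (cases "p \<in> pts") (auto simp: D_def dirs_outside)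
    then show "p \<in> Vertex ` V \<union> I" using p
      by (cases p) (auto simp: D_def sum_dirs_Inner I_def J_def image_iff Bex_def)
  qed
  with fI show "finite {p. (\<Sum>d \<in> dirs p. m d) \<noteq> 0}"
    unfolding D_def[symmetric] using finite_V by (meson finite_UnI finite_imageI finite_subset)
  have "divisor_degree D = sum D (Vertex ` V \<union> I)"
    using supp fI finite_V by (intro divisor_degree_eq_sum) auto
  also have "\<dots> = sum D (Vertex ` V) + sum D I"
    using fI finite_V by (intro sum.union_disjoint) (auto simp: I_def)
  also have "sum D (Vertex ` V) = (\<Sum>v\<in>V. \<Sum>e | e \<in> A \<and> src e = v. m (e, 0, 1))
      + (\<Sum>v\<in>V. \<Sum>e | e \<in> A \<and> tgt e = v. m (e, L e, -1))"
    by (simp add: sum.reindex inj_on_def D_def sum_dirs_Vertex sum.distrib)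
  also have "\<dots> = (\<Sum>e\<in>A. m (e, 0, 1)) + (\<Sum>e\<in>A. m (e, L e, -1))"
  proof -
    have "(\<Sum>v\<in>V. \<Sum>e | e \<in> A \<and> src e = v. m (e, 0, 1)) = (\<Sum>e\<in>A. m (e, 0, 1))"
      using finite_A finite_V src_in by (intro sum.group) auto
    moreover have "(\<Sum>v\<in>V. \<Sum>e | e \<in> A \<and> tgt e = v. m (e, L e, -1)) = (\<Sum>e\<in>A. m (e, L e, -1))"
      using finite_A finite_V tgt_in by (intro sum.group) auto
    ultimately show ?thesis by simp
  qed
  also have "sum D I = (\<Sum>(e, t) \<in> (SIGMA e:A. J e). m (e, t, 1) + m (e, t, -1))"
    unfolding I_def
    by (subst sum.reindex) (auto simp: inj_on_def D_def sum_dirs_Inner J_def intro!: sum.cong)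
  also have "\<dots> = (\<Sum>e\<in>A. \<Sum>t\<in>J e. m (e, t, 1) + m (e, t, -1))"
    using J finite_A by (intro sum.Sigma[symmetric]) auto
  also have "\<dots> = (\<Sum>e\<in>A. - m (e, 0, 1) - m (e, L e, -1))"
    using J by (intro sum.cong) auto
  finally show "divisor_degree (\<lambda>p. \<Sum>d \<in> dirs p. m d) = 0"
    unfolding D_def by (simp add: sum_subtractf sum_negf)
qed

lemma slope_local:
  assumes f: "rat f" and v: "valid e t \<sigma>"
  shows "\<forall>\<^sub>F s in at_right 0. slope f (e, t + \<sigma> * s, \<sigma>) = slope f (e, t, \<sigma>)
    \<and> slope f (e, t + \<sigma> * s, - \<sigma>) = - slope f (e, t, \<sigma>)"
  using has_slope_local[OF v rat_slope[OF f v]] by eventually_elim (auto intro!: slope_eq)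

lemma finite_ord: "rat f \<Longrightarrow> finite {p. ord f p \<noteq> 0}"
  unfolding ord_def by (rule degree_local_slopes(1)) (rule slope_local)

lemma degree_ord: "rat f \<Longrightarrow> divisor_degree (ord f) = 0"
  using degree_local_slopes(2)[of "slope f"] slope_local by (simp add: ord_def[abs_def])

section \<open>Acyclic orientations given by functions\<close>

definition morse :: "(('v, 'e) point \<Rightarrow> real) \<Rightarrow> bool" where
  "morse \<phi> \<longleftrightarrow> rat \<phi> \<and> (\<forall>e t \<sigma>. valid e t \<sigma> \<longrightarrow> slope \<phi> (e, t, \<sigma>) \<noteq> 0)"

text \<open>The indegree minus 1 for the acyclic orientation in which \<open>\<phi>\<close> increases.\<close>
definition nu :: "(('v, 'e) point \<Rightarrow> real) \<Rightarrow> ('v, 'e) point \<Rightarrow> int" where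
  "nu \<phi> p = (if p \<in> pts then int (card {d \<in> dirs p. slope \<phi> d < 0}) - 1 else 0)"

definition K :: "('v, 'e) point \<Rightarrow> int" where
  "K p = (if p \<in> pts then int (card (dirs p)) - 2 else 0)"

lemma card_dirs_Inner: "e \<in> A \<Longrightarrow> 0 < t \<Longrightarrow> t < L e \<Longrightarrow> card (dirs (Inner e t)) = 2"
  by (simp add: dirs_Inner)

lemma K_support: "{p. K p \<noteq> 0} \<subseteq> Vertex ` V"
proof
  fix p assume "p \<in> {p. K p \<noteq> 0}"
  then show "p \<in> Vertex ` V" by (cases p) (auto simp: K_def card_dirs_Inner split: if_splits)
qed

lemma finite_K: "finite {p. K p \<noteq> 0}"
  using K_support finite_V by (meson finite_imageI finite_subset)

lemma degree_K: "divisor_degree K = 2 * (int (card A) - int (card V))"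
proof -
  have c: "int (card (dirs p)) = (\<Sum>d\<in>dirs p. 1)" for p by simp
  have "divisor_degree K = sum K (Vertex ` V)"
    using K_support finite_V by (intro divisor_degree_eq_sum) auto
  also have "\<dots> = (\<Sum>v\<in>V. (\<Sum>e | e \<in> A \<and> src e = v. 1) + (\<Sum>e | e \<in> A \<and> tgt e = v. 1) - 2)"
    by (simp add: sum.reindex inj_on_def K_def c sum_dirs_Vertex del: sum_constant)
  also have "\<dots> = (\<Sum>v\<in>V. \<Sum>e | e \<in> A \<and> src e = v. 1) + (\<Sum>v\<in>V. \<Sum>e | e \<in> A \<and> tgt e = v. 1) - 2 * int (card V)"
    by (simp add: sum.distrib sum_subtractf)
  also have "(\<Sum>v\<in>V. \<Sum>e | e \<in> A \<and> src e = v. 1::int) = (\<Sum>e\<in>A. 1)"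
    using finite_A finite_V src_in by (intro sum.group) auto
  also have "(\<Sum>v\<in>V. \<Sum>e | e \<in> A \<and> tgt e = v. 1::int) = (\<Sum>e\<in>A. 1)"
    using finite_A finite_V tgt_in by (intro sum.group) auto
  finally show ?thesis by simp
qed

lemma morse_rat: "morse \<phi> \<Longrightarrow> rat \<phi>"
  by (simp add: morse_def)

lemma morse_uminus: "morse \<phi> \<Longrightarrow> morse (\<lambda>x. - \<phi> x)"
  unfolding morse_def
  by (auto simp: rat_uminus dirs_def slope_cmult[of \<phi> _ _ "-1", simplified])

text \<open>Reversing the orientation exchanges indegree and outdegree, and (indegree - 1) +
  (outdegree - 1) = valence - 2.\<close>

lemma nu_uminus:
  assumes "morse \<phi>"
  shows "nu (\<lambda>x. - \<phi> x) p = K p - nu \<phi> p"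
proof (cases "p \<in> pts")
  case True
  have s: "slope (\<lambda>x. - \<phi> x) d = - slope \<phi> d" if "d \<in> dirs p" for d
    using slope_cmult[of \<phi> d p "-1"] that assms by (simp add: morse_def)
  have "card (dirs p) = card {d \<in> dirs p. slope \<phi> d < 0} + card {d \<in> dirs p. slope \<phi> d > 0}"
  proof -
    have "slope \<phi> d \<noteq> 0" if "d \<in> dirs p" for d
      using assms that by (cases d) (auto simp: morse_def dirs_def)
    then have "dirs p = {d \<in> dirs p. slope \<phi> d < 0} \<union> {d \<in> dirs p. slope \<phi> d > 0}"
      by (auto simp: neq_iff)
    then have "card (dirs p) = card ({d \<in> dirs p. slope \<phi> d < 0} \<union> {d \<in> dirs p. slope \<phi> d > 0})"
      by (rule arg_cong)
    also have "\<dots> = card {d \<in> dirs p. slope \<phi> d < 0} + card {d \<in> dirs p. slope \<phi> d > 0}"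
      using finite_dirs[OF True] by (intro card_Un_disjoint) auto
    finally show ?thesis .
  qed
  moreover have "{d \<in> dirs p. slope (\<lambda>x. - \<phi> x) d < 0} = {d \<in> dirs p. slope \<phi> d > 0}"
    using s by auto
  ultimately show ?thesis using True by (simp add: nu_def K_def)
qed (simp add: nu_def K_def)

text \<open>The signs of the slopes obey the same local rule as the slopes, so the divisor
  \<open>S\<close> of outdegree minus indegree has degree 0. Since
  \<open>K - S = 2 * nu \<phi>\<close>, the degree of \<open>nu \<phi>\<close> is half that of
  \<open>K\<close>.\<close>

lemma nu_degree:
  assumes "morse \<phi>"
  shows "finite {p. nu \<phi> p \<noteq> 0}" "divisor_degree (nu \<phi>) = int (card A) - int (card V)"
proof -
  have r: "rat \<phi>" using assms by (rule morse_rat)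
  let ?m = "\<lambda>d. sgn (slope \<phi> d)"
  have loc: "\<forall>\<^sub>F s in at_right 0. ?m (e, t + \<sigma> * s, \<sigma>) = ?m (e, t, \<sigma>) \<and> ?m (e, t + \<sigma> * s, - \<sigma>) = - ?m (e, t, \<sigma>)"
    if "valid e t \<sigma>" for e t \<sigma>
    using slope_local[OF r that] by eventually_elim (auto simp: sgn_if)
  define S where "S p = (\<Sum>d\<in>dirs p. ?m d)" for p
  have S: "finite {p. S p \<noteq> 0}" "divisor_degree S = 0"
    unfolding S_def by (rule degree_local_slopes[OF loc], assumption)+
  have eq: "K p - S p = 2 * nu \<phi> p" for p
  proof (cases "p \<in> pts")
    case True
    let ?N = "{d \<in> dirs p. slope \<phi> d < 0}"
    have "K p - S p + 2 = (\<Sum>d\<in>dirs p. 1 - ?m d)"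
      using True by (simp add: K_def S_def sum_subtractf)
    also have "\<dots> = (\<Sum>d\<in>dirs p. if slope \<phi> d < 0 then 2 else 0)"
      using assms by (intro sum.cong) (auto simp: morse_def dirs_def sgn_if)
    also have "\<dots> = 2 * int (card ?N)"
      using finite_dirs[OF True] by (simp add: sum.If_cases Int_def)
    finally show ?thesis using True by (simp add: nu_def)
  qed (simp add: K_def S_def nu_def dirs_outside)
  have "{p. nu \<phi> p \<noteq> 0} = {p. K p - S p \<noteq> 0}" using eq by auto
  then show "finite {p. nu \<phi> p \<noteq> 0}"
    using finite_support_add[OF finite_K, of "\<lambda>p. - S p"] S(1) by simp
  have "divisor_degree (\<lambda>p. K p - S p) = 2 * (int (card A) - int (card V))"
    using divisor_degree_diff[OF finite_K S(1)] S(2) degree_K by simp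
  moreover have "divisor_degree (\<lambda>p. K p - S p) = 2 * divisor_degree (nu \<phi>)"
    unfolding eq by (simp add: divisor_degree_def sum_distrib_left)
  ultimately show "divisor_degree (nu \<phi>) = int (card A) - int (card V)" by simp
qed

text \<open>The points carry no topology here, so compactness is used edge by edge; the minimum is
  then found among the finitely many edge minima and the vertices in \<open>M\<close>.\<close>

lemma attains_min:
  assumes M: "M \<subseteq> pts" "M \<noteq> {}" and g: "rat g"
    and cl: "\<And>e. e \<in> A \<Longrightarrow> compact {t \<in> {0..L e}. ep e t \<in> M}"
  shows "\<exists>p\<in>M. \<forall>p'\<in>M. g p \<le> g p'"
proof -
  define C where "C e = {t \<in> {0..L e}. ep e t \<in> M}" for e
  have "\<exists>u\<in>C e. \<forall>t\<in>C e. g (ep e u) \<le> g (ep e t)" if "e \<in> A" "C e \<noteq> {}" for e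
  proof (rule continuous_attains_inf)
    show "compact (C e)" using cl that by (simp add: C_def)
    show "continuous_on (C e) (\<lambda>t. g (ep e t))"
      by (rule continuous_on_subset[OF rat_continuous[OF g that(1)]]) (auto simp: C_def)
  qed fact
  then obtain u where u: "\<And>e. e \<in> A \<Longrightarrow> C e \<noteq> {} \<Longrightarrow> u e \<in> C e"
    "\<And>e t. e \<in> A \<Longrightarrow> C e \<noteq> {} \<Longrightarrow> t \<in> C e \<Longrightarrow> g (ep e (u e)) \<le> g (ep e t)"
    by metis
  define Q where "Q = (Vertex ` V \<inter> M) \<union> (\<lambda>e. ep e (u e)) ` {e \<in> A. C e \<noteq> {}}"
  have cover: "\<exists>q\<in>Q. g q \<le> g p" if "p \<in> M" for p
  proof -
    have "p \<in> pts" using M that by auto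
    then show ?thesis
    proof (cases rule: pts_cases)
      case (1 v) then show ?thesis using that by (auto simp: Q_def)
    next
      case (2 e t)
      then have "t \<in> C e" using that by (auto simp: C_def)
      then show ?thesis using u(2)[of e t] 2 by (auto simp: Q_def)
    qed
  qed
  have Q: "finite Q" "Q \<subseteq> M" using finite_V finite_A u(1) by (auto simp: Q_def C_def)
  have "Q \<noteq> {}" using cover M(2) by blast
  then obtain q where "q \<in> Q" "\<And>q'. q' \<in> Q \<Longrightarrow> g q \<le> g q'"
    using arg_min_if_finite[OF Q(1), of g] by (metis not_less)
  then show ?thesis using cover Q(2) by (meson order_trans subsetD)
qed

lemma pts_ne: "pts \<noteq> {}"
  using V_ne by (auto simp: pts_def)

text \<open>The inequality holds at the lowest point with respect to \<open>\<phi>\<close> of the set where \<open>f\<close> is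
  maximal: \<open>f\<close> decreases in every direction in which \<open>\<phi>\<close> does.\<close>
lemma nu_not_effective:
  assumes "morse \<phi>" "rat f"
  shows "\<exists>p\<in>pts. nu \<phi> p + ord f p < 0"
proof -
  have "\<exists>p\<in>pts. \<forall>p'\<in>pts. - f p \<le> - f p'"
  proof (rule attains_min)
    show "compact {t \<in> {0..L e}. ep e t \<in> pts}" if "e \<in> A" for e
    proof -
      have "{t \<in> {0..L e}. ep e t \<in> pts} = {0..L e}" using that ep_in_pts by auto
      then show ?thesis by simp
    qed
  qed (use pts_ne assms in \<open>auto simp: rat_uminus\<close>)
  then obtain x where x: "x \<in> pts" "\<And>p. p \<in> pts \<Longrightarrow> f p \<le> f x" by auto
  define M where "M = {p \<in> pts. f p = f x}"
  have "\<exists>p\<in>M. \<forall>p'\<in>M. \<phi> p \<le> \<phi> p'"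
  proof (rule attains_min)
    show "compact {t \<in> {0..L e}. ep e t \<in> M}" if e: "e \<in> A" for e
    proof -
      have "{t \<in> {0..L e}. ep e t \<in> M} = {0..L e} \<inter> (\<lambda>t. f (ep e t)) -` {f x}"
        using e ep_in_pts by (auto simp: M_def)
      moreover have "closed ({0..L e} \<inter> (\<lambda>t. f (ep e t)) -` {f x})"
        by (intro continuous_closed_preimage rat_continuous assms e) auto
      moreover have "bounded ({0..L e} \<inter> (\<lambda>t. f (ep e t)) -` {f x})"
        by (rule bounded_subset[of "{0..L e}"]) auto
      ultimately show ?thesis by (simp add: compact_eq_bounded_closed)
    qed
  qed (use x assms in \<open>auto simp: M_def morse_def\<close>)
  then obtain p where p: "p \<in> M" and min: "\<And>p'. p' \<in> M \<Longrightarrow> \<phi> p \<le> \<phi> p'" by blast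
  have pp: "p \<in> pts" "f p = f x" using p by (auto simp: M_def)
  \<comment> \<open>No direction at \<open>p\<close> increases \<open>f\<close>. If \<open>f\<close>
    were constant in a direction in which \<open>\<phi>\<close> decreases, nearby points would lie
    in \<open>M\<close> below \<open>p\<close>. So \<open>f\<close> decreases there, and by
    integrality the slope is at most -1.\<close>
  have sl: "slope f d \<le> (if slope \<phi> d < 0 then -1 else 0)" if d: "d \<in> dirs p" for d
  proof -
    obtain e t \<sigma> where dd: "d = (e, t, \<sigma>)" by (cases d)
    have v: "valid e t \<sigma>" and ept: "ep e t = p" using dirsD d dd by auto
    have pos: "\<forall>\<^sub>F s in at_right (0::real). s > 0" by (simp add: eventually_at_right_less)
    have inpts: "\<forall>\<^sub>F s in at_right 0. ep e (t + \<sigma> * s) \<in> pts"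
      using eventually_valid[OF v] by eventually_elim (auto intro: valid_in_pts)
    have f: "\<forall>\<^sub>F s in at_right (0::real). f (ep e (t + \<sigma> * s)) = f p + slope f d * s"
      using rat_slope'[OF assms(2) d] by (simp add: has_slope_def dd ept)
    have \<phi>: "\<forall>\<^sub>F s in at_right (0::real). \<phi> (ep e (t + \<sigma> * s)) = \<phi> p + slope \<phi> d * s"
      using rat_slope'[OF morse_rat[OF assms(1)] d] by (simp add: has_slope_def dd ept)
    have "\<forall>\<^sub>F s in at_right (0::real). slope f d \<le> 0 \<and> \<not> (slope f d = 0 \<and> slope \<phi> d < 0)"
      using pos inpts f \<phi>
    proof eventually_elim
      case (elim s)
      have "f p + slope f d * s \<le> f p" using elim x(2) pp by metis
      then have le: "slope f d \<le> 0" using elim(1) by (simp add: mult_le_0_iff)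
      moreover have False if "slope f d = 0" "slope \<phi> d < 0"
      proof -
        have "ep e (t + \<sigma> * s) \<in> M" using elim that pp by (simp add: M_def)
        from min[OF this] have "0 \<le> slope \<phi> d * s" using elim by simp
        then show False using that elim(1) by (simp add: zero_le_mult_iff)
      qed
      ultimately show ?case by blast
    qed
    then have "slope f d \<le> 0 \<and> \<not> (slope f d = 0 \<and> slope \<phi> d < 0)" by simp
    then show ?thesis by auto
  qed
  have "ord f p \<le> (\<Sum>d\<in>dirs p. if slope \<phi> d < 0 then -1 else 0)"
    unfolding ord_def by (rule sum_mono) (rule sl)
  also have "\<dots> = - int (card {d \<in> dirs p. slope \<phi> d < 0})"
    using finite_dirs[OF pp(1)] by (simp add: sum.If_cases Int_def)
  finally show ?thesis using pp(1) by (intro bexI[of _ p]) (auto simp: nu_def)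
qed

end

section \<open>Interpolation with integer slopes\<close>

text \<open>The slope at 0, to the right, of the maximum of two affine functions with values
  \<open>x\<close>, \<open>y\<close> and slopes \<open>m\<close>, \<open>n\<close> at 0.\<close>

definition branch :: "real \<Rightarrow> real \<Rightarrow> int \<Rightarrow> int \<Rightarrow> int" where
  "branch x y m n = (if x > y then m else if x < y then n else max m n)"

lemma max_affine_right:
  fixes x y :: real
  shows "\<forall>\<^sub>F s in at_right 0. max (x + real_of_int m * s) (y + real_of_int n * s)
      = max x y + real_of_int (branch x y m n) * s"
proof -
  have pos: "\<forall>\<^sub>F s in at_right (0::real). s > 0" by (simp add: eventually_at_right_less)
  have t: "((\<lambda>s. (x + real_of_int m * s) - (y + real_of_int n * s)) \<longlongrightarrow> (x + real_of_int m * 0) - (y + real_of_int n * 0)) (at_right 0)"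
    by (intro tendsto_intros)
  consider "x > y" | "x < y" | "x = y" by linarith
  then show ?thesis
  proof cases
    case 1
    then have "\<forall>\<^sub>F s in at_right 0. 0 < (x + real_of_int m * s) - (y + real_of_int n * s)"
      by (intro order_tendstoD[OF t]) auto
    then show ?thesis by eventually_elim (use 1 in \<open>auto simp: branch_def\<close>)
  next
    case 2
    then have "\<forall>\<^sub>F s in at_right 0. (x + real_of_int m * s) - (y + real_of_int n * s) < 0"
      by (intro order_tendstoD[OF t]) auto
    then show ?thesis by eventually_elim (use 2 in \<open>auto simp: branch_def\<close>)
  next
    case 3
    from pos show ?thesis by eventually_elim (use 3 in \<open>auto simp: branch_def max_def\<close>)
  qed
qed

text \<open>The convex function on \<open>{0..l}\<close> with integer slopes and boundary values \<open>\<alpha>\<close>, \<open>\<beta>\<close>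
  that has at most one kink.\<close>
definition bridge :: "real \<Rightarrow> real \<Rightarrow> real \<Rightarrow> real \<Rightarrow> real" where
  "bridge \<alpha> \<beta> l s = max (\<alpha> + of_int \<lfloor>(\<beta> - \<alpha>) / l\<rfloor> * s) (\<beta> + of_int \<lfloor>(\<alpha> - \<beta>) / l\<rfloor> * (l - s))"

lemma floor_mult_le: "0 < (l::real) \<Longrightarrow> of_int \<lfloor>x / l\<rfloor> * l \<le> x"
  by (metis floor_correct mult.commute pos_le_divide_eq mult_of_int_commute)

lemma bridge_0: "0 < l \<Longrightarrow> bridge \<alpha> \<beta> l 0 = \<alpha>"
  using floor_mult_le[of l "\<alpha> - \<beta>"] by (simp add: bridge_def)

lemma bridge_l: "0 < l \<Longrightarrow> bridge \<alpha> \<beta> l l = \<beta>"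
  using floor_mult_le[of l "\<beta> - \<alpha>"] by (simp add: bridge_def)

text \<open>The two affine pieces of \<open>bridge\<close> have slopes
  \<open>\<lfloor>(\<beta> - \<alpha>) / l\<rfloor>\<close> and
  \<open>- \<lfloor>(\<alpha> - \<beta>) / l\<rfloor>\<close>; this compares them.\<close>

lemma floor_opposite:
  "\<lfloor>(\<beta> - \<alpha>) / l :: real\<rfloor> \<le> - \<lfloor>(\<alpha> - \<beta>) / l\<rfloor>"
proof -
  have "of_int \<lfloor>(\<beta> - \<alpha>) / l\<rfloor> \<le> (\<beta> - \<alpha>) / l" "of_int \<lfloor>(\<alpha> - \<beta>) / l\<rfloor> \<le> (\<alpha> - \<beta>) / l" by simp_all
  then have "of_int \<lfloor>(\<beta> - \<alpha>) / l\<rfloor> + of_int \<lfloor>(\<alpha> - \<beta>) / l\<rfloor> \<le> (\<beta> - \<alpha>) / l + (\<alpha> - \<beta>) / l" by linarith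
  also have "\<dots> = 0" by (simp add: diff_divide_distrib)
  finally show ?thesis by linarith
qed

text \<open>If the piece that starts at one end reaches the prescribed value at the other end
  exactly, the quotient is an integer and both pieces of the bridge have the same slope. This
  settles the ties at nodes.\<close>

lemma floor_opposite_eq:
  assumes "of_int \<lfloor>(\<beta> - \<alpha>) / l :: real\<rfloor> * l = \<beta> - \<alpha>" "0 < l"
  shows "\<lfloor>(\<alpha> - \<beta>) / l\<rfloor> = - \<lfloor>(\<beta> - \<alpha>) / l\<rfloor>"
proof -
  have e: "(\<beta> - \<alpha>) / l = of_int \<lfloor>(\<beta> - \<alpha>) / l\<rfloor>" using assms by (simp add: field_simps)
  have "(\<alpha> - \<beta>) / l = - ((\<beta> - \<alpha>) / l)" by (simp add: minus_divide_left)
  also have "\<dots> = of_int (- \<lfloor>(\<beta> - \<alpha>) / l\<rfloor>)" using e by simp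
  finally show ?thesis by (metis floor_of_int)
qed

context metric_network
begin

text \<open>The point required inside every edge makes the subdivided graph free of loops:
  consecutive nodes are then different points, and an injective rank separates them.\<close>

definition nodes :: "('v, 'e) point set \<Rightarrow> bool" where
  "nodes S \<longleftrightarrow> finite S \<and> S \<subseteq> pts \<and> Vertex ` V \<subseteq> S \<and>
     (\<forall>e\<in>A. \<exists>t. 0 < t \<and> t < L e \<and> Inner e t \<in> S)"

text \<open>Parameters are used instead of points because the base of a loop has two parameters on
  it.\<close>

definition params :: "('v, 'e) point set \<Rightarrow> 'e \<Rightarrow> real set" where
  "params S e = {t. 0 \<le> t \<and> t \<le> L e \<and> ep e t \<in> S}"

definition consec :: "('v, 'e) point set \<Rightarrow> 'e \<Rightarrow> real \<Rightarrow> real \<Rightarrow> bool" where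
  "consec S e a b \<longleftrightarrow> e \<in> A \<and> a \<in> params S e \<and> b \<in> params S e \<and> a < b \<and>
     (\<forall>t. a < t \<longrightarrow> t < b \<longrightarrow> t \<notin> params S e)"

text \<open>The starting point need not be a node: \<open>interp\<close> uses this to find the two
  nodes around an inner point.\<close>

definition nxt :: "('v, 'e) point set \<Rightarrow> 'e \<times> real \<times> real \<Rightarrow> real" where
  "nxt S d = (case d of (e, t, \<sigma>) \<Rightarrow>
     if \<sigma> = 1 then Min {b \<in> params S e. t < b} else Max {a \<in> params S e. a < t})"

definition nb :: "('v, 'e) point set \<Rightarrow> 'e \<times> real \<times> real \<Rightarrow> ('v, 'e) point" where
  "nb S d = ep (fst d) (nxt S d)"

definition gap :: "('v, 'e) point set \<Rightarrow> 'e \<times> real \<times> real \<Rightarrow> real" where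
  "gap S d = \<bar>nxt S d - fst (snd d)\<bar>"

text \<open>Prescribed values at the nodes are extended by bridges. The default \<open>0\<close> is
  reached only at vertices outside \<open>V\<close>, because \<open>nodes S\<close> puts all of
  \<open>V\<close> into \<open>S\<close>.\<close>

definition interp :: "('v, 'e) point set \<Rightarrow> (('v, 'e) point \<Rightarrow> real) \<Rightarrow> ('v, 'e) point \<Rightarrow> real" where
  "interp S w p = (if p \<in> S then w p else (case p of Vertex v \<Rightarrow> 0 | Inner e t \<Rightarrow>
     bridge (w (nb S (e, t, -1))) (w (nb S (e, t, 1)))
       (nxt S (e, t, 1) - nxt S (e, t, -1)) (t - nxt S (e, t, -1))))"

lemma finite_params:
  assumes "nodes S"
  shows "finite (params S e)"
proof -
  have "inj (Inner e :: real \<Rightarrow> ('v, 'e) point)" by (simp add: inj_def)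
  then have "finite (Inner e -` S)" using assms by (simp add: nodes_def finite_vimageI)
  then have "finite ({0, L e} \<union> Inner e -` S)" by simp
  then show ?thesis by (rule finite_subset[rotated]) (auto simp: params_def ep_def split: if_splits)
qed

lemma params_0: "nodes S \<Longrightarrow> e \<in> A \<Longrightarrow> 0 \<in> params S e"
  using L_pos[of e] src_in[of e] by (auto simp: nodes_def params_def)

lemma params_L: "nodes S \<Longrightarrow> e \<in> A \<Longrightarrow> L e \<in> params S e"
  using L_pos[of e] tgt_in[of e] by (auto simp: nodes_def params_def)

lemma consec_nxt:
  assumes S: "nodes S" and c: "consec S e a b" and t: "a \<le> t" "t \<le> b"
  shows "t < b \<Longrightarrow> nxt S (e, t, 1) = b" "a < t \<Longrightarrow> nxt S (e, t, -1) = a"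
proof -
  note f = finite_params[OF S, of e]
  show "nxt S (e, t, 1) = b" if "t < b"
  proof -
    have "Min {b \<in> params S e. t < b} = b"
    proof (rule Min_eqI)
      fix y assume y: "y \<in> {b \<in> params S e. t < b}"
      then have "\<not> (a < y \<and> y < b)" using c by (auto simp: consec_def)
      then show "b \<le> y" using y t by auto
    qed (use f c that in \<open>auto simp: consec_def\<close>)
    then show ?thesis by (simp add: nxt_def)
  qed
  show "nxt S (e, t, -1) = a" if "a < t"
  proof -
    have "Max {a \<in> params S e. a < t} = a"
    proof (rule Max_eqI)
      fix y assume y: "y \<in> {a \<in> params S e. a < t}"
      then have "\<not> (a < y \<and> y < b)" using c by (auto simp: consec_def)
      then show "y \<le> a" using y t by auto
    qed (use f c that in \<open>auto simp: consec_def\<close>)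
    then show ?thesis by (simp add: nxt_def)
  qed
qed

text \<open>The wanted interval runs from the last parameter inside a downward closed set to the
  first one outside it. The sets \<open>{..t}\<close> and \<open>{..<t}\<close> give the intervals
  to the right and to the left of \<open>t\<close>.\<close>

lemma consec_cut:
  assumes S: "nodes S" and e: "e \<in> A" and X: "0 \<in> X" "L e \<notin> X" "\<And>x y. x \<in> X \<Longrightarrow> y \<le> x \<Longrightarrow> y \<in> X"
  obtains a b where "consec S e a b" "a \<in> X" "b \<notin> X"
proof -
  note f = finite_params[OF S, of e]
  let ?P = "params S e \<inter> X" and ?Q = "params S e - X"
  have P: "finite ?P" "?P \<noteq> {}" using f params_0[OF S e] X by auto
  have Q: "finite ?Q" "?Q \<noteq> {}" using f params_L[OF S e] X by auto
  define a b where "a = Max ?P" and "b = Min ?Q"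
  have 1: "a \<in> ?P" "b \<in> ?Q" using Max_in[OF P] Min_in[OF Q] unfolding a_def b_def by blast+
  have "x \<notin> params S e" if "a < x" "x < b" for x
  proof
    assume x: "x \<in> params S e"
    show False
    proof (cases "x \<in> X")
      case True then show ?thesis using Max_ge[OF P(1), of x] x that(1) by (simp add: a_def)
    next
      case False then show ?thesis using Min_le[OF Q(1), of x] x that(2) by (simp add: b_def)
    qed
  qed
  moreover have "a < b" using X(3)[of a b] 1 by (auto simp: not_less[symmetric])
  ultimately have "consec S e a b" unfolding consec_def using 1 e by auto
  then show ?thesis using that 1 by blast
qed

lemma consec_right:
  assumes "nodes S" "e \<in> A" "0 \<le> t" "t < L e"
  obtains a b where "consec S e a b" "a \<le> t" "t < b"
  by (rule consec_cut[OF assms(1,2), of "{..t}"]) (use assms that in auto)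

lemma consec_left:
  assumes "nodes S" "e \<in> A" "0 < t" "t \<le> L e"
  obtains a b where "consec S e a b" "a < t" "t \<le> b"
  by (rule consec_cut[OF assms(1,2), of "{..<t}"]) (use assms that in auto)

lemma consec_bounds: "consec S e a b \<Longrightarrow> e \<in> A \<and> 0 \<le> a \<and> a < b \<and> b \<le> L e"
  by (auto simp: consec_def params_def)

lemma nxt_valid:
  assumes S: "nodes S" and v: "valid e t \<sigma>"
  shows "nb S (e, t, \<sigma>) \<in> S" "0 < gap S (e, t, \<sigma>)"
    "nxt S (e, t, \<sigma>) = t + \<sigma> * gap S (e, t, \<sigma>)" "nxt S (e, t, \<sigma>) \<in> params S e"
proof -
  have "nxt S (e, t, \<sigma>) \<in> params S e \<and> \<sigma> * (nxt S (e, t, \<sigma>) - t) > 0"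
  proof (cases "\<sigma> = 1")
    case True
    then obtain a b where "consec S e a b" "a \<le> t" "t < b"
      using v consec_right[OF S, of e t] by (auto simp: valid_def)
    then show ?thesis using consec_nxt(1)[OF S, of e a b t] True by (auto simp: consec_def)
  next
    case False
    then obtain a b where "consec S e a b" "a < t" "t \<le> b"
      using v consec_left[OF S, of e t] by (auto simp: valid_def)
    then show ?thesis using consec_nxt(2)[OF S, of e a b t] False v by (auto simp: consec_def valid_def)
  qed
  then show "nb S (e, t, \<sigma>) \<in> S" "0 < gap S (e, t, \<sigma>)"
    "nxt S (e, t, \<sigma>) = t + \<sigma> * gap S (e, t, \<sigma>)" "nxt S (e, t, \<sigma>) \<in> params S e"
    using valid_sign[OF v] by (auto simp: nb_def gap_def params_def)
qed

lemma interp_node: "p \<in> S \<Longrightarrow> interp S w p = w p"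
  by (simp add: interp_def)

lemma interp_consec:
  assumes S: "nodes S" and c: "consec S e a b" and t: "a \<le> t" "t \<le> b"
  shows "interp S w (ep e t) = bridge (w (ep e a)) (w (ep e b)) (b - a) (t - a)"
proof -
  note cb = consec_bounds[OF c]
  consider "t = a" | "t = b" | "a < t" "t < b" using t by linarith
  then show ?thesis
  proof cases
    case 1 then show ?thesis using c by (simp add: consec_def params_def interp_def bridge_0)
  next
    case 2 then show ?thesis using c by (simp add: consec_def params_def interp_def bridge_l)
  next
    case 3
    then have "ep e t = Inner e t" "ep e t \<notin> S" using cb c by (auto simp: ep_Inner consec_def params_def)
    then show ?thesis
      using consec_nxt[OF S c] 3 by (simp add: interp_def nb_def)
  qed
qed

lemma interp_slopes:
  fixes w
  assumes S: "nodes S" and c: "consec S e a b"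
  defines "\<alpha> \<equiv> w (ep e a)" and "\<beta> \<equiv> w (ep e b)"
  defines "k \<equiv> \<lfloor>(\<beta> - \<alpha>) / (b - a)\<rfloor>" and "k' \<equiv> \<lfloor>(\<alpha> - \<beta>) / (b - a)\<rfloor>"
  defines "x \<equiv> \<lambda>t. \<alpha> + of_int k * (t - a)" and "y \<equiv> \<lambda>t. \<beta> + of_int k' * (b - t)"
  shows "a \<le> t \<Longrightarrow> t < b \<Longrightarrow> has_slope (interp S w) (e, t, 1) (branch (x t) (y t) k (- k'))"
    "a < t \<Longrightarrow> t \<le> b \<Longrightarrow> has_slope (interp S w) (e, t, -1) (branch (x t) (y t) (- k) k')"
proof -
  note cb = consec_bounds[OF c]
  have I: "interp S w (ep e u) = max (x u) (y u)" if "a \<le> u" "u \<le> b" for u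
    using interp_consec[OF S c that] by (simp add: bridge_def x_def y_def \<alpha>_def \<beta>_def k_def k'_def)
  show "has_slope (interp S w) (e, t, 1) (branch (x t) (y t) k (- k'))" if "a \<le> t" "t < b"
  proof -
    have "\<forall>\<^sub>F s in at_right 0. s < b - t" "\<forall>\<^sub>F s in at_right (0::real). s > 0"
      using that by (auto simp: eventually_at_right_less eventually_at_right_field intro!: exI[of _ "b - t"])
    with max_affine_right[of "x t" k "y t" "- k'"]
    have "\<forall>\<^sub>F s in at_right 0. interp S w (ep e (t + 1 * s))
      = interp S w (ep e t) + of_int (branch (x t) (y t) k (- k')) * s"
    proof eventually_elim
      case (elim s)
      have "x (t + s) = x t + of_int k * s" "y (t + s) = y t + of_int (- k') * s"
        by (simp_all add: x_def y_def algebra_simps)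
      then show ?case using elim that I[of "t + s"] I[of t] by simp
    qed
    then show ?thesis by (simp add: has_slope_def)
  qed
  show "has_slope (interp S w) (e, t, -1) (branch (x t) (y t) (- k) k')" if "a < t" "t \<le> b"
  proof -
    have "\<forall>\<^sub>F s in at_right 0. s < t - a" "\<forall>\<^sub>F s in at_right (0::real). s > 0"
      using that by (auto simp: eventually_at_right_less eventually_at_right_field intro!: exI[of _ "t - a"])
    with max_affine_right[of "x t" "- k" "y t" k']
    have "\<forall>\<^sub>F s in at_right 0. interp S w (ep e (t + (-1) * s))
      = interp S w (ep e t) + of_int (branch (x t) (y t) (- k) k') * s"
    proof eventually_elim
      case (elim s)
      have "x (t - s) = x t + of_int (- k) * s" "y (t - s) = y t + of_int k' * s"
        by (simp_all add: x_def y_def algebra_simps)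
      then show ?case using elim that I[of "t - s"] I[of t] by simp
    qed
    then show ?thesis by (simp add: has_slope_def)
  qed
qed

lemma interp_rat:
  assumes S: "nodes S"
  shows "rat (interp S w)"
  unfolding rat_def
proof (intro allI impI)
  fix e t \<sigma> assume v: "valid e t \<sigma>"
  show "\<exists>m::int. has_slope (interp S w) (e, t, \<sigma>) m"
  proof (cases "\<sigma> = 1")
    case True
    then obtain a b where "consec S e a b" "a \<le> t" "t < b"
      using v consec_right[OF S, of e t] by (auto simp: valid_def)
    then show ?thesis using interp_slopes(1)[OF S] True by blast
  next
    case False
    then obtain a b where "consec S e a b" "a < t" "t \<le> b" "\<sigma> = -1"
      using v consec_left[OF S, of e t] by (auto simp: valid_def)
    then show ?thesis using interp_slopes(2)[OF S] by blast
  qed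
qed

text \<open>At a node the piece of the bridge that starts there dominates; the other piece is lower
  or, on a tie, has the same slope. The slope is therefore the rounded difference quotient, which
  says how many chips move along \<open>d\<close>.\<close>

lemma interp_slope_node:
  assumes S: "nodes S" and v: "valid e t \<sigma>" and t: "ep e t \<in> S"
  shows "slope (interp S w) (e, t, \<sigma>)
    = \<lfloor>(w (nb S (e, t, \<sigma>)) - w (ep e t)) / gap S (e, t, \<sigma>)\<rfloor>"
proof (cases "\<sigma> = 1")
  case True
  then obtain a b where c: "consec S e a b" "a \<le> t" "t < b"
    using v consec_right[OF S, of e t] by (auto simp: valid_def)
  moreover have "t \<in> params S e" using t v by (auto simp: params_def valid_def)
  ultimately have [simp]: "t = a" by (metis consec_def less_eq_real_def)
  note cb = consec_bounds[OF c(1)]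
  define \<alpha> \<beta> where "\<alpha> = w (ep e a)" and "\<beta> = w (ep e b)"
  let ?y = "\<beta> + of_int \<lfloor>(\<alpha> - \<beta>) / (b - a)\<rfloor> * (b - a)"
  have n: "nxt S (e, a, 1) = b" using consec_nxt(1)[OF S c(1), of a] cb by simp
  have "?y \<le> \<alpha>" using floor_mult_le[of "b - a" "\<alpha> - \<beta>"] cb by simp
  then have "branch (\<alpha> + of_int \<lfloor>(\<beta> - \<alpha>) / (b - a)\<rfloor> * (a - a)) ?y
      \<lfloor>(\<beta> - \<alpha>) / (b - a)\<rfloor> (- \<lfloor>(\<alpha> - \<beta>) / (b - a)\<rfloor>) = \<lfloor>(\<beta> - \<alpha>) / (b - a)\<rfloor>"
    using floor_opposite_eq[of \<alpha> \<beta> "b - a"] cb by (auto simp: branch_def)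
  then have "has_slope (interp S w) (e, a, 1) (of_int \<lfloor>(\<beta> - \<alpha>) / (b - a)\<rfloor>)"
    using interp_slopes(1)[OF S c(1), of a w] cb by (simp add: \<alpha>_def \<beta>_def)
  from slope_eq[OF this] show ?thesis using True n cb by (simp add: nb_def gap_def \<alpha>_def \<beta>_def)
next
  case False
  then obtain a b where c: "consec S e a b" "a < t" "t \<le> b" and [simp]: "\<sigma> = -1"
    using v consec_left[OF S, of e t] by (auto simp: valid_def)
  moreover have "t \<in> params S e" using t v by (auto simp: params_def valid_def)
  ultimately have [simp]: "t = b" by (metis consec_def less_eq_real_def)
  note cb = consec_bounds[OF c(1)]
  define \<alpha> \<beta> where "\<alpha> = w (ep e a)" and "\<beta> = w (ep e b)"
  let ?x = "\<alpha> + of_int \<lfloor>(\<beta> - \<alpha>) / (b - a)\<rfloor> * (b - a)"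
  have n: "nxt S (e, b, -1) = a" using consec_nxt(2)[OF S c(1), of b] cb by simp
  have "?x \<le> \<beta>" using floor_mult_le[of "b - a" "\<beta> - \<alpha>"] cb by simp
  then have "branch ?x (\<beta> + of_int \<lfloor>(\<alpha> - \<beta>) / (b - a)\<rfloor> * (b - b))
      (- \<lfloor>(\<beta> - \<alpha>) / (b - a)\<rfloor>) \<lfloor>(\<alpha> - \<beta>) / (b - a)\<rfloor> = \<lfloor>(\<alpha> - \<beta>) / (b - a)\<rfloor>"
    using floor_opposite_eq[of \<beta> \<alpha> "b - a"] cb by (auto simp: branch_def)
  then have "has_slope (interp S w) (e, b, -1) (of_int \<lfloor>(\<alpha> - \<beta>) / (b - a)\<rfloor>)"
    using interp_slopes(2)[OF S c(1), of b w] cb by (simp add: \<alpha>_def \<beta>_def)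
  from slope_eq[OF this] show ?thesis using n cb by (simp add: nb_def gap_def \<alpha>_def \<beta>_def)
qed

lemma not_node_cases:
  assumes S: "nodes S" and p: "p \<in> pts" "p \<notin> S"
  obtains e t a b where "p = Inner e t" "e \<in> A" "0 < t" "t < L e" "consec S e a b" "a < t" "t < b"
proof -
  obtain e t where et: "p = Inner e t" "e \<in> A" "0 < t" "t < L e"
    using p S by (cases p) (auto simp: nodes_def)
  obtain a b where c: "consec S e a b" "a \<le> t" "t < b" using consec_right[OF S et(2), of t] et by auto
  have "a \<noteq> t" using c p et by (auto simp: consec_def params_def ep_Inner)
  then show ?thesis using that et c by auto
qed

text \<open>Bridges are maxima of affine functions, so a kink between nodes is convex and can only
  add chips.\<close>

lemma interp_ord_nonneg:
  assumes S: "nodes S" and p: "p \<notin> S"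
  shows "0 \<le> ord (interp S w) p"
proof (cases "p \<in> pts")
  case True
  obtain e t a b where et: "p = Inner e t" "e \<in> A" "0 < t" "t < L e" and c: "consec S e a b" "a < t" "t < b"
    using not_node_cases[OF S True p] .
  \<comment> \<open>The sum is 0 away from a tie and \<open>\<bar>m - n\<bar>\<close> at
    one.\<close>
  have b: "0 \<le> branch u v m n + branch u v (- m) (- n)" for u v m n by (auto simp: branch_def max_def)
  show ?thesis unfolding et(1) ord_def sum_dirs_Inner[OF et(2-4)]
    using slope_eq[OF interp_slopes(1)[OF S c(1), of t w]] slope_eq[OF interp_slopes(2)[OF S c(1), of t w]] c
      b[of _ _ _ "- _"] by simp
qed (simp add: ord_outside)

text \<open>If the values at consecutive nodes differ by at least the gap, both pieces of the bridge
  have nonzero slopes of the same sign. The function is then strictly monotone between nodes, so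
  each point there has exactly one incoming direction and its indegree minus 1 is 0.\<close>

lemma interp_steep:
  assumes S: "nodes S"
    and st: "\<And>e a b. consec S e a b \<Longrightarrow> b - a \<le> \<bar>w (ep e a) - w (ep e b)\<bar>"
  shows "morse (interp S w)" "p \<notin> S \<Longrightarrow> nu (interp S w) p = 0"
proof -
  have br: "branch u v m n = m \<or> branch u v m n = n" for u v m n by (auto simp: branch_def)
  have key: "\<lfloor>(\<beta> - \<alpha>) / l\<rfloor> \<ge> 1 \<and> - \<lfloor>(\<alpha> - \<beta>) / l\<rfloor> \<ge> 1 \<or> \<lfloor>(\<beta> - \<alpha>) / l\<rfloor> \<le> -1 \<and> - \<lfloor>(\<alpha> - \<beta>) / l\<rfloor> \<le> -1"
    if "0 < l" "l \<le> \<bar>\<alpha> - \<beta>\<bar>" for \<alpha> \<beta> l :: real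
  proof (cases "\<beta> \<ge> \<alpha>")
    case True
    then have "1 \<le> (\<beta> - \<alpha>) / l" using that by simp
    then have "\<lfloor>(\<beta> - \<alpha>) / l\<rfloor> \<ge> 1" by simp
    then show ?thesis using floor_opposite[of \<beta> \<alpha> l] by linarith
  next
    case False
    then have "1 \<le> (\<alpha> - \<beta>) / l" using that by simp
    then have "\<lfloor>(\<alpha> - \<beta>) / l\<rfloor> \<ge> 1" by simp
    then show ?thesis using floor_opposite[of \<beta> \<alpha> l] by linarith
  qed
  have sl: "(a \<le> t \<longrightarrow> t < b \<longrightarrow> slope (interp S w) (e, t, 1) \<noteq> 0) \<and>
      (a < t \<longrightarrow> t \<le> b \<longrightarrow> slope (interp S w) (e, t, -1) \<noteq> 0) \<and>
      (a < t \<longrightarrow> t < b \<longrightarrow> (slope (interp S w) (e, t, 1) < 0) \<noteq> (slope (interp S w) (e, t, -1) < 0))"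
    if c: "consec S e a b" for e a b t
  proof -
    let ?k = "\<lfloor>(w (ep e b) - w (ep e a)) / (b - a)\<rfloor>" and ?k' = "\<lfloor>(w (ep e a) - w (ep e b)) / (b - a)\<rfloor>"
    have k: "?k \<ge> 1 \<and> - ?k' \<ge> 1 \<or> ?k \<le> -1 \<and> - ?k' \<le> -1"
      using key[of "b - a" "w (ep e a)" "w (ep e b)"] st[OF c] consec_bounds[OF c] by simp
    have r: "slope (interp S w) (e, t, 1) = ?k \<or> slope (interp S w) (e, t, 1) = - ?k'" if "a \<le> t" "t < b"
      using slope_eq[OF interp_slopes(1)[OF S c that, of w]] br by metis
    have l: "slope (interp S w) (e, t, -1) = - ?k \<or> slope (interp S w) (e, t, -1) = ?k'" if "a < t" "t \<le> b"
      using slope_eq[OF interp_slopes(2)[OF S c that, of w]] br by metis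
    have 1: "x \<noteq> 0 \<and> (x < 0 \<longleftrightarrow> m < 0)" if "m \<ge> 1 \<and> n \<ge> 1 \<or> m \<le> -1 \<and> n \<le> -1" "x = m \<or> x = n"
      for x m n :: int using that by auto
    have 2: "x \<noteq> 0 \<and> (x < 0 \<longleftrightarrow> m > 0)" if "m \<ge> 1 \<and> n \<ge> 1 \<or> m \<le> -1 \<and> n \<le> -1" "x = - m \<or> x = - n"
      for x m n :: int using that by auto
    have r': "slope (interp S w) (e, t, 1) \<noteq> 0 \<and> (slope (interp S w) (e, t, 1) < 0 \<longleftrightarrow> ?k < 0)"
      if "a \<le> t" "t < b" by (rule 1[OF k r[OF that]])
    have l': "slope (interp S w) (e, t, -1) \<noteq> 0 \<and> (slope (interp S w) (e, t, -1) < 0 \<longleftrightarrow> ?k > 0)"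
      if "a < t" "t \<le> b" by (rule 2[OF k]) (use l[OF that] in simp)
    show ?thesis
    proof (intro conjI impI)
      show "slope (interp S w) (e, t, 1) \<noteq> 0" if "a \<le> t" "t < b" using r'[OF that] by blast
      show "slope (interp S w) (e, t, -1) \<noteq> 0" if "a < t" "t \<le> b" using l'[OF that] by blast
      show "(slope (interp S w) (e, t, 1) < 0) \<noteq> (slope (interp S w) (e, t, -1) < 0)" if "a < t" "t < b"
        using r'[OF less_imp_le[OF that(1)] that(2)] l'[OF that(1) less_imp_le[OF that(2)]] k by linarith
    qed
  qed
  show "morse (interp S w)" unfolding morse_def
  proof (intro conjI allI impI)
    show "rat (interp S w)" by (rule interp_rat[OF S])
    fix e t \<sigma> assume v: "valid e t \<sigma>"
    show "slope (interp S w) (e, t, \<sigma>) \<noteq> 0"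
    proof (cases "\<sigma> = 1")
      case True
      then obtain a b where "consec S e a b" "a \<le> t" "t < b"
        using v consec_right[OF S, of e t] by (auto simp: valid_def)
      then show ?thesis using sl True by blast
    next
      case False
      then obtain a b where "consec S e a b" "a < t" "t \<le> b" "\<sigma> = -1"
        using v consec_left[OF S, of e t] by (auto simp: valid_def)
      then show ?thesis using sl by blast
    qed
  qed
  show "nu (interp S w) p = 0" if p: "p \<notin> S"
  proof (cases "p \<in> pts")
    case True
    obtain e t a b where et: "p = Inner e t" "e \<in> A" "0 < t" "t < L e" and c: "consec S e a b" "a < t" "t < b"
      using not_node_cases[OF S True p] .
    have "(slope (interp S w) (e, t, 1) < 0) \<noteq> (slope (interp S w) (e, t, -1) < 0)"
      using sl[OF c(1), of t] c by blast
    then have "{d \<in> dirs p. slope (interp S w) d < 0} = {(e, t, 1)} \<or>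
        {d \<in> dirs p. slope (interp S w) d < 0} = {(e, t, -1)}"
      unfolding et(1) dirs_Inner[OF et(2-4)] by auto
    then have "card {d \<in> dirs p. slope (interp S w) d < 0} = 1" by auto
    then show ?thesis using True by (simp add: nu_def)
  qed (simp add: nu_def)
qed

end

section \<open>Burning\<close>

context metric_network
begin

lemma dirs_nb: "nodes S \<Longrightarrow> d \<in> dirs p \<Longrightarrow> nb S d \<in> S"
  by (cases d) (auto dest!: dirsD nxt_valid(1))

lemma dirs_gap: "nodes S \<Longrightarrow> d \<in> dirs p \<Longrightarrow> 0 < gap S d"
  by (cases d) (auto dest!: dirsD nxt_valid(2))

lemma slope_interp_dirs:
  assumes "nodes S" "p \<in> S" "d \<in> dirs p"
  shows "slope (interp S w) d = \<lfloor>(w (nb S d) - w p) / gap S d\<rfloor>"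
  using assms by (cases d) (auto dest!: dirsD simp: interp_slope_node)

text \<open>Dhar's burning algorithm: \<open>c\<close> is the divisor, and a fire started at \<open>q\<close> burns the
  whole graph unless there is a set \<open>U\<close> that can be fired. The rank records the order in
  which the nodes burn.\<close>
lemma burning:
  assumes S: "nodes S" and q: "q \<in> S"
    and H: "\<And>U. U \<subseteq> S - {q} \<Longrightarrow> U \<noteq> {} \<Longrightarrow> \<exists>p\<in>U. c p < int (card {d \<in> dirs p. nb S d \<notin> U})"
  shows "\<exists>r :: _ \<Rightarrow> nat. inj_on r S \<and> r q = 0 \<and>
    (\<forall>p\<in>S - {q}. c p < int (card {d \<in> dirs p. r (nb S d) < r p}))"
proof -
  have fS: "finite S" using S by (simp add: nodes_def)
  \<comment> \<open>\<open>B\<close> is the set of the first \<open>n\<close> burnt nodes. Burnt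
    neighbours are counted only if their rank is smaller, so the counts are not disturbed by nodes
    that burn later.\<close>
  define good where "good n B r \<longleftrightarrow> B \<subseteq> S \<and> q \<in> B \<and> card B = n \<and> inj_on r B \<and> r q = 0 \<and>
    (\<forall>p\<in>B. r p < n) \<and> (\<forall>p\<in>B - {q}. c p < int (card {d \<in> dirs p. nb S d \<in> B \<and> r (nb S d) < r p}))"
    for n :: nat and B and r :: "('v, 'e) point \<Rightarrow> nat"
  have "\<exists>B r. good (Suc n) B r" if "Suc n \<le> card S" for n
    using that
  proof (induction n)
    case 0
    have "good (Suc 0) {q} (\<lambda>_. 0)" using q by (simp add: good_def)
    then show ?case by blast
  next
    case (Suc n)
    then obtain B r where B: "good (Suc n) B r" by auto
    define U where "U = S - B"
    have fB: "finite B" using B fS finite_subset by (auto simp: good_def)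
    have "U \<noteq> {}"
    proof
      assume "U = {}"
      then have "B = S" using B by (auto simp: U_def good_def)
      then show False using B Suc.prems by (simp add: good_def)
    qed
    moreover have "U \<subseteq> S - {q}" using B by (auto simp: U_def good_def)
    ultimately obtain p where p: "p \<in> U" "c p < int (card {d \<in> dirs p. nb S d \<notin> U})" using H by blast
    define r' where "r' = r(p := Suc n)"
    have pB: "p \<notin> B" "p \<noteq> q" using p B by (auto simp: U_def good_def)
    have lt: "r x < Suc n" if "x \<in> B" for x using B that by (simp add: good_def)
    \<comment> \<open>The newest node has the largest rank, so its neighbours of smaller rank are
      exactly the burnt ones, that is, those outside \<open>U\<close>.\<close>
    have e1: "{d \<in> dirs p. nb S d \<in> insert p B \<and> r' (nb S d) < r' p} = {d \<in> dirs p. nb S d \<notin> U}"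
      using dirs_nb[OF S] lt pB by (auto simp: r'_def U_def split: if_splits)
    have e2: "{d \<in> dirs x. nb S d \<in> insert p B \<and> r' (nb S d) < r' x} = {d \<in> dirs x. nb S d \<in> B \<and> r (nb S d) < r x}"
      if "x \<in> B" for x
      using lt[OF that] pB that by (auto simp: r'_def)
    have "good (Suc (Suc n)) (insert p B) r'" unfolding good_def
    proof (intro conjI ballI)
      show "insert p B \<subseteq> S" "q \<in> insert p B" "card (insert p B) = Suc (Suc n)" "r' q = 0"
        using p pB B fB by (auto simp: good_def U_def r'_def)
      show "inj_on r' (insert p B)"
      proof (rule inj_on_insert[THEN iffD2], intro conjI)
        have "inj_on r B" using B by (simp add: good_def)
        then show "inj_on r' B" using pB by (auto simp: r'_def inj_on_def)
        have "r' x < r' p" if "x \<in> B" for x using lt[OF that] pB that by (auto simp: r'_def)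
        then show "r' p \<notin> r' ` (B - {p})" by (metis DiffD1 imageE less_irrefl)
      qed
      show "r' x < Suc (Suc n)" if "x \<in> insert p B" for x using that lt[of x] by (auto simp: r'_def)
      show "c x < int (card {d \<in> dirs x. nb S d \<in> insert p B \<and> r' (nb S d) < r' x})"
        if "x \<in> insert p B - {q}" for x
        using that e1 p e2[of x] B by (cases "x = p") (auto simp: good_def)
    qed
    then show ?case by blast
  qed
  moreover have "card S \<noteq> 0" using q fS by auto
  ultimately obtain n B r where n: "card S = Suc n" and B: "good (Suc n) B r"
    by (metis less_or_eq_imp_le not0_implies_Suc)
  then have "B = S" using fS by (metis card_subset_eq good_def)
  then have "\<forall>p\<in>S - {q}. {d \<in> dirs p. nb S d \<in> B \<and> r (nb S d) < r p} = {d \<in> dirs p. r (nb S d) < r p}"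
    using dirs_nb[OF S] by auto
  then show ?thesis using B \<open>B = S\<close> by (auto simp: good_def)
qed

text \<open>If no direction left \<open>U\<close>, then \<open>U\<close> would contain all nodes of
  every edge that it meets. Its vertices would then be closed under adjacency, hence all of
  \<open>V\<close>, and \<open>U\<close> would contain \<open>q\<close>.\<close>

lemma nodes_connected:
  assumes S: "nodes S" and U: "U \<subseteq> S" "U \<noteq> {}" and q: "q \<in> S" "q \<notin> U"
  shows "\<exists>p\<in>U. \<exists>d\<in>dirs p. nb S d \<notin> U"
proof (rule ccontr)
  assume no: "\<not> ?thesis"
  have all: "ep e y \<in> U" if e: "e \<in> A" and x: "x \<in> params S e" "ep e x \<in> U" and y: "y \<in> params S e" for e x y
  proof (rule ccontr)
    assume yU: "ep e y \<notin> U"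
    note f = finite_params[OF S, of e]
    show False
    proof (cases "x < y")
      case True
      let ?P = "{t \<in> params S e. ep e t \<in> U \<and> t < y}"
      \<comment> \<open>The last node of \<open>U\<close> before \<open>y\<close>: its successor
        lies in \<open>U\<close> and does not pass \<open>y\<close>, hence it contradicts
        maximality.\<close>
      define m where "m = Max ?P"
      have m: "m \<in> ?P" unfolding m_def by (rule Max_in) (use f True x in auto)
      have v: "valid e m 1" using m y e by (auto simp: valid_def params_def)
      let ?n = "nxt S (e, m, 1)"
      have n: "?n \<in> params S e" "?n > m" using nxt_valid[OF S v] by auto
      have "?n \<le> y" unfolding nxt_def using f m y by (auto intro!: Min_le)
      moreover have "nb S (e, m, 1) \<in> U" using no m v by (auto simp: dirs_def)
      then have "ep e ?n \<in> U" by (simp add: nb_def)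
      ultimately have "?n \<in> ?P" using n yU by (cases "?n = y") auto
      then have "?n \<le> m" unfolding m_def using f by (intro Max_ge) auto
      then show False using n by simp
    next
      case False
      then have xy: "y < x" using x yU by (metis linorder_neqE_linordered_idom)
      let ?P = "{t \<in> params S e. ep e t \<in> U \<and> y < t}"
      define m where "m = Min ?P"
      have m: "m \<in> ?P" unfolding m_def by (rule Min_in) (use f xy x in auto)
      have v: "valid e m (-1)" using m y e by (auto simp: valid_def params_def)
      let ?n = "nxt S (e, m, -1)"
      have n: "?n \<in> params S e" "?n < m" using nxt_valid[OF S v] by auto
      have "y \<le> ?n" unfolding nxt_def using f m y by (auto intro!: Max_ge)
      moreover have "nb S (e, m, -1) \<in> U" using no m v by (auto simp: dirs_def)
      then have "ep e ?n \<in> U" by (simp add: nb_def)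
      ultimately have "?n \<in> ?P" using n yU by (cases "?n = y") auto
      then have "m \<le> ?n" unfolding m_def using f by (intro Min_le) auto
      then show False using n by simp
    qed
  qed
  define W where "W = {v \<in> V. Vertex v \<in> U}"
  have on_edge: "(\<exists>v\<in>V. p = Vertex v) \<or> (\<exists>e\<in>A. \<exists>t\<in>params S e. p = ep e t)" if "p \<in> S" for p
  proof -
    have "p \<in> pts" using S that by (auto simp: nodes_def)
    then show ?thesis
    proof (cases rule: pts_cases)
      case (2 e t)
      then have "t \<in> params S e" using that by (simp add: params_def)
      then show ?thesis using 2 by blast
    qed auto
  qed
  have srcW: "src e \<in> W" if "e \<in> A" "t \<in> params S e" "ep e t \<in> U" for e t
    using all[OF that(1-3) params_0[OF S that(1)]] src_in that(1) by (simp add: W_def)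
  have "W = V"
  proof (rule conn)
    show "W \<noteq> {}"
    proof -
      obtain p where "p \<in> U" "p \<in> S" using U by blast
      then show ?thesis using on_edge[of p] srcW by (auto simp: W_def)
    qed
    show "src e \<in> W \<longleftrightarrow> tgt e \<in> W" if "e \<in> A" for e
      using all[OF that params_0[OF S that] _ params_L[OF S that]]
        all[OF that params_L[OF S that] _ params_0[OF S that]] that src_in tgt_in
      by (auto simp: W_def)
  qed (auto simp: W_def)
  then have VU: "Vertex v \<in> U" if "v \<in> V" for v using that by (auto simp: W_def)
  then have "ep e t \<in> U" if "e \<in> A" "t \<in> params S e" for e t
    using all[OF that(1) params_0[OF S that(1)] _ that(2)] src_in that(1) by simp
  then show False using on_edge[OF q(1)] q(2) VU by auto
qed

text \<open>The debts are paid off in the order of decreasing rank, by firing all nodes of smaller rank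
  sufficiently often.\<close>
lemma effective_off_point:
  assumes S: "nodes S" and D: "\<And>p. p \<in> pts \<Longrightarrow> p \<notin> S \<Longrightarrow> 0 \<le> D p" and q: "q \<in> S"
  shows "\<exists>f. rat f \<and> (\<forall>p\<in>pts. p \<noteq> q \<longrightarrow> 0 \<le> D p + ord f p)"
proof -
  have fS: "finite S" using S by (simp add: nodes_def)
  \<comment> \<open>With \<open>c = 0\<close> one burning neighbour is enough, so by connectedness
    everything burns. The rank gives every node other than \<open>q\<close> a neighbour of smaller
    rank.\<close>
  have "\<exists>r :: _ \<Rightarrow> nat. inj_on r S \<and> r q = 0 \<and>
    (\<forall>p\<in>S - {q}. 0 < int (card {d \<in> dirs p. r (nb S d) < r p}))"
  proof (rule burning[OF S q])
    fix U assume U: "U \<subseteq> S - {q}" "U \<noteq> {}"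
    have "\<exists>p\<in>U. \<exists>d\<in>dirs p. nb S d \<notin> U"
      by (rule nodes_connected[OF S _ _ q]) (use U in auto)
    then obtain p d where pd: "p \<in> U" "d \<in> dirs p" "nb S d \<notin> U" by blast
    have "finite (dirs p)" using pd U S by (auto simp: nodes_def intro!: finite_dirs)
    then show "\<exists>p\<in>U. 0 < int (card {d \<in> dirs p. nb S d \<notin> U})"
    proof (intro bexI[OF _ pd(1)])
      have "{d \<in> dirs p. nb S d \<notin> U} \<noteq> {}" using pd by blast
      then have "0 < card {d \<in> dirs p. nb S d \<notin> U}" using \<open>finite (dirs p)\<close> by (simp only: card_gt_0_iff) simp
      then show "0 < int (card {d \<in> dirs p. nb S d \<notin> U})" by simp
    qed
  qed
  then obtain r :: "('v, 'e) point \<Rightarrow> nat" where inj: "inj_on r S" and rq: "r q = 0"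
    and r: "\<And>p. p \<in> S \<Longrightarrow> p \<noteq> q \<Longrightarrow> 0 < card {d \<in> dirs p. r (nb S d) < r p}" by auto
  \<comment> \<open>All ranks lie below \<open>N\<close>, so the claim for \<open>j = 0\<close>
    concerns no node of \<open>S\<close>; each further step of \<open>j\<close> repairs the one node
    of rank \<open>N - j\<close>, if it exists and is not \<open>q\<close>.\<close>
  define N where "N = Suc (Max (r ` S))"
  have N: "r p < N" if "p \<in> S" for p using fS that by (auto simp: N_def less_Suc_eq_le)
  have "\<exists>f. rat f \<and> (\<forall>p\<in>pts. p \<noteq> q \<longrightarrow> (p \<in> S \<longrightarrow> N \<le> r p + j) \<longrightarrow> 0 \<le> D p + ord f p)" for j
  proof (induction j)
    case 0
    show ?case using D N by (intro exI[of _ "\<lambda>_. 0"]) (force simp: rat_const ord_const)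
  next
    case (Suc j)
    then obtain f where f: "rat f" "\<And>p. p \<in> pts \<Longrightarrow> p \<noteq> q \<Longrightarrow> (p \<in> S \<Longrightarrow> N \<le> r p + j) \<Longrightarrow> 0 \<le> D p + ord f p"
      by blast
    show ?case
    proof (cases "\<exists>p\<in>S. p \<noteq> q \<and> N = Suc (r p + j)")
      case False
      then show ?thesis using f by (intro exI[of _ f]) (auto simp: le_Suc_eq)
    next
      case True
      then obtain p0 where p0: "p0 \<in> S" "p0 \<noteq> q" "N = Suc (r p0 + j)" by blast
      have "{d \<in> dirs p0. r (nb S d) < r p0} \<noteq> {}"
        using r[OF p0(1,2)] by (metis card.empty less_irrefl)
      then obtain d0 where d0: "d0 \<in> dirs p0" "r (nb S d0) < r p0" by blast
      \<comment> \<open>The size of the debt to be paid. Raising the nodes of smaller rank by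
        \<open>n\<close> times the gap makes the slope along \<open>d0\<close> exactly
        \<open>n\<close>, while no direction at a node of rank at least \<open>r p0\<close> gets a
        negative slope. New debts arise only at smaller ranks.\<close>
      define n where "n = \<bar>D p0 + ord f p0\<bar>"
      define T where "T = real_of_int n * gap S d0"
      have T: "0 \<le> T" using dirs_gap[OF S d0(1)] by (simp add: T_def n_def)
      define w where "w p = (if r p < r p0 then T else 0)" for p
      let ?g = "interp S w"
      have ge: "0 \<le> slope ?g d" if "d \<in> dirs p" "p \<in> S" "r p0 \<le> r p" for p d
        using slope_interp_dirs[OF S that(2,1)] dirs_gap[OF S that(1)] T that by (simp add: w_def)
      have new: "0 \<le> D p + ord (\<lambda>x. f x + ?g x) p"
        if p: "p \<in> pts" "p \<noteq> q" "p \<in> S \<Longrightarrow> N \<le> r p + Suc j" for p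
      proof -
        have o: "ord (\<lambda>x. f x + ?g x) p = ord f p + ord ?g p" by (rule ord_add[OF f(1) interp_rat[OF S]])
        show ?thesis
        proof (cases "p \<in> S \<and> r p \<le> r p0")
          case False
          have "0 \<le> ord ?g p"
          proof (cases "p \<in> S")
            case True
            then show ?thesis unfolding ord_def using False ge by (intro sum_nonneg) auto
          qed (rule interp_ord_nonneg[OF S])
          moreover have "0 \<le> D p + ord f p" using f(2)[OF p(1,2)] p(3) p0(3) False by auto
          ultimately show ?thesis using o by simp
        next
          case True
          then have "r p = r p0" using p(3) p0(3) by auto
          then have [simp]: "p = p0" using inj True p0 by (auto simp: inj_on_def)
          have "slope ?g d0 = n"
            using slope_interp_dirs[OF S p0(1) d0(1), of w] dirs_gap[OF S d0(1)] d0(2)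
            by (simp add: w_def T_def)
          moreover have "slope ?g d0 \<le> ord ?g p0" unfolding ord_def
            using finite_dirs[OF p(1)] d0(1) ge[OF _ p0(1)] by (intro member_le_sum) auto
          ultimately show ?thesis using o by (simp add: n_def)
        qed
      qed
      show ?thesis
        using new by (intro exI[of _ "\<lambda>x. f x + ?g x"]) (auto intro!: rat_add f(1) interp_rat[OF S])
    qed
  qed
  from this[of N] show ?thesis by auto
qed

text \<open>The rank, scaled beyond all edge lengths, is interpolated. Adjacent nodes then differ by
  more than their gap, so the orientation follows the rank.\<close>

lemma morse_of_rank:
  fixes r :: "('v, 'e) point \<Rightarrow> nat"
  assumes S: "nodes S" and inj: "inj_on r S"
  shows "\<exists>\<phi>. morse \<phi> \<and> (\<forall>p. p \<notin> S \<longrightarrow> nu \<phi> p = 0) \<and>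
    (\<forall>p\<in>S. nu \<phi> p = int (card {d \<in> dirs p. r (nb S d) < r p}) - 1)"
proof -
  \<comment> \<open>At least as large as every edge length; the summand 1 keeps it positive if there
    are no edges.\<close>
  define T where "T = (\<Sum>e\<in>A. L e) + 1"
  have T: "L e \<le> T" if "e \<in> A" for e
    using member_le_sum[of e A L] that finite_A L_pos by (fastforce simp: T_def)
  have T0: "0 < T" unfolding T_def using sum_nonneg[of A L] L_pos by (smt (verit))
  define w where "w p = T * real (r p)" for p
  have st: "b - a \<le> \<bar>w (ep e a) - w (ep e b)\<bar>" if c: "consec S e a b" for e a b
  proof -
    note cb = consec_bounds[OF c]
    obtain t where t: "0 < t" "t < L e" "Inner e t \<in> S" using S cb by (auto simp: nodes_def)
    have "ep e a \<noteq> ep e b"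
    proof
      assume eq: "ep e a = ep e b"
      \<comment> \<open>Two parameters of the same point can only be the two ends of a loop, but an
        inner node lies between those.\<close>
      have "a = 0 \<and> b = L e"
        using cb eq by (cases "a = 0"; cases "b = L e") (auto simp: ep_def split: if_splits)
      then have "t \<notin> params S e" using c t by (auto simp: consec_def)
      then show False using t by (simp add: params_def ep_Inner)
    qed
    then have "r (ep e a) \<noteq> r (ep e b)" using inj c by (auto simp: consec_def params_def inj_on_def)
    then have "1 \<le> \<bar>real (r (ep e a)) - real (r (ep e b))\<bar>" by linarith
    then have "T * 1 \<le> T * \<bar>real (r (ep e a)) - real (r (ep e b))\<bar>" using T0 by (intro mult_left_mono) auto
    also have "\<dots> = \<bar>w (ep e a) - w (ep e b)\<bar>" using T0
      by (simp add: w_def right_diff_distrib[symmetric] abs_mult)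
    finally show ?thesis using T[of e] cb by simp
  qed
  let ?\<phi> = "interp S w"
  have "nu ?\<phi> p = int (card {d \<in> dirs p. r (nb S d) < r p}) - 1" if p: "p \<in> S" for p
  proof -
    have "slope ?\<phi> d < 0 \<longleftrightarrow> r (nb S d) < r p" if "d \<in> dirs p" for d
      using slope_interp_dirs[OF S p that, of w] dirs_gap[OF S that] T0
      by (simp add: w_def divide_less_0_iff)
    then have "{d \<in> dirs p. slope ?\<phi> d < 0} = {d \<in> dirs p. r (nb S d) < r p}" by auto
    then show ?thesis using p S by (auto simp: nu_def nodes_def)
  qed
  then show ?thesis using interp_steep[OF S st] by (intro exI[of _ ?\<phi>]) auto
qed

lemma nodes_exist:
  assumes "finite T" "T \<subseteq> pts"
  shows "\<exists>S. nodes S \<and> T \<subseteq> S"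
proof -
  let ?M = "(\<lambda>e. Inner e (L e / 2)) ` A"
  have "nodes (T \<union> Vertex ` V \<union> ?M)" unfolding nodes_def
  proof (intro conjI ballI)
    show "\<exists>t. 0 < t \<and> t < L e \<and> Inner e t \<in> T \<union> Vertex ` V \<union> ?M" if "e \<in> A" for e
      using that L_pos by (intro exI[of _ "L e / 2"]) auto
  qed (use assms finite_V finite_A L_pos in auto)
  then show ?thesis by blast
qed

end

section \<open>Reduced divisors\<close>

text \<open>The condition on \<open>R t + B t\<close> says that all kinks are convex. Both
  conclusions are proved together, because gluing supporting lines at \<open>y\<close> needs the
  monotonicity of the slopes.\<close>

lemma convex_supporting_line:
  fixes R B :: "real \<Rightarrow> int" and G :: "real \<Rightarrow> real" and a b :: real
  assumes fwd: "\<And>t. a \<le> t \<Longrightarrow> t < b \<Longrightarrow> \<forall>\<^sub>F s in at_right (0::real).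
      G (t + s) = G t + real_of_int (R t) * s \<and> R (t + s) = R t \<and> B (t + s) = - R t"
    and bwd: "\<And>t. a < t \<Longrightarrow> t \<le> b \<Longrightarrow> \<forall>\<^sub>F s in at_right (0::real).
      G (t - s) = G t + real_of_int (B t) * s \<and> B (t - s) = B t \<and> R (t - s) = - B t"
    and jump: "\<And>t. a < t \<Longrightarrow> t < b \<Longrightarrow> 0 \<le> R t + B t" and ab: "a < b"
  shows "R a \<le> - B b \<and> G b \<ge> G a + real_of_int (R a) * (b - a)"
proof (rule local_to_global[where P = "\<lambda>x y. R x \<le> - B y \<and> G y \<ge> G x + real_of_int (R x) * (y - x)"])
  show "\<forall>\<^sub>F s in at_right (0::real). R x \<le> - B (x + s) \<and> G (x + s) \<ge> G x + real_of_int (R x) * (x + s - x)"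
    if "a \<le> x" "x < b" for x
    using fwd[OF that] by eventually_elim simp
  show "\<forall>\<^sub>F s in at_right (0::real). R (x - s) \<le> - B x \<and> G x \<ge> G (x - s) + real_of_int (R (x - s)) * (x - (x - s))"
    if "a < x" "x \<le> b" for x
    using bwd[OF that] by eventually_elim simp
  fix x y z assume lt: "a \<le> x" "x < y" "y < z" "z \<le> b"
    and xy: "R x \<le> - B y \<and> G y \<ge> G x + real_of_int (R x) * (y - x)"
    and yz: "R y \<le> - B z \<and> G z \<ge> G y + real_of_int (R y) * (z - y)"
  have j: "R x \<le> R y" using jump[of y] xy lt by linarith
  then have "real_of_int (R x) * (z - y) \<le> real_of_int (R y) * (z - y)" using lt by (intro mult_right_mono) auto
  then have "G z \<ge> G x + real_of_int (R x) * (y - x) + real_of_int (R x) * (z - y)" using xy yz by linarith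
  then show "R x \<le> - B z \<and> G z \<ge> G x + real_of_int (R x) * (z - x)" using j yz by (simp add: algebra_simps)
qed (rule ab)

lemma slopes_lipschitz:
  fixes R B :: "real \<Rightarrow> int" and G :: "real \<Rightarrow> real" and a b :: real
  assumes fwd: "\<And>t. a \<le> t \<Longrightarrow> t < b \<Longrightarrow> \<forall>\<^sub>F s in at_right (0::real). G (t + s) = G t + real_of_int (R t) * s"
    and bwd: "\<And>t. a < t \<Longrightarrow> t \<le> b \<Longrightarrow> \<forall>\<^sub>F s in at_right (0::real). G (t - s) = G t + real_of_int (B t) * s"
    and bd: "\<And>t. a \<le> t \<Longrightarrow> t < b \<Longrightarrow> \<bar>R t\<bar> \<le> n" "\<And>t. a < t \<Longrightarrow> t \<le> b \<Longrightarrow> \<bar>B t\<bar> \<le> n"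
    and ab: "a \<le> b"
  shows "\<bar>G b - G a\<bar> \<le> of_int n * (b - a)"
proof (cases "a = b")
  case False
  have pos: "\<forall>\<^sub>F s in at_right (0::real). 0 < s" by (simp add: eventually_at_right_less)
  have mm: "\<bar>real_of_int k * s\<bar> \<le> of_int n * s" if "\<bar>k\<bar> \<le> n" "0 < s" for k s
  proof -
    have "\<bar>real_of_int k\<bar> \<le> of_int n" using that(1) by linarith
    then show ?thesis using that(2) by (simp add: abs_mult mult_right_mono)
  qed
  show ?thesis
  proof (rule local_to_global[where P = "\<lambda>x y. \<bar>G y - G x\<bar> \<le> of_int n * (y - x)"])
    show "\<forall>\<^sub>F s in at_right (0::real). \<bar>G (x + s) - G x\<bar> \<le> of_int n * (x + s - x)" if "a \<le> x" "x < b" for x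
      using fwd[OF that] pos by eventually_elim (use mm[OF bd(1)[OF that]] in simp)
    show "\<forall>\<^sub>F s in at_right (0::real). \<bar>G x - G (x - s)\<bar> \<le> of_int n * (x - (x - s))" if "a < x" "x \<le> b" for x
      using bwd[OF that] pos by eventually_elim (use mm[OF bd(2)[OF that]] in simp)
  qed (use False ab in \<open>auto simp: right_diff_distrib\<close>)
qed simp

text \<open>The slopes of the supporting lines are monotone and integral, hence constant
  near the left end of the interval.\<close>
lemma integral_supports_imp_slope:
  fixes G :: "real \<Rightarrow> real"
  assumes u: "0 < u"
    and sup: "\<And>t. 0 < t \<Longrightarrow> t < u \<Longrightarrow>
      \<exists>m::int. \<bar>m\<bar> \<le> N \<and> (\<forall>y. 0 \<le> y \<longrightarrow> y \<le> u \<longrightarrow> G t + real_of_int m * (y - t) \<le> G y)"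
    and sup0: "\<And>y. 0 \<le> y \<Longrightarrow> y \<le> u \<Longrightarrow> G 0 + real_of_int m0 * y \<le> G y"
  shows "\<exists>m::int. m0 \<le> m \<and> (\<forall>\<^sub>F s in at_right (0::real). G s = G 0 + real_of_int m * s)"
proof -
  obtain mm :: "real \<Rightarrow> int" where mm: "\<And>t. 0 < t \<Longrightarrow> t < u \<Longrightarrow> \<bar>mm t\<bar> \<le> N"
    "\<And>t y. 0 < t \<Longrightarrow> t < u \<Longrightarrow> 0 \<le> y \<Longrightarrow> y \<le> u \<Longrightarrow> G t + real_of_int (mm t) * (y - t) \<le> G y"
    using sup by metis
  have mono: "mm t \<le> mm t'" if "0 < t" "t < t'" "t' < u" for t t'
  proof -
    have "G t + real_of_int (mm t) * (t' - t) \<le> G t'" "G t' + real_of_int (mm t') * (t - t') \<le> G t"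
      using mm(2)[of t t'] mm(2)[of t' t] that by auto
    then have "real_of_int (mm t) * (t' - t) \<le> real_of_int (mm t') * (t' - t)" by (simp add: algebra_simps)
    then show ?thesis using that by simp
  qed
  let ?I = "mm ` {0<..<u}"
  \<comment> \<open>Bounded integers form a finite set, so the monotone slopes attain their minimum
    at some \<open>t1\<close> and are constant before it.\<close>
  have fin: "finite ?I" by (rule finite_subset[of _ "{-N..N}"]) (use mm(1) in \<open>fastforce simp: abs_le_iff\<close>)+
  have "?I \<noteq> {}" using u by auto
  from Min_in[OF fin this] obtain t1 where t1: "0 < t1" "t1 < u" "mm t1 = Min ?I" by auto
  define \<mu> where "\<mu> = mm t1"
  have min: "\<mu> \<le> mm t" if "0 < t" "t < u" for t
    using Min_le[OF fin] that t1 by (auto simp: \<mu>_def)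
  have eq: "mm t = \<mu>" if "0 < t" "t \<le> t1" for t
    using min[of t] mono[of t t1] that t1 by (cases "t = t1") (auto simp: \<mu>_def)
  have lin: "G t = G t1 - real_of_int \<mu> * (t1 - t)" if "0 < t" "t \<le> t1" for t
    using mm(2)[of t t1] mm(2)[of t1 t] eq[of t] eq[of t1] that t1 by (simp add: algebra_simps)
  define c where "c = G t1 - real_of_int \<mu> * t1"
  have lin': "G t = c + real_of_int \<mu> * t" if "0 < t" "t \<le> t1" for t
    using lin[OF that] by (simp add: c_def algebra_simps)
  \<comment> \<open>The supporting lines at inner points still allow \<open>G\<close> to jump
    upwards at 0; the line through \<open>G 0\<close> given by \<open>sup0\<close> excludes
    this.\<close>
  have "c \<le> G 0" using mm(2)[of t1 0] t1 by (simp add: \<mu>_def c_def)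
  moreover have "G 0 \<le> c"
  proof (rule tendsto_lowerbound)
    have "((\<lambda>t. c + real_of_int (\<mu> - m0) * t) \<longlongrightarrow> c + real_of_int (\<mu> - m0) * 0) (at_right 0)" by (intro tendsto_intros)
    then show "((\<lambda>t. c + real_of_int (\<mu> - m0) * t) \<longlongrightarrow> c) (at_right (0::real))" by simp
    show "\<forall>\<^sub>F t in at_right (0::real). G 0 \<le> c + real_of_int (\<mu> - m0) * t" unfolding eventually_at_right_field
    proof (intro exI[of _ t1] conjI allI impI)
      fix t assume "0 < t" "t < t1"
      then show "G 0 \<le> c + real_of_int (\<mu> - m0) * t"
        using sup0[of t] lin'[of t] t1 by (simp add: algebra_simps)
    qed (use t1 in auto)
  qed simp
  ultimately have c: "c = G 0" by simp
  have "real_of_int m0 * t1 \<le> real_of_int \<mu> * t1" using sup0[of t1] lin'[of t1] t1 c by simp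
  then have "m0 \<le> \<mu>" using t1 by simp
  moreover have "\<forall>\<^sub>F s in at_right (0::real). G s = G 0 + real_of_int \<mu> * s" unfolding eventually_at_right_field
    using lin' c t1 by (intro exI[of _ t1]) auto
  ultimately show ?thesis by blast
qed

lemma bridge_ge_min:
  assumes "0 < l" "0 \<le> s" "s \<le> l"
  shows "min \<alpha> \<beta> \<le> bridge \<alpha> \<beta> l s"
proof (cases "\<alpha> \<le> \<beta>")
  case True
  then have "0 \<le> \<lfloor>(\<beta> - \<alpha>) / l\<rfloor>" using assms by simp
  then have "\<alpha> \<le> \<alpha> + of_int \<lfloor>(\<beta> - \<alpha>) / l\<rfloor> * s" using assms by simp
  then show ?thesis unfolding bridge_def by linarith
next
  case False
  then have "0 \<le> \<lfloor>(\<alpha> - \<beta>) / l\<rfloor>" using assms by simp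
  then have "\<beta> \<le> \<beta> + of_int \<lfloor>(\<alpha> - \<beta>) / l\<rfloor> * (l - s)" using assms by simp
  then show ?thesis unfolding bridge_def by linarith
qed

context metric_network
begin

lemma interp_nonneg:
  assumes S: "nodes S" and w: "\<And>p. p \<in> S \<Longrightarrow> 0 \<le> w p" and p: "p \<in> pts"
  shows "0 \<le> interp S w p"
proof (cases "p \<in> S")
  case False
  obtain e t a b where et: "p = Inner e t" "e \<in> A" "0 < t" "t < L e" and c: "consec S e a b" "a < t" "t < b"
    using not_node_cases[OF S p False] .
  have "min (w (ep e a)) (w (ep e b)) \<le> interp S w (ep e t)"
    using interp_consec[OF S c(1), of t] bridge_ge_min[of "b - a" "t - a"] c by simp
  moreover have "0 \<le> w (ep e a)" "0 \<le> w (ep e b)" using w c by (auto simp: consec_def params_def)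
  ultimately show ?thesis using et by (simp add: ep_Inner)
qed (simp add: interp_node w)

lemma edge_slopes_fwd:
  fixes t x y :: real
  assumes "rat f" "e \<in> A" "0 \<le> t" "t < L e"
  shows "\<forall>\<^sub>F s in at_right (0::real). f (ep e (t + s)) = f (ep e t) + real_of_int (slope f (e, t, 1)) * s \<and>
    slope f (e, t + s, 1) = slope f (e, t, 1) \<and> slope f (e, t + s, -1) = - slope f (e, t, 1)"
proof -
  have v: "valid e t 1" using assms by (simp add: valid_def)
  have "\<forall>\<^sub>F s in at_right (0::real). f (ep e (t + s)) = f (ep e t) + real_of_int (slope f (e, t, 1)) * s"
    using rat_slope[OF assms(1) v] by (simp add: has_slope_def)
  with slope_local[OF assms(1) v] show ?thesis by eventually_elim simp
qed

lemma edge_slopes_bwd: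
  fixes t x y :: real
  assumes "rat f" "e \<in> A" "0 < t" "t \<le> L e"
  shows "\<forall>\<^sub>F s in at_right (0::real). f (ep e (t - s)) = f (ep e t) + real_of_int (slope f (e, t, -1)) * s \<and>
    slope f (e, t - s, -1) = slope f (e, t, -1) \<and> slope f (e, t - s, 1) = - slope f (e, t, -1)"
proof -
  have v: "valid e t (-1)" using assms by (simp add: valid_def)
  have "\<forall>\<^sub>F s in at_right (0::real). f (ep e (t - s)) = f (ep e t) + real_of_int (slope f (e, t, -1)) * s"
    using rat_slope[OF assms(1) v] by (simp add: has_slope_def)
  with slope_local[OF assms(1) v] show ?thesis by eventually_elim simp
qed

lemma supporting_line_fwd:
  fixes t x y :: real
  assumes f: "rat f" and e: "e \<in> A" and t: "0 \<le> t" "t \<le> y" "y \<le> L e"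
    and o: "\<And>x. t < x \<Longrightarrow> x < y \<Longrightarrow> 0 \<le> ord f (ep e x)"
  shows "f (ep e t) + real_of_int (slope f (e, t, 1)) * (y - t) \<le> f (ep e y)"
proof (cases "t = y")
  case False
  have "slope f (e, t, 1) \<le> - slope f (e, y, -1) \<and>
      f (ep e y) \<ge> f (ep e t) + real_of_int (slope f (e, t, 1)) * (y - t)"
  proof (rule convex_supporting_line[where G = "\<lambda>t. f (ep e t)" and R = "\<lambda>t. slope f (e, t, 1)"
        and B = "\<lambda>t. slope f (e, t, -1)"])
    show "0 \<le> slope f (e, x, 1) + slope f (e, x, -1)" if "t < x" "x < y" for x
      using o[OF that] that t e by (simp add: ep_Inner ord_def sum_dirs_Inner)
  qed (use edge_slopes_fwd[OF f e] edge_slopes_bwd[OF f e] t False in auto)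
  then show ?thesis by simp
qed simp

lemma supporting_line_bwd:
  fixes t x y :: real
  assumes f: "rat f" and e: "e \<in> A" and t: "0 \<le> y" "y \<le> t" "t \<le> L e"
    and o: "\<And>x. y < x \<Longrightarrow> x < t \<Longrightarrow> 0 \<le> ord f (ep e x)"
  shows "f (ep e t) + real_of_int (slope f (e, t, -1)) * (t - y) \<le> f (ep e y)"
proof (cases "t = y")
  case False
  \<comment> \<open>The convexity lemma is applied to the edge with reflected parameter.\<close>
  have "slope f (e, - (- t), -1) \<le> - slope f (e, - (- y), 1) \<and>
      f (ep e (- (- y))) \<ge> f (ep e (- (- t))) + real_of_int (slope f (e, - (- t), -1)) * (- y - (- t))"
  proof (rule convex_supporting_line[where a = "- t" and b = "- y" and G = "\<lambda>t. f (ep e (- t))"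
        and R = "\<lambda>t. slope f (e, - t, -1)" and B = "\<lambda>t. slope f (e, - t, 1)"])
    show "0 \<le> slope f (e, - x, -1) + slope f (e, - x, 1)" if "- t < x" "x < - y" for x
      using o[of "- x"] that t e by (simp add: ep_Inner ord_def sum_dirs_Inner)
    show "\<forall>\<^sub>F s in at_right (0::real). f (ep e (- (x + s))) = f (ep e (- x)) + real_of_int (slope f (e, - x, -1)) * s \<and>
        slope f (e, - (x + s), -1) = slope f (e, - x, -1) \<and> slope f (e, - (x + s), 1) = - slope f (e, - x, -1)"
      if "- t \<le> x" "x < - y" for x
      using edge_slopes_bwd[OF f e, of "- x"] that t by simp
    show "\<forall>\<^sub>F s in at_right (0::real). f (ep e (- (x - s))) = f (ep e (- x)) + real_of_int (slope f (e, - x, 1)) * s \<and>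
        slope f (e, - (x - s), 1) = slope f (e, - x, 1) \<and> slope f (e, - (x - s), -1) = - slope f (e, - x, 1)"
      if "- t < x" "x \<le> - y" for x
      using edge_slopes_fwd[OF f e, of "- x"] that t by simp
  qed (use t False in auto)
  then show ?thesis by simp
qed simp

lemma rat_lipschitz:
  fixes t x y :: real
  assumes f: "rat f" and e: "e \<in> A" and t: "0 \<le> x" "x \<le> y" "y \<le> L e"
    and bd: "\<And>e t \<sigma>. valid e t \<sigma> \<Longrightarrow> \<bar>slope f (e, t, \<sigma>)\<bar> \<le> N"
  shows "\<bar>f (ep e y) - f (ep e x)\<bar> \<le> of_int N * (y - x)"
proof (rule slopes_lipschitz[where G = "\<lambda>t. f (ep e t)" and R = "\<lambda>t. slope f (e, t, 1)"
        and B = "\<lambda>t. slope f (e, t, -1)"])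
  show "\<forall>\<^sub>F s in at_right (0::real). f (ep e (u + s)) = f (ep e u) + real_of_int (slope f (e, u, 1)) * s" if "x \<le> u" "u < y" for u
    using edge_slopes_fwd[OF f e, of u] that t by (auto elim: eventually_mono)
  show "\<forall>\<^sub>F s in at_right (0::real). f (ep e (u - s)) = f (ep e u) + real_of_int (slope f (e, u, -1)) * s" if "x < u" "u \<le> y" for u
    using edge_slopes_bwd[OF f e, of u] that t by (auto elim: eventually_mono)
  show "\<bar>slope f (e, u, 1)\<bar> \<le> N" if "x \<le> u" "u < y" for u
    using bd[of e u 1] e that t by (simp add: valid_def)
  show "\<bar>slope f (e, u, -1)\<bar> \<le> N" if "x < u" "u \<le> y" for u
    using bd[of e u "-1"] e that t by (simp add: valid_def)
qed (use t in auto)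

end

context metric_network
begin

text \<open>The functions that move the chips of \<open>D\<close> towards \<open>q\<close>.\<close>
definition towards :: "(('v, 'e) point \<Rightarrow> int) \<Rightarrow> ('v, 'e) point \<Rightarrow> (('v, 'e) point \<Rightarrow> real) set" where
  "towards D q = {f. rat f \<and> f q = 0 \<and> (\<forall>p\<in>pts. 0 \<le> f p \<and> (p \<noteq> q \<longrightarrow> 0 \<le> D p + ord f p))}"

text \<open>The function \<open>f\<close> is flattened below the level of \<open>x = ep e t\<close>.
  Since \<open>f q = 0\<close> is a lowest value, \<open>q\<close> is never strictly above that
  level, and \<open>D' + ord g\<close> is nonnegative away from \<open>x\<close>, where
  \<open>D'\<close> omits \<open>q\<close>. The positive slopes of \<open>f\<close> at
  \<open>x\<close> survive in \<open>ord g x\<close>, which is bounded by the total number of chips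
  of \<open>D'\<close>.\<close>

lemma towards_slope_le:
  assumes D: "finite {p. D p \<noteq> 0}" "\<And>p. p \<in> pts \<Longrightarrow> p \<noteq> q \<Longrightarrow> 0 \<le> D p"
    and f: "f \<in> towards D q" and q: "q \<in> pts" and v: "valid e t \<sigma>"
  shows "slope f (e, t, \<sigma>) \<le> divisor_degree (\<lambda>p. if p \<in> pts \<and> p \<noteq> q then D p else 0)"
proof -
  define D' where "D' p = (if p \<in> pts \<and> p \<noteq> q then D p else 0)" for p
  have D': "0 \<le> D' p" for p using D(2) by (simp add: D'_def)
  have fD': "finite {p. D' p \<noteq> 0}" by (rule finite_subset[OF _ D(1)]) (auto simp: D'_def)
  have rf: "rat f" using f by (simp add: towards_def)
  define x where "x = ep e t"
  have x: "x \<in> pts" using valid_in_pts[OF v] by (simp add: x_def)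
  have fx: "0 \<le> f x" using f x by (simp add: towards_def)
  define g where "g p = max (f p) (f x)" for p
  have rg: "rat g" unfolding g_def by (intro rat_max rf rat_const)
  have og: "0 \<le> ord g p + D' p" if "p \<noteq> x" for p
  proof (cases "p \<in> pts")
    case True
    consider "f p > f x" | "f p < f x" | "f p = f x" by linarith
    then show ?thesis
    proof cases
      case 1
      then have "p \<noteq> q" using fx f by (auto simp: towards_def)
      then have "0 \<le> D p + ord f p" using f True by (simp add: towards_def)
      moreover have "ord g p = ord f p" unfolding g_def by (rule ord_max_greater[OF rf rat_const 1])
      ultimately show ?thesis using True \<open>p \<noteq> q\<close> by (simp add: D'_def)
    next
      case 2
      then have "ord g p = 0"
        using ord_max_greater[OF rat_const rf, of p "f x"] by (simp add: g_def[abs_def] max.commute ord_const)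
      then show ?thesis using D' by simp
    next
      case 3
      have "ord (\<lambda>_. f x) p \<le> ord g p" unfolding g_def by (rule ord_max_ge') (use 3 rf rat_const in auto)
      then show ?thesis using D'[of p] by (simp add: ord_const)
    qed
  qed (use D' in \<open>simp add: ord_outside\<close>)
  have "slope f (e, t, \<sigma>) \<le> ord g x"
  proof -
    have d: "(e, t, \<sigma>) \<in> dirs x" using v by (simp add: dirs_def x_def)
    have sg: "slope g d = max (slope f d) 0" if "d \<in> dirs x" for d
      unfolding g_def using slope_max_eq[OF rf rat_const _ that, of "f x"] by (simp add: slope_const)
    have "slope f (e, t, \<sigma>) \<le> slope g (e, t, \<sigma>)" using sg[OF d] by simp
    also have "\<dots> \<le> ord g x" unfolding ord_def
      using sg finite_dirs[OF x] d by (intro member_le_sum) auto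
    finally show ?thesis .
  qed
  also have "ord g x \<le> ord g x + D' x" using D' by simp
  also have "\<dots> \<le> divisor_degree (\<lambda>p. ord g p + D' p)"
  proof (cases "ord g x + D' x = 0")
    case False
    have "0 \<le> ord g x + D' x" using \<open>slope f (e, t, \<sigma>) \<le> ord g x\<close> og D'[of x] ord_max_ge'[OF rf rat_const, of x "f x"]
      by (simp add: g_def[abs_def] ord_const)
    then have "0 \<le> ord g p + D' p" for p using og[of p] by (cases "p = x") auto
    then show ?thesis unfolding divisor_degree_def
      using False finite_support_add[OF finite_ord[OF rg] fD'] by (intro member_le_sum) auto
  next
    case True
    have "0 \<le> ord g p + D' p" for p using og[of p] True by (cases "p = x") auto
    then show ?thesis using True by (simp add: divisor_degree_nonneg)
  qed
  also have "\<dots> = divisor_degree D'"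
    using divisor_degree_add[OF finite_ord[OF rg] fD'] degree_ord[OF rg] by simp
  finally show ?thesis by (simp add: D'_def[abs_def])
qed

text \<open>A lower bound for a slope is the upper bound for the opposite direction at a nearby
  point. The bound does not depend on \<open>f\<close>.\<close>

lemma towards_slope_bound:
  assumes D: "finite {p. D p \<noteq> 0}" "\<And>p. p \<in> pts \<Longrightarrow> p \<noteq> q \<Longrightarrow> 0 \<le> D p"
    and q: "q \<in> pts"
  shows "\<exists>N. \<forall>f\<in>towards D q. \<forall>e t \<sigma>. valid e t \<sigma> \<longrightarrow> \<bar>slope f (e, t, \<sigma>)\<bar> \<le> N"
proof -
  define N where "N = divisor_degree (\<lambda>p. if p \<in> pts \<and> p \<noteq> q then D p else 0)"
  have "\<bar>slope f (e, t, \<sigma>)\<bar> \<le> N" if f: "f \<in> towards D q" and v: "valid e t \<sigma>" for f e t \<sigma>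
  proof -
    have rf: "rat f" using f by (simp add: towards_def)
    have "\<forall>\<^sub>F s in at_right (0::real). - slope f (e, t, \<sigma>) \<le> N"
      using slope_local[OF rf v] eventually_valid[OF v]
    proof eventually_elim
      case (elim s)
      then show ?case using towards_slope_le[OF D f q, of e "t + \<sigma> * s" "- \<sigma>"] by (simp add: N_def)
    qed
    then have "- slope f (e, t, \<sigma>) \<le> N" by simp
    then show ?thesis using towards_slope_le[OF D f q v] by (simp add: N_def abs_le_iff)
  qed
  then show ?thesis by blast
qed

text \<open>All functions vanish at \<open>q\<close> and share a Lipschitz constant on edges.
  Boundedness therefore spreads from \<open>q\<close> by connectedness, without computing a
  diameter.\<close>

lemma towards_pointwise_bound:
  assumes D: "finite {p. D p \<noteq> 0}" "\<And>p. p \<in> pts \<Longrightarrow> p \<noteq> q \<Longrightarrow> 0 \<le> D p"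
    and q: "q \<in> pts" and p: "p \<in> pts"
  shows "\<exists>C. \<forall>f\<in>towards D q. f p \<le> C"
proof -
  obtain N where N: "\<And>f e t \<sigma>. f \<in> towards D q \<Longrightarrow> valid e t \<sigma> \<Longrightarrow> \<bar>slope f (e, t, \<sigma>)\<bar> \<le> N"
    using towards_slope_bound[OF D q] by blast
  have lip: "\<bar>f (ep e y) - f (ep e x)\<bar> \<le> of_int N * (y - x)"
    if "f \<in> towards D q" "e \<in> A" "0 \<le> x" "x \<le> y" "y \<le> L e" for f e x y
    by (rule rat_lipschitz) (use that N[OF that(1)] in \<open>auto simp: towards_def\<close>)
  define ok where "ok p \<longleftrightarrow> (\<exists>C. \<forall>f\<in>towards D q. f p \<le> C)" for p
  have step: "ok (ep e x) \<longleftrightarrow> ok (ep e y)" if "e \<in> A" "0 \<le> x" "x \<le> y" "y \<le> L e" for e x y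
  proof
    assume "ok (ep e x)"
    then obtain C where C: "\<And>f. f \<in> towards D q \<Longrightarrow> f (ep e x) \<le> C" by (auto simp: ok_def)
    have "f (ep e y) \<le> C + of_int N * (y - x)" if "f \<in> towards D q" for f
      using lip[OF that \<open>e \<in> A\<close> \<open>0 \<le> x\<close> \<open>x \<le> y\<close> \<open>y \<le> L e\<close>] C[OF that] by linarith
    then show "ok (ep e y)" unfolding ok_def by blast
  next
    assume "ok (ep e y)"
    then obtain C where C: "\<And>f. f \<in> towards D q \<Longrightarrow> f (ep e y) \<le> C" by (auto simp: ok_def)
    have "f (ep e x) \<le> C + of_int N * (y - x)" if "f \<in> towards D q" for f
      using lip[OF that \<open>e \<in> A\<close> \<open>0 \<le> x\<close> \<open>x \<le> y\<close> \<open>y \<le> L e\<close>] C[OF that] by linarith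
    then show "ok (ep e x)" unfolding ok_def by blast
  qed
  have src: "ok (ep e x) \<longleftrightarrow> ok (Vertex (src e))" if "e \<in> A" "0 \<le> x" "x \<le> L e" for e x
    using step[of e 0 x] that by simp
  have "ok q" unfolding ok_def by (rule exI[of _ 0]) (auto simp: towards_def)
  have "{v \<in> V. ok (Vertex v)} = V"
  proof (rule conn)
    show "{v \<in> V. ok (Vertex v)} \<noteq> {}" using q
    proof (cases rule: pts_cases)
      case (1 v) then show ?thesis using \<open>ok q\<close> by auto
    next
      case (2 e t) then show ?thesis using \<open>ok q\<close> src[of e t] src_in by auto
    qed
    show "src e \<in> {v \<in> V. ok (Vertex v)} \<longleftrightarrow> tgt e \<in> {v \<in> V. ok (Vertex v)}" if "e \<in> A" for e
      using src[of e "L e"] that src_in tgt_in L_pos[of e] by simp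
  qed auto
  then have "ok (Vertex v)" if "v \<in> V" for v using that by blast
  with p have "ok p" using src src_in by (cases rule: pts_cases) auto
  then show ?thesis by (simp add: ok_def)
qed

text \<open>The pointwise supremum is attained in \<open>towards D q\<close>: by the slope bound, the slopes at a
  point of functions that almost attain the supremum can be taken to be constant, and then the
  supremum inherits their supporting lines.\<close>
lemma towards_greatest:
  assumes D: "finite {p. D p \<noteq> 0}" "\<And>p. p \<in> pts \<Longrightarrow> p \<noteq> q \<Longrightarrow> 0 \<le> D p"
    and q: "q \<in> pts"
  shows "\<exists>F\<in>towards D q. \<forall>f\<in>towards D q. \<forall>p\<in>pts. f p \<le> F p"
proof -
  obtain N where N: "\<And>f e t \<sigma>. f \<in> towards D q \<Longrightarrow> valid e t \<sigma> \<Longrightarrow> \<bar>slope f (e, t, \<sigma>)\<bar> \<le> N"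
    using towards_slope_bound[OF D q] by blast
  have T0: "(\<lambda>_. 0) \<in> towards D q" using D by (simp add: towards_def rat_const ord_const)
  define F where "F p = (SUP f\<in>towards D q. f p)" for p
  have bdd: "bdd_above ((\<lambda>f. f p) ` towards D q)" if "p \<in> pts" for p
    using towards_pointwise_bound[OF D q that] by (auto simp: bdd_above_def)
  have le: "f p \<le> F p" if "f \<in> towards D q" "p \<in> pts" for f p
    unfolding F_def by (rule cSUP_upper[OF that(1) bdd[OF that(2)]])
  have approx: "\<exists>f\<in>towards D q. F p - \<epsilon> < f p" if "p \<in> pts" "0 < \<epsilon>" for p \<epsilon>
    using less_cSUP_iff[OF _ bdd[OF that(1)], of "F p - \<epsilon>"] T0 that(2) by (auto simp: F_def)
  have "finite ({p. D p \<noteq> 0} \<inter> pts \<union> {q})" "{p. D p \<noteq> 0} \<inter> pts \<union> {q} \<subseteq> pts" using D(1) q by auto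
  from nodes_exist[OF this] obtain S where S: "nodes S" "{p. D p \<noteq> 0} \<inter> pts \<union> {q} \<subseteq> S" by blast
  have inner: "ep e x \<in> pts \<and> ep e x \<notin> S \<and> D (ep e x) = 0 \<and> ep e x \<noteq> q"
    if c: "consec S e a b" and x: "a < x" "x < b" for e a b x
  proof -
    note cb = consec_bounds[OF c]
    have "ep e x \<in> pts" using cb x by (intro ep_in_pts) auto
    moreover have "ep e x \<notin> S" using c x cb by (auto simp: consec_def params_def)
    ultimately show ?thesis using S(2) by auto
  qed
  have f_fwd: "f (ep e t) + real_of_int (slope f (e, t, 1)) * (y - t) \<le> f (ep e y)"
    if "f \<in> towards D q" "consec S e a b" "a \<le> t" "t \<le> y" "y \<le> b" for f e a b t y
  proof (rule supporting_line_fwd)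
    show "0 \<le> ord f (ep e x)" if "t < x" "x < y" for x
      using inner[OF \<open>consec S e a b\<close>, of x] that \<open>a \<le> t\<close> \<open>y \<le> b\<close> \<open>f \<in> towards D q\<close>
      by (auto simp: towards_def)
  qed (use that consec_bounds[OF that(2)] in \<open>auto simp: towards_def\<close>)
  have f_bwd: "f (ep e t) + real_of_int (slope f (e, t, -1)) * (t - y) \<le> f (ep e y)"
    if "f \<in> towards D q" "consec S e a b" "a \<le> y" "y \<le> t" "t \<le> b" for f e a b t y
  proof (rule supporting_line_bwd)
    show "0 \<le> ord f (ep e x)" if "y < x" "x < t" for x
      using inner[OF \<open>consec S e a b\<close>, of x] that \<open>a \<le> y\<close> \<open>t \<le> b\<close> \<open>f \<in> towards D q\<close>
      by (auto simp: towards_def)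
  qed (use that consec_bounds[OF that(2)] in \<open>auto simp: towards_def\<close>)
  \<comment> \<open>\<open>m\<close> is a choice of integer slopes at \<open>p\<close> that pays for
    \<open>D p\<close> and gives supporting lines of \<open>F\<close> on the node intervals around
    \<open>p\<close>. These conditions survive the passage from near-optimal functions to the
    supremum.\<close>
  define supp where "supp p m \<longleftrightarrow> (\<forall>d\<in>dirs p. \<bar>m d\<bar> \<le> N) \<and> (p \<noteq> q \<longrightarrow> - D p \<le> (\<Sum>d\<in>dirs p. m d)) \<and>
      (\<forall>e t a b y. ep e t = p \<longrightarrow> consec S e a b \<longrightarrow> a \<le> t \<longrightarrow> t < b \<longrightarrow> t \<le> y \<longrightarrow> y \<le> b \<longrightarrow>
        F p + real_of_int (m (e, t, 1)) * (y - t) \<le> F (ep e y)) \<and>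
      (\<forall>e t a b y. ep e t = p \<longrightarrow> consec S e a b \<longrightarrow> a < t \<longrightarrow> t \<le> b \<longrightarrow> a \<le> y \<longrightarrow> y \<le> t \<longrightarrow>
        F p + real_of_int (m (e, t, -1)) * (t - y) \<le> F (ep e y))"
    for p and m :: "'e \<times> real \<times> real \<Rightarrow> int"
  have "\<exists>m. supp p m" if p: "p \<in> pts" for p
  proof -
    have "\<forall>n. \<exists>f\<in>towards D q. F p - 1 / real (Suc n) < f p" using approx[OF p] by simp
    then obtain h where h: "\<And>n. h n \<in> towards D q" "\<And>n. F p - 1 / real (Suc n) < h n p" by metis
    define sl where "sl n = restrict (slope (h n)) (dirs p)" for n
    have "finite (range sl)"
    proof (rule finite_subset)
      show "range sl \<subseteq> dirs p \<rightarrow>\<^sub>E {-N..N}"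
      proof (clarify, rule PiE_I)
        fix n d assume d: "d \<in> dirs p"
        obtain e t \<sigma> where dd: "d = (e, t, \<sigma>)" by (cases d)
        have "valid e t \<sigma>" using d dd dirsD by auto
        then have "\<bar>slope (h n) d\<bar> \<le> N" using N[OF h(1)] dd by blast
        then show "sl n d \<in> {-N..N}" using d by (simp add: sl_def abs_le_iff)
      qed (simp add: sl_def)
      show "finite (dirs p \<rightarrow>\<^sub>E {-N..N})" by (intro finite_PiE finite_dirs p) auto
    qed
    \<comment> \<open>There are finitely many slope patterns at \<open>p\<close>, so one occurs for
      infinitely many of the functions \<open>h n\<close>, whose values at \<open>p\<close> tend to
      \<open>F p\<close>.\<close>
    then obtain n0 where n0: "infinite {n. sl n = sl n0}"
      using pigeonhole_infinite[of "UNIV :: nat set" sl] by auto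
    define m where "m = sl n0"
    have lim: "F p + c \<le> z" if "\<And>n. sl n = m \<Longrightarrow> h n p + c \<le> z" for c z
    proof (rule field_le_epsilon)
      fix \<epsilon> :: real assume "0 < \<epsilon>"
      then obtain n1 where n1: "1 / real (Suc n1) < \<epsilon>" using nat_approx_posE by blast
      obtain n where n: "n \<ge> n1" "sl n = m"
        using n0 unfolding infinite_nat_iff_unbounded_le m_def by auto
      have "1 / real (Suc n) \<le> 1 / real (Suc n1)" using n(1) by (simp add: frac_le)
      then show "F p + c \<le> z + \<epsilon>" using h(2)[of n] that[OF n(2)] n1 by linarith
    qed
    have ms: "m d = slope (h n) d" if "sl n = m" "d \<in> dirs p" for n d
      using that by (auto simp: sl_def)
    have "supp p m" unfolding supp_def
    proof (intro conjI ballI allI impI)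
      show "\<bar>m d\<bar> \<le> N" if "d \<in> dirs p" for d
        using ms[OF _ that, of n0] N[OF h(1)] that by (cases d) (auto simp: m_def dest!: dirsD)
      show "- D p \<le> (\<Sum>d\<in>dirs p. m d)" if "p \<noteq> q"
      proof -
        have "0 \<le> D p + ord (h n0) p" using h(1)[of n0] p that by (auto simp: towards_def)
        moreover have "ord (h n0) p = (\<Sum>d\<in>dirs p. m d)" unfolding ord_def
          using ms[of n0] by (auto simp: m_def intro!: sum.cong)
        ultimately show ?thesis by simp
      qed
    next
      fix e t a b y assume et: "ep e t = p" and c: "consec S e a b" and t: "a \<le> t" "t < b" "t \<le> y" "y \<le> b"
      note cb = consec_bounds[OF c]
      show "F p + real_of_int (m (e, t, 1)) * (y - t) \<le> F (ep e y)"
      proof (rule lim)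
        fix n assume n: "sl n = m"
        have "(e, t, 1) \<in> dirs p" using et t cb by (auto simp: dirs_def valid_def)
        then have "h n p + real_of_int (m (e, t, 1)) * (y - t) \<le> h n (ep e y)"
          using f_fwd[OF h(1) c, of t y n] ms[OF n] t et by simp
        also have "\<dots> \<le> F (ep e y)" using t cb by (intro le h(1) ep_in_pts) auto
        finally show "h n p + real_of_int (m (e, t, 1)) * (y - t) \<le> F (ep e y)" .
      qed
    next
      fix e t a b y assume et: "ep e t = p" and c: "consec S e a b" and t: "a < t" "t \<le> b" "a \<le> y" "y \<le> t"
      note cb = consec_bounds[OF c]
      show "F p + real_of_int (m (e, t, -1)) * (t - y) \<le> F (ep e y)"
      proof (rule lim)
        fix n assume n: "sl n = m"
        have "(e, t, -1) \<in> dirs p" using et t cb by (auto simp: dirs_def valid_def)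
        then have "h n p + real_of_int (m (e, t, -1)) * (t - y) \<le> h n (ep e y)"
          using f_bwd[OF h(1) c, of y t n] ms[OF n] t et by simp
        also have "\<dots> \<le> F (ep e y)" using t cb by (intro le h(1) ep_in_pts) auto
        finally show "h n p + real_of_int (m (e, t, -1)) * (t - y) \<le> F (ep e y)" .
      qed
    qed
    then show ?thesis by blast
  qed
  then obtain m where m: "\<And>p. p \<in> pts \<Longrightarrow> supp p (m p)" by metis
  note m' = m[unfolded supp_def]
  have mN: "\<bar>m p d\<bar> \<le> N" if "p \<in> pts" "d \<in> dirs p" for p d
    by (rule m'[OF that(1), THEN conjunct1, rule_format, OF that(2)])
  have mD: "- D p \<le> (\<Sum>d\<in>dirs p. m p d)" if "p \<in> pts" "p \<noteq> q" for p
    by (rule m'[OF that(1), THEN conjunct2, THEN conjunct1, rule_format, OF that(2)])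
  have m_fwd: "F p + real_of_int (m p (e, t, 1)) * (y - t) \<le> F (ep e y)"
    if "p \<in> pts" "ep e t = p" "consec S e a b" "a \<le> t" "t < b" "t \<le> y" "y \<le> b" for p e t a b y
    by (rule m'[OF that(1), THEN conjunct2, THEN conjunct2, THEN conjunct1, rule_format, OF that(2-)])
  have m_bwd: "F p + real_of_int (m p (e, t, -1)) * (t - y) \<le> F (ep e y)"
    if "p \<in> pts" "ep e t = p" "consec S e a b" "a < t" "t \<le> b" "a \<le> y" "y \<le> t" for p e t a b y
    by (rule m'[OF that(1), THEN conjunct2, THEN conjunct2, THEN conjunct2, rule_format, OF that(2-)])
  \<comment> \<open>Between nodes \<open>D\<close> vanishes, so the two chosen slopes have a
    nonnegative sum, and the forward line also supports \<open>F\<close> to the left.\<close>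
  have two_sided: "\<exists>k::int. \<bar>k\<bar> \<le> N \<and> (\<forall>y. a \<le> y \<longrightarrow> y \<le> b \<longrightarrow> F (ep e x) + real_of_int k * (y - x) \<le> F (ep e y))"
    if c: "consec S e a b" and x: "a < x" "x < b" for e a b x
  proof -
    let ?p = "ep e x"
    let ?k = "m ?p (e, x, 1)"
    note cb = consec_bounds[OF c]
    note i = inner[OF c x]
    have pe: "?p = Inner e x" using cb x by (simp add: ep_Inner)
    have "0 \<le> ?k + m ?p (e, x, -1)"
      using mD[of ?p] i cb x unfolding pe by (simp add: sum_dirs_Inner)
    then have k: "real_of_int (- ?k) \<le> real_of_int (m ?p (e, x, -1))" by linarith
    have "F ?p + real_of_int ?k * (y - x) \<le> F (ep e y)" if y: "a \<le> y" "y \<le> b" for y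
    proof (cases "x \<le> y")
      case True
      then show ?thesis using m_fwd[of ?p e x a b y] i c x y by simp
    next
      case False
      have "real_of_int (- ?k) * (x - y) \<le> real_of_int (m ?p (e, x, -1)) * (x - y)"
        using k False by (intro mult_right_mono) auto
      moreover have "F ?p + real_of_int (m ?p (e, x, -1)) * (x - y) \<le> F (ep e y)"
        using m_bwd[of ?p e x a b y] i c x y False by simp
      ultimately show ?thesis by (simp add: algebra_simps)
    qed
    moreover have "\<bar>?k\<bar> \<le> N" using mN[of ?p] i cb x unfolding pe by (simp add: dirs_Inner)
    ultimately show ?thesis by blast
  qed
  \<comment> \<open>The slopes of \<open>F\<close> exist and are at least the chosen ones, so
    \<open>ord F p\<close> is large enough for \<open>F\<close> to belong to
    \<open>towards D q\<close>.\<close>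
  have sl: "\<exists>k::int. m (ep e t) (e, t, \<sigma>) \<le> k \<and> has_slope F (e, t, \<sigma>) k" if v: "valid e t \<sigma>" for e t \<sigma>
  proof (cases "\<sigma> = 1")
    case True
    then obtain a b where c: "consec S e a b" "a \<le> t" "t < b"
      using v consec_right[OF S(1), of e t] by (auto simp: valid_def)
    have "\<exists>k::int. m (ep e t) (e, t, 1) \<le> k \<and>
        (\<forall>\<^sub>F s in at_right (0::real). F (ep e (t + s)) = F (ep e (t + 0)) + real_of_int k * s)"
    proof (rule integral_supports_imp_slope[where u = "b - t" and G = "\<lambda>s. F (ep e (t + s))" and N = N])
      show "\<exists>k::int. \<bar>k\<bar> \<le> N \<and> (\<forall>y. 0 \<le> y \<longrightarrow> y \<le> b - t \<longrightarrow>
          F (ep e (t + x)) + real_of_int k * (y - x) \<le> F (ep e (t + y)))" if xx: "0 < x" "x < b - t" for x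
      proof -
        obtain k :: int where k: "\<bar>k\<bar> \<le> N"
          "\<And>y. a \<le> y \<Longrightarrow> y \<le> b \<Longrightarrow> F (ep e (t + x)) + real_of_int k * (y - (t + x)) \<le> F (ep e y)"
          using two_sided[OF c(1), of "t + x"] xx c by auto
        have "F (ep e (t + x)) + real_of_int k * (y - x) \<le> F (ep e (t + y))" if "0 \<le> y" "y \<le> b - t" for y
          using k(2)[of "t + y"] that c by simp
        then show ?thesis using k(1) by blast
      qed
      show "F (ep e (t + 0)) + real_of_int (m (ep e t) (e, t, 1)) * y \<le> F (ep e (t + y))"
        if "0 \<le> y" "y \<le> b - t" for y
        using m_fwd[of "ep e t" e t a b "t + y"] that c valid_in_pts[OF v] by simp
    qed (use c in auto)
    then show ?thesis using True by (simp add: has_slope_def)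
  next
    case False
    then obtain a b where c: "consec S e a b" "a < t" "t \<le> b" and \<sigma>: "\<sigma> = -1"
      using v consec_left[OF S(1), of e t] by (auto simp: valid_def)
    have "\<exists>k::int. m (ep e t) (e, t, -1) \<le> k \<and>
        (\<forall>\<^sub>F s in at_right (0::real). F (ep e (t - s)) = F (ep e (t - 0)) + real_of_int k * s)"
    proof (rule integral_supports_imp_slope[where u = "t - a" and G = "\<lambda>s. F (ep e (t - s))" and N = N])
      show "\<exists>k::int. \<bar>k\<bar> \<le> N \<and> (\<forall>y. 0 \<le> y \<longrightarrow> y \<le> t - a \<longrightarrow>
          F (ep e (t - x)) + real_of_int k * (y - x) \<le> F (ep e (t - y)))" if xx: "0 < x" "x < t - a" for x
      proof -
        obtain k :: int where k: "\<bar>k\<bar> \<le> N"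
          "\<And>y. a \<le> y \<Longrightarrow> y \<le> b \<Longrightarrow> F (ep e (t - x)) + real_of_int k * (y - (t - x)) \<le> F (ep e y)"
          using two_sided[OF c(1), of "t - x"] xx c by auto
        have "F (ep e (t - x)) + real_of_int (- k) * (y - x) \<le> F (ep e (t - y))" if "0 \<le> y" "y \<le> t - a" for y
          using k(2)[of "t - y"] that c by (simp add: algebra_simps)
        then show ?thesis using k(1) by (intro exI[of _ "- k"]) auto
      qed
      show "F (ep e (t - 0)) + real_of_int (m (ep e t) (e, t, -1)) * y \<le> F (ep e (t - y))"
        if "0 \<le> y" "y \<le> t - a" for y
        using m_bwd[of "ep e t" e t a b "t - y"] that c valid_in_pts[OF v] by simp
    qed (use c in auto)
    then show ?thesis using \<sigma> by (simp add: has_slope_def)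
  qed
  have rF: "rat F" unfolding rat_def using sl by blast
  have "F \<in> towards D q" unfolding towards_def
  proof (intro CollectI conjI ballI impI)
    show "rat F" by (rule rF)
    have "(\<lambda>f. f q) ` towards D q = {0}" using T0 by (auto simp: towards_def)
    then show "F q = 0" by (simp add: F_def)
    show "0 \<le> F p" if "p \<in> pts" for p using le[OF T0 that] by simp
    show "0 \<le> D p + ord F p" if "p \<in> pts" "p \<noteq> q" for p
    proof -
      have "m p d \<le> slope F d" if d: "d \<in> dirs p" for d
      proof -
        obtain e t \<sigma> where dd: "d = (e, t, \<sigma>)" by (cases d)
        then have v: "valid e t \<sigma>" "ep e t = p" using d dirsD by auto
        then obtain k :: int where "m p d \<le> k" "has_slope F d k" using sl[OF v(1)] dd by auto
        then show ?thesis using slope_eq by simp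
      qed
      then have "(\<Sum>d\<in>dirs p. m p d) \<le> ord F p" unfolding ord_def by (rule sum_mono)
      then show ?thesis using mD[OF that] by simp
    qed
  qed
  then show ?thesis using le by blast
qed

end

section \<open>Special divisors\<close>

context metric_network
begin

definition eq_eff :: "(('v, 'e) point \<Rightarrow> int) \<Rightarrow> bool" where
  "eq_eff D \<longleftrightarrow> (\<exists>f. rat f \<and> (\<forall>p\<in>pts. 0 \<le> D p + ord f p))"

definition pt :: "('v, 'e) point \<Rightarrow> ('v, 'e) point \<Rightarrow> int" where
  "pt x p = (if p = x then 1 else 0)"

lemma finite_pt: "finite {p. pt x p \<noteq> 0}"
  by (simp add: pt_def)

lemma degree_pt: "divisor_degree (pt x) = 1"
  by (subst divisor_degree_eq_sum[of "{x}"]) (auto simp: pt_def)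

lemma eq_eff_mono: "eq_eff D \<Longrightarrow> (\<And>p. p \<in> pts \<Longrightarrow> D p \<le> E p) \<Longrightarrow> eq_eff E"
  unfolding eq_eff_def by (meson add_right_mono order_trans)

text \<open>The orientation produced by the fire has \<open>q\<close> as its only source.\<close>
theorem effective_or_below_nu:
  assumes D: "finite {p. D p \<noteq> 0}" and ne: "\<not> eq_eff D"
  shows "\<exists>f \<phi>. rat f \<and> morse \<phi> \<and> (\<forall>p\<in>pts. D p + ord f p \<le> nu \<phi> p)"
proof -
  obtain q where q: "q \<in> pts" using pts_ne by blast
  have "finite ({p. D p \<noteq> 0} \<inter> pts \<union> {q})" "{p. D p \<noteq> 0} \<inter> pts \<union> {q} \<subseteq> pts" using D(1) q by auto
  from nodes_exist[OF this] obtain S0 where S0: "nodes S0" "{p. D p \<noteq> 0} \<inter> pts \<union> {q} \<subseteq> S0" by blast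
  have "\<exists>f. rat f \<and> (\<forall>p\<in>pts. p \<noteq> q \<longrightarrow> 0 \<le> D p + ord f p)"
  proof (rule effective_off_point[OF S0(1)])
    show "0 \<le> D p" if "p \<in> pts" "p \<notin> S0" for p using that S0(2) by (cases "D p = 0") auto
  qed (use S0(2) in blast)
  then obtain f0 where f0: "rat f0" "\<And>p. p \<in> pts \<Longrightarrow> p \<noteq> q \<Longrightarrow> 0 \<le> D p + ord f0 p" by blast
  define D1 where "D1 p = D p + ord f0 p" for p
  have D1: "finite {p. D1 p \<noteq> 0}" unfolding D1_def by (intro finite_support_add D finite_ord f0)
  have D1': "0 \<le> D1 p" if "p \<in> pts" "p \<noteq> q" for p using f0(2) that by (simp add: D1_def)
  \<comment> \<open>Maximality is what makes \<open>D2 = D1 + ord F\<close> reduced: a legal firing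
    of a set avoiding \<open>q\<close> would produce a larger member of
    \<open>towards D1 q\<close>.\<close>
  obtain F where F: "F \<in> towards D1 q" "\<And>f p. f \<in> towards D1 q \<Longrightarrow> p \<in> pts \<Longrightarrow> f p \<le> F p"
    using towards_greatest[OF D1 D1' q] by blast
  have rF: "rat F" and Fq: "F q = 0" using F by (auto simp: towards_def)
  define D2 where "D2 p = D1 p + ord F p" for p
  have D2: "finite {p. D2 p \<noteq> 0}" unfolding D2_def by (intro finite_support_add D1 finite_ord rF)
  have D2': "0 \<le> D2 p" if "p \<in> pts" "p \<noteq> q" for p using F that by (simp add: D2_def towards_def)
  have "finite ({p. D2 p \<noteq> 0} \<inter> pts \<union> {q})" "{p. D2 p \<noteq> 0} \<inter> pts \<union> {q} \<subseteq> pts" using D2 q by auto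
  from nodes_exist[OF this] obtain S where S: "nodes S" "{p. D2 p \<noteq> 0} \<inter> pts \<union> {q} \<subseteq> S" by blast
  have qS: "q \<in> S" using S by blast
  have Spts: "S \<subseteq> pts" "finite S" using S by (auto simp: nodes_def)
  have "\<exists>r :: _ \<Rightarrow> nat. inj_on r S \<and> r q = 0 \<and>
    (\<forall>p\<in>S - {q}. D2 p < int (card {d \<in> dirs p. r (nb S d) < r p}))"
  proof (rule burning[OF S(1) qS], rule ccontr)
    fix U assume U: "U \<subseteq> S - {q}" "U \<noteq> {}"
      and "\<not> (\<exists>p\<in>U. D2 p < int (card {d \<in> dirs p. nb S d \<notin> U}))"
    then have fire: "int (card {d \<in> dirs p. nb S d \<notin> U}) \<le> D2 p" if "p \<in> U" for p
      using that by (simp add: not_less)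
    define G where "G = gap S ` (\<Union>p\<in>S. dirs p)"
    have "finite G" unfolding G_def using Spts finite_dirs by auto
    moreover have "0 < x" if "x \<in> G" for x using that dirs_gap[OF S(1)] by (auto simp: G_def)
    ultimately have "0 < Min (insert 1 G)" by (subst Min_gr_iff) auto
    \<comment> \<open>No larger than any gap, so
      \<open>\<lfloor>- \<epsilon> / gap S d\<rfloor> = -1\<close> and exactly one chip leaves
      \<open>U\<close> along each outward direction. The 1 keeps \<open>Min\<close> meaningful when
      there are no edges.\<close>
    define \<epsilon> where "\<epsilon> = Min (insert 1 G)"
    have \<epsilon>: "0 < \<epsilon>" "\<And>p d. p \<in> S \<Longrightarrow> d \<in> dirs p \<Longrightarrow> \<epsilon> \<le> gap S d"
      using \<open>0 < Min (insert 1 G)\<close> \<open>finite G\<close> by (auto simp: \<epsilon>_def G_def intro!: Min_le)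
    define w where "w p = (if p \<in> U then \<epsilon> else 0)" for p
    let ?g = "interp S w"
    have rg: "rat ?g" by (rule interp_rat[OF S(1)])
    have og: "0 \<le> D2 p + ord ?g p" if p: "p \<in> pts" "p \<noteq> q" for p
    proof (cases "p \<in> S")
      case True
      have sl: "slope ?g d = \<lfloor>(w (nb S d) - w p) / gap S d\<rfloor>" if "d \<in> dirs p" for d
        by (rule slope_interp_dirs[OF S(1) True that])
      show ?thesis
      proof (cases "p \<in> U")
        case True
        have "slope ?g d = (if nb S d \<notin> U then -1 else 0)" if d: "d \<in> dirs p" for d
        proof (cases "nb S d \<in> U")
          case False
          have "\<lfloor>- \<epsilon> / gap S d\<rfloor> = -1"
            using \<epsilon>(1) \<epsilon>(2)[OF \<open>p \<in> S\<close> d] dirs_gap[OF S(1) d] by (simp add: floor_eq_iff field_simps)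
          then show ?thesis using sl[OF d] False True by (simp add: w_def)
        qed (use sl[OF d] True in \<open>simp add: w_def\<close>)
        then have "ord ?g p = (\<Sum>d\<in>dirs p. if nb S d \<notin> U then -1 else 0)" unfolding ord_def by simp
        also have "\<dots> = - int (card {d \<in> dirs p. nb S d \<notin> U})"
          using finite_dirs[OF p(1)] by (subst sum.If_cases) (auto simp: Int_def)
        finally show ?thesis using fire[OF True] by simp
      next
        case False
        have "0 \<le> slope ?g d" if d: "d \<in> dirs p" for d
          using sl[OF d] False \<epsilon>(1) dirs_gap[OF S(1) d] by (simp add: w_def)
        then have "0 \<le> ord ?g p" unfolding ord_def by (rule sum_nonneg)
        then show ?thesis using D2'[OF p] by simp
      qed
    next
      case False
      then show ?thesis using interp_ord_nonneg[OF S(1) False, of w] D2'[OF p] by simp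
    qed
    have "(\<lambda>x. F x + ?g x) \<in> towards D1 q" unfolding towards_def
    proof (intro CollectI conjI ballI impI)
      show "F q + ?g q = 0" using U Fq interp_node[OF qS, of w] by (auto simp: w_def)
      show "0 \<le> F p + ?g p" if "p \<in> pts" for p
        using interp_nonneg[OF S(1) _ that, of w] F(1) that \<epsilon>(1) by (simp add: w_def towards_def)
      show "0 \<le> D1 p + ord (\<lambda>x. F x + ?g x) p" if "p \<in> pts" "p \<noteq> q" for p
        using og[OF that] by (simp add: ord_add rF rg D2_def)
    qed (intro rat_add rF rg)
    moreover obtain p where p: "p \<in> U" using U by blast
    ultimately have "F p + ?g p \<le> F p" using F(2) U Spts by blast
    moreover have "?g p = \<epsilon>" using p U interp_node[of p S w] by (auto simp: w_def)
    ultimately show False using \<epsilon>(1) by simp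
  qed
  then obtain r :: "('v, 'e) point \<Rightarrow> nat" where r: "inj_on r S" "r q = 0"
    "\<And>p. p \<in> S - {q} \<Longrightarrow> D2 p < int (card {d \<in> dirs p. r (nb S d) < r p})" by blast
  from morse_of_rank[OF S(1) r(1)] obtain \<phi> where \<phi>: "morse \<phi>" "\<And>p. p \<notin> S \<Longrightarrow> nu \<phi> p = 0"
    "\<And>p. p \<in> S \<Longrightarrow> nu \<phi> p = int (card {d \<in> dirs p. r (nb S d) < r p}) - 1" by blast
  let ?f = "\<lambda>x. f0 x + F x"
  have o: "D p + ord ?f p = D2 p" for p by (simp add: ord_add f0 rF D2_def D1_def)
  have "D2 q < 0"
  proof (rule ccontr)
    assume "\<not> D2 q < 0"
    then have "0 \<le> D p + ord ?f p" if "p \<in> pts" for p using o D2' that by (cases "p = q") auto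
    then show False using ne rat_add[OF f0(1) rF] unfolding eq_eff_def by blast
  qed
  \<comment> \<open>At \<open>q\<close> no neighbour has rank below 0, so
    \<open>nu \<phi> q = -1\<close>, and \<open>D2 q\<close> is negative. At other nodes the strict
    inequality of integers gives the bound by indegree minus 1, and off \<open>S\<close> both sides
    are 0.\<close>
  then have "D2 p \<le> nu \<phi> p" if "p \<in> pts" for p
    using that r(2) r(3)[of p] \<phi>(2,3)[of p] S(2) by (cases "p = q"; cases "p \<in> S") force+
  then show ?thesis using o \<phi>(1) rat_add[OF f0(1) rF] by metis
qed

text \<open>\<open>F\<close> is the slack below \<open>nu \<phi>\<close>. Everything vanishes
  outside \<open>pts\<close>, so the equation holds at all points and degrees can be
  compared.\<close>

lemma not_eff_complement:
  assumes D: "finite {p. D p \<noteq> 0}" "\<And>p. p \<notin> pts \<Longrightarrow> D p = 0" and ne: "\<not> eq_eff D"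
  obtains f \<phi> F where "rat f" "morse \<phi>" "\<And>p. 0 \<le> F p" "\<And>p. D p + ord f p + F p = nu \<phi> p"
    "finite {p. F p \<noteq> 0}" "divisor_degree F = int (card A) - int (card V) - divisor_degree D"
proof -
  obtain f \<phi> where f: "rat f" and \<phi>: "morse \<phi>" and le: "\<And>p. p \<in> pts \<Longrightarrow> D p + ord f p \<le> nu \<phi> p"
    using effective_or_below_nu[OF D(1) ne] by blast
  define F where "F p = nu \<phi> p - (D p + ord f p)" for p
  note fin = finite_support_add[OF D(1) finite_ord[OF f]]
  have "0 \<le> F p" for p using le[of p] D(2)[of p] by (cases "p \<in> pts") (simp_all add: F_def nu_def ord_outside)
  moreover have "finite {p. F p \<noteq> 0}"
    unfolding F_def by (rule finite_support_diff[OF nu_degree(1)[OF \<phi>] fin])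
  moreover have "divisor_degree F = int (card A) - int (card V) - divisor_degree D"
    unfolding F_def using divisor_degree_diff[OF nu_degree(1)[OF \<phi>] fin] nu_degree(2)[OF \<phi>]
      divisor_degree_add[OF D(1) finite_ord[OF f]] degree_ord[OF f] by simp
  ultimately show ?thesis using f \<phi> by (intro that[of f \<phi> F]) (auto simp: F_def)
qed

text \<open>Here \<open>x + x' - y\<close> has degree 1, so \<open>F\<close> has degree
  \<open>g - 2\<close> and \<open>K - F - z\<close> has degree \<open>g - 1\<close>. If the latter
  were not equivalent to an effective divisor, its own slack would be 0; it would be equivalent to
  some \<open>nu \<psi>\<close>, and the effective \<open>F + z\<close> to
  \<open>nu (- \<psi>)\<close>. On the other hand \<open>K - F - x - x'\<close> is equivalent to
  \<open>nu (- \<phi>) - y\<close>, and even adding \<open>y\<close> does not make this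
  effective.\<close>

lemma special_decomposition:
  assumes x: "x \<in> pts" "x' \<in> pts" "y \<in> pts" and ne: "\<not> eq_eff (\<lambda>p. pt x p + pt x' p - pt y p)"
  obtains F where "\<And>p. 0 \<le> F p" "eq_eff (\<lambda>p. K p - F p - pt x p)" "eq_eff (\<lambda>p. K p - F p - pt x' p)"
    "\<not> eq_eff (\<lambda>p. K p - F p - pt x p - pt x' p)"
proof -
  let ?D = "\<lambda>p. pt x p + pt x' p - pt y p"
  have fD: "finite {p. ?D p \<noteq> 0}" by (rule finite_subset[of _ "{x, x', y}"]) (auto simp: pt_def)
  have degD: "divisor_degree ?D = 1"
    using x by (subst divisor_degree_eq_sum[of "{x, x', y}"]) (auto simp: pt_def sum.insert_if)
  obtain f \<phi> F where f: "rat f" and \<phi>: "morse \<phi>" and F: "\<And>p. 0 \<le> F p" "\<And>p. ?D p + ord f p + F p = nu \<phi> p"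
    "finite {p. F p \<noteq> 0}" "divisor_degree F = int (card A) - int (card V) - divisor_degree ?D"
    by (rule not_eff_complement[OF fD _ ne]) (use x in \<open>auto simp: pt_def\<close>)
  have outF: "F p = 0" if "p \<notin> pts" for p
    using F(2)[of p] that x by (auto simp: nu_def ord_outside pt_def split: if_splits)
  have A: "eq_eff (\<lambda>p. K p - F p - pt z p)" if z: "z \<in> pts" for z
  proof (rule ccontr)
    let ?E = "\<lambda>p. K p - F p - pt z p"
    assume no: "\<not> eq_eff ?E"
    have fKF: "finite {p. K p - F p \<noteq> 0}"
      by (rule finite_support_diff[OF finite_K F(3)])
    have fE: "finite {p. ?E p \<noteq> 0}"
      by (rule finite_support_diff[OF fKF finite_pt])
    have degE: "divisor_degree ?E = int (card A) - int (card V)"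
      using divisor_degree_diff[OF fKF finite_pt[of z]] divisor_degree_diff[OF finite_K F(3)]
        degree_K F(4) degD degree_pt by simp
    obtain g \<psi> H where g: "rat g" and \<psi>: "morse \<psi>" and H: "\<And>p. 0 \<le> H p" "\<And>p. ?E p + ord g p + H p = nu \<psi> p"
      "finite {p. H p \<noteq> 0}" "divisor_degree H = int (card A) - int (card V) - divisor_degree ?E"
      by (rule not_eff_complement[OF fE _ no]) (use z outF in \<open>auto simp: pt_def K_def\<close>)
    have "H p = 0" for p by (rule divisor_degree_eq_0D[OF _ H(3,1)]) (use H(4) degE in simp)
    then have "nu (\<lambda>x. - \<psi> x) p + ord g p = F p + pt z p" for p
      using H(2)[of p] nu_uminus[OF \<psi>, of p] by simp
    moreover have "0 \<le> F p + pt z p" for p using F(1)[of p] by (simp add: pt_def)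
    ultimately have "\<not> nu (\<lambda>x. - \<psi> x) p + ord g p < 0" for p by (simp add: not_less)
    then show False using nu_not_effective[OF morse_uminus[OF \<psi>] g] by blast
  qed
  have "\<not> eq_eff (\<lambda>p. K p - F p - pt x p - pt x' p)"
  proof
    assume "eq_eff (\<lambda>p. K p - F p - pt x p - pt x' p)"
    then obtain g where g: "rat g" "\<And>p. p \<in> pts \<Longrightarrow> 0 \<le> K p - F p - pt x p - pt x' p + ord g p"
      by (auto simp: eq_eff_def)
    have "0 \<le> nu (\<lambda>x. - \<phi> x) p + ord (\<lambda>x. f x + g x) p" if "p \<in> pts" for p
      using g(2)[OF that] F(2)[of p] nu_uminus[OF \<phi>, of p] ord_add[OF f g(1), of p]
      by (simp add: pt_def split: if_splits)
    then show False using nu_not_effective[OF morse_uminus[OF \<phi>] rat_add[OF f g(1)]] by fastforce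
  qed
  then show ?thesis using that F(1) A x by blast
qed

theorem canonical_separates:
  assumes x: "x \<in> pts" "x' \<in> pts" "y \<in> pts" "x \<noteq> x'"
    and ne: "\<not> eq_eff (\<lambda>p. pt x p + pt x' p - pt y p)"
  shows "\<exists>f g. rat f \<and> rat g \<and> (\<forall>p\<in>pts. 0 \<le> K p + ord f p) \<and> (\<forall>p\<in>pts. 0 \<le> K p + ord g p) \<and>
    f x - f x' \<noteq> g x - g x'"
proof -
  obtain F where F: "\<And>p. 0 \<le> F p" "eq_eff (\<lambda>p. K p - F p - pt x p)" "eq_eff (\<lambda>p. K p - F p - pt x' p)"
    "\<not> eq_eff (\<lambda>p. K p - F p - pt x p - pt x' p)"
    using special_decomposition[OF x(1-3) ne] by blast
  obtain f where f: "rat f" "\<And>p. p \<in> pts \<Longrightarrow> 0 \<le> K p - F p - pt x p + ord f p"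
    using F(2) by (auto simp: eq_eff_def)
  obtain g where g: "rat g" "\<And>p. p \<in> pts \<Longrightarrow> 0 \<le> K p - F p - pt x' p + ord g p"
    using F(3) by (auto simp: eq_eff_def)
  have "f x - f x' \<noteq> g x - g x'"
  proof
    assume eq: "f x - f x' = g x - g x'"
    define c where "c = f x - g x"
    define g' where "g' p = g p + c" for p
    have rg': "rat g'" unfolding g'_def by (intro rat_add g rat_const)
    have og': "ord g' p = ord g p" for p
      unfolding g'_def by (simp add: ord_add[OF g(1) rat_const] ord_const)
    have same: "f x = g' x" "f x' = g' x'" using eq by (auto simp: g'_def c_def)
    define h where "h p = max (f p) (g' p)" for p
    have rh: "rat h" unfolding h_def by (intro rat_max f rg')
    have h1: "ord f p \<le> ord h p" if "g' p \<le> f p" for p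
      unfolding h_def[abs_def] by (rule ord_max_ge[OF f(1) rg' that])
    have h2: "ord g p \<le> ord h p" if "f p \<le> g' p" for p
      unfolding h_def[abs_def] og'[symmetric] by (rule ord_max_ge'[OF f(1) rg' that])
    \<comment> \<open>At \<open>x\<close> the function \<open>f\<close> already pays for
      \<open>pt x\<close>, and at \<open>x'\<close> the function \<open>g\<close> pays for
      \<open>pt x'\<close>. The ties at these two points let \<open>h\<close> inherit the order of
      the function that is needed.\<close>
    have "0 \<le> K p - F p - pt x p - pt x' p + ord h p" if p: "p \<in> pts" for p
    proof -
      consider "p = x" | "p = x'" | "p \<noteq> x" "p \<noteq> x'" by blast
      then show ?thesis
      proof cases
        case 1 then show ?thesis using f(2)[OF p] h1[of p] same x(4) by (simp add: pt_def)
      next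
        case 2 then show ?thesis using g(2)[OF p] h2[of p] same x(4) by (simp add: pt_def)
      next
        case 3 then show ?thesis using f(2)[OF p] g(2)[OF p] h1[of p] h2[of p]
          by (cases "g' p \<le> f p") (auto simp: pt_def)
      qed
    qed
    then show False using F(4) rh by (auto simp: eq_eff_def)
  qed
  moreover have "0 \<le> K p + ord f p" "0 \<le> K p + ord g p" if "p \<in> pts" for p
    using f(2)[OF that] g(2)[OF that] F(1)[of p] by (auto simp: pt_def split: if_splits)
  ultimately show ?thesis by (intro exI[of _ f] exI[of _ g] conjI ballI f(1) g(1))
qed

text \<open>The decomposition with \<open>x' = x\<close>. It supplies a spare canonical chip at the
  base of an infinite edge.\<close>

theorem canonical_minus_point:
  assumes x: "x \<in> pts" "y \<in> pts" and ne: "\<not> eq_eff (\<lambda>p. pt x p + pt x p - pt y p)"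
  shows "eq_eff (\<lambda>p. K p - pt x p)"
proof -
  obtain F where F: "\<And>p. 0 \<le> F p" "eq_eff (\<lambda>p. K p - F p - pt x p)"
    using special_decomposition[OF x(1,1,2) ne] by blast
  show ?thesis by (rule eq_eff_mono[OF F(2)]) (use F(1) in auto)
qed

lemma degree_0_effective:
  assumes "finite {p. D p \<noteq> 0}" "\<And>p. p \<notin> pts \<Longrightarrow> D p = 0" "divisor_degree D = 0" "eq_eff D"
  obtains f where "rat f" "\<And>p. D p + ord f p = 0"
proof -
  obtain f where f: "rat f" "\<And>p. p \<in> pts \<Longrightarrow> 0 \<le> D p + ord f p" using assms(4) by (auto simp: eq_eff_def)
  have "D p + ord f p = 0" for p
  proof (rule divisor_degree_eq_0D)
    show "divisor_degree (\<lambda>p. D p + ord f p) = 0"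
      using divisor_degree_add[OF assms(1) finite_ord[OF f(1)]] degree_ord[OF f(1)] assms(3) by simp
    show "finite {p. D p + ord f p \<noteq> 0}" by (intro finite_support_add assms finite_ord f)
    show "0 \<le> D p + ord f p" for p
      using f(2)[of p] assms(2)[of p] by (cases "p \<in> pts") (auto simp: ord_outside)
  qed
  then show ?thesis using that f(1) by blast
qed

text \<open>Otherwise any two points are equivalent, and then some \<open>nu \<phi>\<close> is equivalent to an effective
  divisor.\<close>
theorem degree_2_rank_le_1:
  assumes genus: "card V \<le> card A" and x: "x \<in> pts" "x' \<in> pts"
  shows "\<exists>y\<in>pts. \<exists>z\<in>pts. \<not> eq_eff (\<lambda>p. pt x p + pt x' p - pt y p - pt z p)"
proof (rule ccontr)
  assume "\<not> ?thesis"
  then have all: "eq_eff (\<lambda>p. pt x p + pt x' p - pt y p - pt z p)" if "y \<in> pts" "z \<in> pts" for y z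
    using that by blast
  have ex: "\<exists>f. rat f \<and> (\<forall>p. pt x p + pt x' p - pt y p - pt z p + ord f p = 0)" if yz: "y \<in> pts" "z \<in> pts" for y z
  proof -
    let ?D = "\<lambda>p. pt x p + pt x' p - pt y p - pt z p"
    have fin: "finite {p. ?D p \<noteq> 0}" by (rule finite_subset[of _ "{x, x', y, z}"]) (auto simp: pt_def)
    have deg: "divisor_degree ?D = 0"
      by (subst divisor_degree_eq_sum[of "{x, x', y, z}"]) (auto simp: pt_def sum.insert_if)
    have out: "?D p = 0" if "p \<notin> pts" for p using x yz that by (auto simp: pt_def)
    obtain f where "rat f" "\<And>p. ?D p + ord f p = 0"
      using degree_0_effective[OF fin out deg all[OF yz]] by blast
    then show ?thesis by blast
  qed
  obtain q where q: "q \<in> pts" using pts_ne by blast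
  have fq: "finite {p. - pt q p \<noteq> 0}" using finite_pt by simp
  have "\<not> eq_eff (\<lambda>p. - pt q p)"
  proof
    assume "eq_eff (\<lambda>p. - pt q p)"
    then obtain f where f: "rat f" "\<And>p. p \<in> pts \<Longrightarrow> 0 \<le> - pt q p + ord f p" by (auto simp: eq_eff_def)
    have "0 \<le> - pt q p + ord f p" for p using f(2)[of p] q by (cases "p \<in> pts") (auto simp: ord_outside pt_def)
    then have "0 \<le> divisor_degree (\<lambda>p. - pt q p + ord f p)" by (rule divisor_degree_nonneg)
    then show False using divisor_degree_add[OF fq finite_ord[OF f(1)]] degree_ord[OF f(1)]
      by (simp add: divisor_degree_uminus degree_pt)
  qed
  then obtain f \<phi> F where f: "rat f" and \<phi>: "morse \<phi>" and F: "\<And>p. 0 \<le> F p" "\<And>p. - pt q p + ord f p + F p = nu \<phi> p"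
    "finite {p. F p \<noteq> 0}" "divisor_degree F = int (card A) - int (card V) - divisor_degree (\<lambda>p. - pt q p)"
    by (rule not_eff_complement[OF fq, rotated]) (use q in \<open>auto simp: pt_def\<close>)
  \<comment> \<open>The degree of \<open>- q\<close> is -1, so \<open>F\<close> has degree
    \<open>g\<close>, which is positive. Some \<open>y\<close> in its support can be traded for
    \<open>q\<close>.\<close>
  have "divisor_degree F \<noteq> 0" using F(4) genus by (simp add: divisor_degree_uminus degree_pt)
  then have "\<exists>y. F y \<noteq> 0" by (rule contrapos_np) (simp add: divisor_degree_def)
  then obtain y where y: "F y \<noteq> 0" by blast
  have yp: "y \<in> pts"
    using F(2)[of y] y q by (cases "y \<in> pts") (auto simp: nu_def ord_outside pt_def split: if_splits)
  \<comment> \<open>Both \<open>q + q\<close> and \<open>y + q\<close> are equivalent to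
    \<open>x + x'\<close>, so \<open>q\<close> and \<open>y\<close> are equivalent, and
    \<open>F - q\<close> can be replaced by the effective divisor \<open>F - y\<close>.\<close>
  obtain g where g: "rat g" "\<And>p. pt x p + pt x' p - pt q p - pt q p + ord g p = 0" using ex[OF q q] by blast
  obtain h where h: "rat h" "\<And>p. pt x p + pt x' p - pt y p - pt q p + ord h p = 0" using ex[OF yp q] by blast
  let ?u = "\<lambda>p. (- f p + g p) + - h p"
  have ru: "rat ?u" by (intro rat_add rat_uminus f g h)
  have ou: "ord ?u p = - ord f p + ord g p - ord h p" for p
    by (simp only: ord_add[OF rat_add[OF rat_uminus[OF f] g(1)] rat_uminus[OF h(1)]]
        ord_add[OF rat_uminus[OF f] g(1)] ord_uminus[OF f] ord_uminus[OF h(1)] diff_conv_add_uminus)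
  have "nu \<phi> p + ord ?u p = F p - pt y p" for p
    unfolding ou using F(2)[of p] g(2)[of p] h(2)[of p] by linarith
  moreover have "0 \<le> F p - pt y p" for p using F(1)[of p] y by (cases "p = y") (auto simp: pt_def)
  ultimately have "\<not> nu \<phi> p + ord ?u p < 0" for p by (simp only: not_less)
  then show False using nu_not_effective[OF \<phi> ru] by blast
qed

end

section \<open>The core of a tropical curve\<close>

locale tropical =
  fixes \<Gamma> :: "('v, 'e) metric_graph"
  assumes curve: "tropical_curve \<Gamma>" and genus: "1 \<le> genus \<Gamma>"
begin

abbreviation G where "G \<equiv> graph \<Gamma>"

definition legs :: "'e set" where
  "legs = {e \<in> arcs G. len \<Gamma> e = \<infinity>}"

definition core_arcs :: "'e set" where
  "core_arcs = {e \<in> arcs G. len \<Gamma> e \<noteq> \<infinity>}"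

definition core_verts :: "'v set" where
  "core_verts = verts G - head G ` legs"

definition arc_length :: "'e \<Rightarrow> real" where
  "arc_length e = real_of_ereal (len \<Gamma> e)"

lemma fin_digraph_G: "fin_digraph G"
  using curve by (simp add: tropical_curve_def)

sublocale fin_digraph G
  by (rule fin_digraph_G)

lemma len_pos: "e \<in> arcs G \<Longrightarrow> 0 < len \<Gamma> e"
  using curve by (simp add: tropical_curve_def)

lemma len_core: "e \<in> core_arcs \<Longrightarrow> len \<Gamma> e = ereal (arc_length e)"
  using len_pos[of e] by (cases "len \<Gamma> e") (auto simp: core_arcs_def arc_length_def)

lemma len_leg: "e \<in> legs \<Longrightarrow> len \<Gamma> e = \<infinity>"
  by (simp add: legs_def)

lemma arcs_split: "arcs G = core_arcs \<union> legs" "core_arcs \<inter> legs = {}"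
  by (auto simp: core_arcs_def legs_def)

lemma leg_head:
  assumes e: "e \<in> legs"
  shows "in_arcs G (head G e) = {e}" "out_arcs G (head G e) = {}"
proof -
  let ?v = "head G e"
  have a: "e \<in> arcs G" using e by (simp add: legs_def)
  have val: "card (in_arcs G ?v) + card (out_arcs G ?v) = 1"
    using curve e by (auto simp: tropical_curve_def legs_def vertex_valence_def in_degree_def out_degree_def)
  have "e \<in> in_arcs G ?v" using a by (simp add: in_arcs_def)
  then have "0 < card (in_arcs G ?v)" by (auto simp: card_gt_0_iff in_arcs_def)
  then have c: "card (in_arcs G ?v) = 1" "card (out_arcs G ?v) = 0" using val by auto
  then obtain e' where "in_arcs G ?v = {e'}" by (auto simp: card_1_singleton_iff)
  then show "in_arcs G ?v = {e}" using \<open>e \<in> in_arcs G ?v\<close> by auto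
  show "out_arcs G ?v = {}" using c(2) by (auto simp: out_arcs_def)
qed

lemma leg_head_inj: "e \<in> legs \<Longrightarrow> e' \<in> arcs G \<Longrightarrow> head G e' = head G e \<Longrightarrow> e' = e"
  using leg_head(1)[of e] by (auto simp: in_arcs_def)

lemma leg_tail_head: "e \<in> legs \<Longrightarrow> e' \<in> arcs G \<Longrightarrow> tail G e' \<noteq> head G e"
  using leg_head(2)[of e] by (auto simp: out_arcs_def)

lemma tail_core: "e \<in> arcs G \<Longrightarrow> tail G e \<in> core_verts"
  using leg_tail_head by (auto simp: core_verts_def)

lemma head_core: "e \<in> core_arcs \<Longrightarrow> head G e \<in> core_verts"
  using leg_head_inj by (auto simp: core_verts_def core_arcs_def legs_def)

text \<open>Induction along a path in the symmetric closure. This turns reachability into the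
  closure principle by which \<open>metric_network\<close> expresses connectedness.\<close>

lemma connected_closed:
  assumes W: "W \<subseteq> verts G" "W \<noteq> {}" and cl: "\<And>e. e \<in> arcs G \<Longrightarrow> tail G e \<in> W \<longleftrightarrow> head G e \<in> W"
  shows "W = verts G"
proof
  interpret S: pair_wf_digraph "mk_symmetric G" by (rule wellformed_mk_symmetric)
  show "verts G \<subseteq> W"
  proof
    fix v assume v: "v \<in> verts G"
    obtain u where u: "u \<in> W" using W by blast
    have "u \<rightarrow>\<^sup>*\<^bsub>with_proj (mk_symmetric G)\<^esub> v"
      using curve u v W by (auto simp: tropical_curve_def Digraph_Component.connected_def strongly_connected_def)
    then show "v \<in> W"
    proof (induction rule: S.reachable_induct)
      case base show ?case by (rule u)
    next
      case (step x y)
      then have "(x, y) \<in> parcs (mk_symmetric G)" by simp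
      then obtain e where "e \<in> arcs G" "x = tail G e \<and> y = head G e \<or> x = head G e \<and> y = tail G e"
        by (auto simp: mk_symmetric_def)
      then show ?case using cl[of e] step by auto
    qed
  qed
qed (rule W)

sublocale N: metric_network core_verts core_arcs "tail G" "head G" arc_length
proof
  show "finite core_verts" "finite core_arcs" by (simp_all add: core_verts_def core_arcs_def)
  show "tail G e \<in> core_verts" "head G e \<in> core_verts" "0 < arc_length e" if "e \<in> core_arcs" for e
    using that tail_core head_core len_pos[of e] len_core[OF that] by (auto simp: core_arcs_def)
  show "core_verts \<noteq> {}"
  proof -
    obtain v where v: "v \<in> verts G"
      using curve by (auto simp: tropical_curve_def Digraph_Component.connected_def strongly_connected_def)
    show ?thesis
    proof (cases "v \<in> core_verts")
      case False
      then obtain e where "e \<in> legs" using v by (auto simp: core_verts_def)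
      then show ?thesis using tail_core[of e] by (auto simp: legs_def)
    qed auto
  qed
  fix W assume W: "W \<subseteq> core_verts" "W \<noteq> {}" "\<And>e. e \<in> core_arcs \<Longrightarrow> tail G e \<in> W \<longleftrightarrow> head G e \<in> W"
  \<comment> \<open>Adding the infinite ends of the legs based in \<open>W\<close> makes the set
    closed under all arcs of the curve.\<close>
  define W' where "W' = W \<union> head G ` {e \<in> legs. tail G e \<in> W}"
  have mem: "v \<in> W' \<longleftrightarrow> v \<in> W" if "v \<in> core_verts" for v
    using that by (auto simp: W'_def core_verts_def)
  have "W' = verts G"
  proof (rule connected_closed)
    show "W' \<subseteq> verts G" "W' \<noteq> {}" using W by (auto simp: W'_def core_verts_def legs_def)
    fix e assume e: "e \<in> arcs G"
    show "tail G e \<in> W' \<longleftrightarrow> head G e \<in> W'"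
    proof (cases "e \<in> legs")
      case True
      have "head G e \<in> W' \<longleftrightarrow> tail G e \<in> W"
      proof
        assume "head G e \<in> W'"
        moreover have "head G e \<notin> W" using True W by (auto simp: core_verts_def)
        ultimately obtain e' where "e' \<in> legs" "tail G e' \<in> W" "head G e = head G e'" by (auto simp: W'_def)
        then show "tail G e \<in> W" using leg_head_inj[of e e'] True by (auto simp: legs_def)
      qed (use True in \<open>auto simp: W'_def\<close>)
      then show ?thesis using mem[OF tail_core[OF e]] by simp
    next
      case False
      then have "e \<in> core_arcs" using e arcs_split by auto
      then show ?thesis using mem[OF tail_core[OF e]] mem[OF head_core] W(3) by simp
    qed
  qed
  then show "W = core_verts" using mem W by (auto simp: core_verts_def)
qed

text \<open>Each leg takes one arc and one vertex with it, so cutting off the legs keeps the genus,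
  which is at least 1.\<close>

lemma card_core: "card core_verts \<le> card core_arcs"
proof -
  have "inj_on (head G) legs" using leg_head_inj by (auto simp: inj_on_def legs_def)
  then have "card (head G ` legs) = card legs" by (rule card_image)
  moreover have "card (arcs G) = card core_arcs + card legs"
    using arcs_split card_Un_disjoint[of core_arcs legs] by (simp add: core_arcs_def legs_def)
  moreover have "card (verts G) = card core_verts + card (head G ` legs)"
  proof -
    have "verts G = core_verts \<union> head G ` legs" by (auto simp: core_verts_def legs_def)
    moreover have "finite core_verts" "finite (head G ` legs)" by (simp_all add: core_verts_def legs_def)
    moreover have "core_verts \<inter> head G ` legs = {}" by (auto simp: core_verts_def)
    ultimately show ?thesis by (metis card_Un_disjoint)
  qed
  ultimately show ?thesis using genus by (simp add: genus_def)
qed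

abbreviation edge_at :: "'e \<Rightarrow> real \<Rightarrow> ('v, 'e) point" where
  "edge_at e t \<equiv> edge_point \<Gamma> e (ereal t)"

lemma edge_point_core:
  assumes "e \<in> core_arcs"
  shows "edge_at e t = N.ep e t"
  using len_core[OF assms] by (auto simp: edge_point_def N.ep_def)

lemma edge_point_leg:
  assumes "e \<in> legs"
  shows "edge_at e t = (if t = 0 then Vertex (tail G e) else Inner e t)"
    "edge_point \<Gamma> e \<infinity> = Vertex (head G e)"
  using len_leg[OF assms] by (auto simp: edge_point_def)

lemma points_at_infinity_eq: "points_at_infinity \<Gamma> = (\<lambda>e. Vertex (head G e)) ` legs"
  by (auto simp: points_at_infinity_def legs_def)

lemma points_cases:
  assumes "x \<in> points \<Gamma>"
  obtains "x \<in> N.pts" | e t where "e \<in> legs" "0 < t" "x = Inner e t"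
    | e where "e \<in> legs" "x = Vertex (head G e)"
proof (cases x)
  case (Vertex v)
  then have "v \<in> verts G" using assms by (auto simp: points_def)
  then have "v \<in> core_verts \<or> (\<exists>e\<in>legs. v = head G e)" by (auto simp: core_verts_def)
  then show ?thesis using Vertex that N.Vertex_in_pts by blast
next
  case (Inner e t)
  then have e: "e \<in> arcs G" "0 < t" "ereal t < len \<Gamma> e" using assms by (auto simp: points_def)
  show ?thesis
  proof (cases "e \<in> legs")
    case True then show ?thesis using that e Inner by auto
  next
    case False
    then have "e \<in> core_arcs" using e arcs_split by auto
    then show ?thesis using that e Inner len_core[of e] by auto
  qed
qed

lemma core_in_points: "x \<in> N.pts \<Longrightarrow> x \<in> points \<Gamma>"
proof (cases x)
  case (Vertex v)
  assume "x \<in> N.pts"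
  then have "v \<in> verts G" using Vertex by (simp add: core_verts_def[THEN eqset_imp_iff])
  then show ?thesis using Vertex by (simp add: points_def)
next
  case (Inner e t)
  assume "x \<in> N.pts"
  then have "e \<in> core_arcs" "0 < t" "t < arc_length e" using Inner by simp_all
  then show ?thesis using Inner len_core[of e] by (auto simp: points_def core_arcs_def)
qed

lemma leg_in_points: "e \<in> legs \<Longrightarrow> 0 < t \<Longrightarrow> Inner e t \<in> points \<Gamma>"
    "e \<in> legs \<Longrightarrow> Vertex (head G e) \<in> points \<Gamma>"
  by (auto simp: points_def legs_def)

lemma core_not_infinity: "x \<in> N.pts \<Longrightarrow> x \<notin> points_at_infinity \<Gamma>"
proof
  assume x: "x \<in> N.pts" "x \<in> points_at_infinity \<Gamma>"
  then obtain e where e: "e \<in> legs" "x = Vertex (head G e)" by (auto simp: points_at_infinity_eq)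
  then have "head G e \<in> core_verts" using x by simp
  then show False using e by (simp add: core_verts_def)
qed

text \<open>Only the legs based at \<open>x\<close> are missing from its valence in the core. The
  correction is a sum of ones so that it combines with the sum of leg slopes in
  \<open>ext_ord_core\<close>.\<close>

lemma canonical_core:
  assumes "x \<in> N.pts"
  shows "canonical \<Gamma> x = N.K x + (\<Sum>e | e \<in> legs \<and> Vertex (tail G e) = x. 1)"
proof (cases x)
  case (Vertex v)
  have v: "v \<in> core_verts" using assms Vertex by simp
  have "out_arcs G v = {e \<in> core_arcs. tail G e = v} \<union> {e \<in> legs. Vertex (tail G e) = x}"
    using arcs_split Vertex by (auto simp: out_arcs_def)
  moreover have "finite core_arcs" "finite legs" by (simp_all add: core_arcs_def legs_def)
  moreover have "{e \<in> core_arcs. tail G e = v} \<inter> {e \<in> legs. Vertex (tail G e) = x} = {}"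
    using arcs_split by auto
  ultimately have o: "card (out_arcs G v) = card {e \<in> core_arcs. tail G e = v} + card {e \<in> legs. Vertex (tail G e) = x}"
    by (simp add: card_Un_disjoint)
  have i: "in_arcs G v = {e \<in> core_arcs. head G e = v}"
    using arcs_split v by (auto simp: in_arcs_def core_verts_def)
  have "int (card (N.dirs x)) = int (card {e \<in> core_arcs. tail G e = v}) + int (card {e \<in> core_arcs. head G e = v})"
    using N.sum_dirs_Vertex[of "\<lambda>_. 1 :: int" v] by (simp add: Vertex)
  moreover have "int (valence \<Gamma> x) = int (card (out_arcs G v)) + int (card (in_arcs G v))"
    by (simp add: valence_def vertex_valence_def in_degree_def out_degree_def Vertex)
  ultimately show ?thesis
    using assms core_in_points[OF assms] o i by (simp add: canonical_def N.K_def)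
next
  case (Inner e t)
  then show ?thesis using assms core_in_points[OF assms]
    by (simp add: canonical_def valence_def N.K_def N.card_dirs_Inner)
qed

lemma canonical_leg:
  assumes "e \<in> legs"
  shows "0 < t \<Longrightarrow> canonical \<Gamma> (Inner e t) = 0" "canonical \<Gamma> (Vertex (head G e)) = -1"
  using leg_in_points[OF assms] leg_head[OF assms]
  by (simp_all add: canonical_def valence_def vertex_valence_def in_degree_def out_degree_def)

end

section \<open>Computing one-sided slopes of extended-real functions\<close>

lemma affine_slope_unique:
  fixes a b c d :: real
  assumes ev: "\<forall>\<^sub>F t in F. a * t + c = b * t + d" and F: "F \<noteq> bot" "\<And>y. \<forall>\<^sub>F t in F. t \<noteq> y"
  shows "a = b"
proof -
  obtain t where t: "a * t + c = b * t + d" using eventually_happens'[OF F(1) ev] by blast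
  obtain u where u: "a * u + c = b * u + d" "u \<noteq> t"
    using eventually_happens'[OF F(1) eventually_conj[OF ev F(2)[of t]]] by blast
  have "(a - b) * (u - t) = 0" using t u by (simp add: algebra_simps)
  then show ?thesis using u by simp
qed

lemma eventually_at_right_shift:
  fixes t :: real
  shows "eventually P (at_right t) \<longleftrightarrow> (\<forall>\<^sub>F h in at_right 0. P (t + h))"
  by (subst at_right_to_0) (simp add: eventually_filtermap add.commute)

lemma eventually_at_left_shift:
  fixes t :: real
  shows "eventually P (at_left t) \<longleftrightarrow> (\<forall>\<^sub>F h in at_right 0. P (t - h))"
proof -
  have "eventually P (at_left t) \<longleftrightarrow> (\<forall>\<^sub>F h in at_right (-t). P (- h))"
    by (subst at_left_minus) (simp add: eventually_filtermap)
  also have "\<dots> \<longleftrightarrow> (\<forall>\<^sub>F h in at_right 0. P (t - h))"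
    by (subst eventually_at_right_shift) simp
  finally show ?thesis .
qed

lemma slope_after_eqI:
  assumes "\<forall>\<^sub>F t in at_right x. g (edge_point \<Gamma> e (ereal t)) = ereal (of_int m * t + c)"
  shows "slope_after \<Gamma> g e (ereal x) = m"
  unfolding slope_after_def
proof (rule the_equality)
  show "\<exists>c::real. \<forall>\<^sub>F t in at_right (ereal x). g (edge_point \<Gamma> e t) = ereal (of_int m * real_of_ereal t + c)"
    using assms by (auto simp: at_right_ereal eventually_filtermap)
  fix n assume "\<exists>c::real. \<forall>\<^sub>F t in at_right (ereal x). g (edge_point \<Gamma> e t) = ereal (of_int n * real_of_ereal t + c)"
  then obtain d where "\<forall>\<^sub>F t in at_right x. g (edge_point \<Gamma> e (ereal t)) = ereal (of_int n * t + d)"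
    by (auto simp: at_right_ereal eventually_filtermap)
  with assms have "\<forall>\<^sub>F t in at_right x. of_int n * t + d = of_int m * t + c"
    by eventually_elim simp
  then have "real_of_int n = of_int m"
    by (rule affine_slope_unique) (auto intro: eventually_neq_at_within)
  then show "n = m" by simp
qed

lemma slope_before_eqI:
  assumes "\<forall>\<^sub>F t in at_left x. g (edge_point \<Gamma> e (ereal t)) = ereal (of_int m * t + c)"
  shows "slope_before \<Gamma> g e (ereal x) = m"
  unfolding slope_before_def
proof (rule the_equality)
  show "\<exists>c::real. \<forall>\<^sub>F t in at_left (ereal x). g (edge_point \<Gamma> e t) = ereal (of_int m * real_of_ereal t + c)"
    using assms by (auto simp: at_left_ereal eventually_filtermap)
  fix n assume "\<exists>c::real. \<forall>\<^sub>F t in at_left (ereal x). g (edge_point \<Gamma> e t) = ereal (of_int n * real_of_ereal t + c)"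
  then obtain d where "\<forall>\<^sub>F t in at_left x. g (edge_point \<Gamma> e (ereal t)) = ereal (of_int n * t + d)"
    by (auto simp: at_left_ereal eventually_filtermap)
  with assms have "\<forall>\<^sub>F t in at_left x. of_int n * t + d = of_int m * t + c"
    by eventually_elim simp
  then have "real_of_int n = of_int m"
    by (rule affine_slope_unique) (auto intro: eventually_neq_at_within)
  then show "n = m" by simp
qed

lemma slope_before_infinity_eqI:
  assumes "\<forall>\<^sub>F t in at_top. g (edge_point \<Gamma> e (ereal t)) = ereal (of_int m * t + c)"
  shows "slope_before \<Gamma> g e \<infinity> = m"
  unfolding slope_before_def
proof (rule the_equality)
  show "\<exists>c::real. \<forall>\<^sub>F t in at_left \<infinity>. g (edge_point \<Gamma> e t) = ereal (of_int m * real_of_ereal t + c)"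
    using assms by (auto simp: at_left_PInf eventually_filtermap)
  fix n assume "\<exists>c::real. \<forall>\<^sub>F t in at_left \<infinity>. g (edge_point \<Gamma> e t) = ereal (of_int n * real_of_ereal t + c)"
  then obtain d where "\<forall>\<^sub>F t in at_top. g (edge_point \<Gamma> e (ereal t)) = ereal (of_int n * t + d)"
    by (auto simp: at_left_PInf eventually_filtermap)
  with assms have "\<forall>\<^sub>F t in at_top. of_int n * t + d = of_int m * t + c"
    by eventually_elim simp
  then have "real_of_int n = of_int m"
    by (rule affine_slope_unique) (auto intro: eventually_mono[OF eventually_gt_at_top])
  then show "n = m" by simp
qed

text \<open>Where the order vanishes, \<open>f\<close> and \<open>- f\<close> are both convex, so
  the supporting line at the midpoint bounds \<open>f\<close> from both sides.\<close>

lemma (in metric_network) affine_between_kinks: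
  assumes f: "rat f" and e: "e \<in> A" and ab: "0 \<le> a" "a < b" "b \<le> L e"
    and o: "\<And>x. a < x \<Longrightarrow> x < b \<Longrightarrow> ord f (Inner e x) = 0"
  shows "\<exists>(m::int) c. \<forall>t. a < t \<longrightarrow> t < b \<longrightarrow> f (ep e t) = of_int m * t + c"
proof -
  define x where "x = (a + b) / 2"
  have x: "a < x" "x < b" using ab by (auto simp: x_def)
  have xe: "valid e x 1" "valid e x (-1)" using x ab e by (auto simp: valid_def)
  let ?m = "slope f (e, x, 1)"
  have o': "ord f (ep e y) = 0" if "a < y" "y < b" for y using o that ab by (simp add: ep_Inner)
  have m': "slope f (e, x, -1) = - ?m"
    using o[OF x] x ab e by (simp add: ord_def sum_dirs_Inner)
  have neg: "slope (\<lambda>p. - f p) (e, x, \<sigma>) = - slope f (e, x, \<sigma>)" if "valid e x \<sigma>" for \<sigma>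
    using slope_cmult[OF f, of "(e, x, \<sigma>)" "ep e x" "-1"] that by (simp add: dirs_def)
  have "f (ep e t) = f (ep e x) + real_of_int ?m * (t - x)" if t: "a < t" "t < b" for t
  proof (cases "x \<le> t")
    case True
    have "f (ep e x) + real_of_int ?m * (t - x) \<le> f (ep e t)"
      by (rule supporting_line_fwd[OF f e]) (use True t ab x o' in auto)
    moreover have "- f (ep e x) + real_of_int (slope (\<lambda>p. - f p) (e, x, 1)) * (t - x) \<le> - f (ep e t)"
      by (rule supporting_line_fwd[OF rat_uminus[OF f] e]) (use True t ab x o' in \<open>auto simp: ord_uminus[OF f]\<close>)
    ultimately show ?thesis by (simp add: neg xe)
  next
    case False
    have "f (ep e x) + real_of_int (slope f (e, x, -1)) * (x - t) \<le> f (ep e t)"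
      by (rule supporting_line_bwd[OF f e]) (use False t ab x o' in auto)
    moreover have "- f (ep e x) + real_of_int (slope (\<lambda>p. - f p) (e, x, -1)) * (x - t) \<le> - f (ep e t)"
      by (rule supporting_line_bwd[OF rat_uminus[OF f] e]) (use False t ab x o' in \<open>auto simp: ord_uminus[OF f]\<close>)
    ultimately show ?thesis by (simp add: neg xe m' algebra_simps)
  qed
  then have "\<forall>t. a < t \<longrightarrow> t < b \<longrightarrow> f (ep e t) = of_int ?m * t + (f (ep e x) - of_int ?m * x)"
    by (simp add: algebra_simps)
  then show ?thesis by blast
qed

section \<open>Extending functions from the core to the curve\<close>

context tropical
begin

text \<open>The convention \<open>0 * \<infinity> = 0\<close> keeps a leg with
  \<open>k e = 0\<close> constant up to its end; with \<open>s e = \<infinity>\<close> and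
  \<open>k e > 0\<close> the value at the end is \<open>-\<infinity>\<close>.\<close>

definition leg_value :: "(('v, 'e) point \<Rightarrow> real) \<Rightarrow> ('e \<Rightarrow> int) \<Rightarrow> ('e \<Rightarrow> ereal) \<Rightarrow> 'e \<Rightarrow> ereal \<Rightarrow> ereal" where
  "leg_value f k s e t = ereal (f (Vertex (tail G e))) + ereal (- real_of_int (k e)) * min t (s e)"

text \<open>The extension of a function \<open>f\<close> on the core whose slope on the leg \<open>e\<close>
  is \<open>- k e\<close> up to the parameter \<open>s e\<close> and \<open>0\<close> beyond it.\<close>
definition extend :: "(('v, 'e) point \<Rightarrow> real) \<Rightarrow> ('e \<Rightarrow> int) \<Rightarrow> ('e \<Rightarrow> ereal) \<Rightarrow> ('v, 'e) point \<Rightarrow> ereal" where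
  "extend f k s x = (case x of
      Vertex v \<Rightarrow> if v \<in> head G ` legs then leg_value f k s (THE e. e \<in> legs \<and> head G e = v) \<infinity> else ereal (f x)
    | Inner e t \<Rightarrow> if e \<in> legs then leg_value f k s e (ereal t) else ereal (f x))"

lemma ext_core: "x \<in> N.pts \<Longrightarrow> extend f k s x = ereal (f x)"
proof (cases x)
  case (Vertex v)
  assume "x \<in> N.pts"
  then have "v \<in> core_verts" using Vertex by simp
  then have "v \<notin> head G ` legs" by (simp add: core_verts_def)
  then show ?thesis using Vertex by (simp add: extend_def)
next
  case (Inner e t)
  assume "x \<in> N.pts"
  then have "e \<notin> legs" using Inner arcs_split by auto
  then show ?thesis using Inner by (simp add: extend_def)
qed

lemma ext_leg_end: "e \<in> legs \<Longrightarrow> extend f k s (Vertex (head G e)) = leg_value f k s e \<infinity>"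
proof -
  assume e: "e \<in> legs"
  then have "(THE e'. e' \<in> legs \<and> head G e' = head G e) = e"
    using leg_head_inj[OF e] by (intro the_equality) (auto simp: legs_def)
  then show ?thesis using e by (auto simp: extend_def)
qed

lemma ext_leg: "e \<in> legs \<Longrightarrow> extend f k s (Inner e t) = leg_value f k s e (ereal t)"
  by (simp add: extend_def)

lemma tail_core_pt: "e \<in> arcs G \<Longrightarrow> Vertex (tail G e) \<in> N.pts"
  using tail_core by simp

lemma ext_edge_core:
  assumes "e \<in> core_arcs" "0 \<le> t" "t \<le> arc_length e"
  shows "extend f k s (edge_at e t) = ereal (f (N.ep e t))"
  using edge_point_core[OF assms(1)] ext_core[OF N.ep_in_pts[OF assms]] by simp

lemma ext_edge_leg:
  assumes e: "e \<in> legs" and s: "0 < s e" and t: "0 \<le> t"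
  shows "extend f k s (edge_point \<Gamma> e t) = leg_value f k s e t"
proof (cases t)
  case (real r)
  have "extend f k s (Vertex (tail G e)) = leg_value f k s e 0"
    using ext_core[OF tail_core_pt, of e f k s] e s by (simp add: leg_value_def legs_def)
  then show ?thesis using edge_point_leg(1)[OF e, of r] ext_leg[OF e] real by (simp add: zero_ereal_def)
next
  case PInf
  then show ?thesis using edge_point_leg(2)[OF e] ext_leg_end[OF e] by simp
next
  case MInf
  then show ?thesis using t by simp
qed

lemma leg_value_affine:
  shows "ereal t \<le> s e \<Longrightarrow> leg_value f k s e (ereal t) = ereal (of_int (- k e) * t + f (Vertex (tail G e)))"
    "s e = ereal r \<Longrightarrow> r \<le> t \<Longrightarrow>
      leg_value f k s e (ereal t) = ereal (of_int 0 * t + (f (Vertex (tail G e)) - of_int (k e) * r))"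
  by (simp_all add: leg_value_def min_def)

lemma ext_rational:
  assumes f: "N.rat f" and s: "\<And>e. 0 < s e"
  shows "rational_function \<Gamma> (extend f k s)"
  unfolding rational_function_def
proof (intro conjI ballI)
  fix x assume x: "x \<in> points \<Gamma> - points_at_infinity \<Gamma>"
  then have "x \<in> points \<Gamma>" by simp
  then show "\<bar>extend f k s x\<bar> \<noteq> \<infinity>"
  proof (cases rule: points_cases)
    case 1 then show ?thesis by (simp add: ext_core)
  next
    case (2 e t)
    have "\<bar>leg_value f k s e (ereal t)\<bar> \<noteq> \<infinity>"
      using s[of e] by (cases "s e") (auto simp: leg_value_def min_def)
    then show ?thesis using 2 by (simp add: ext_leg)
  next
    case (3 e) then show ?thesis using x by (auto simp: points_at_infinity_eq)
  qed
next
  fix e assume e: "e \<in> arcs G"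
  show "continuous_on {0..len \<Gamma> e} (\<lambda>t. extend f k s (edge_point \<Gamma> e t))"
  proof (cases "e \<in> legs")
    case True
    have "continuous_on {0..len \<Gamma> e} (leg_value f k s e)" unfolding continuous_on_def leg_value_def
      by (intro ballI tendsto_add_ereal_general2 tendsto_cmult_ereal tendsto_min tendsto_const tendsto_ident_at) auto
    then show ?thesis using ext_edge_leg[OF True s] by (subst continuous_on_cong[OF refl, of _ _ "leg_value f k s e"]) auto
  next
    case False
    then have ec: "e \<in> core_arcs" using e arcs_split by auto
    have sub: "real_of_ereal ` {0..ereal (arc_length e)} \<subseteq> {0..arc_length e}"
    proof
      fix y assume "y \<in> real_of_ereal ` {0..ereal (arc_length e)}"
      then obtain u where "0 \<le> u" "u \<le> ereal (arc_length e)" "y = real_of_ereal u" by auto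
      then show "y \<in> {0..arc_length e}" by (cases u) auto
    qed
    have "continuous_on {0..ereal (arc_length e)} (\<lambda>t. ereal (f (N.ep e (real_of_ereal t))))"
    proof (intro continuous_on_ereal continuous_on_compose2[OF N.rat_continuous[OF f ec] _ sub])
      show "continuous_on {0..ereal (arc_length e)} real_of_ereal"
        by (rule continuous_on_subset[OF continuous_on_real]) auto
    qed
    then show ?thesis unfolding len_core[OF ec]
    proof (rule continuous_on_eq)
      show "ereal (f (N.ep e (real_of_ereal t))) = extend f k s (edge_point \<Gamma> e t)" if "t \<in> {0..ereal (arc_length e)}" for t
        using ext_edge_core[OF ec, of "real_of_ereal t"] that by (cases t) auto
    qed
  qed
  show "\<exists>B. finite B \<and> (\<forall>a b. 0 \<le> a \<longrightarrow> a < b \<longrightarrow> b \<le> len \<Gamma> e \<longrightarrow> {a<..<b} \<inter> B = {} \<longrightarrow>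
      (\<exists>(m::int) (c::real). \<forall>t::real. a < ereal t \<longrightarrow> ereal t < b \<longrightarrow>
         extend f k s (edge_at e t) = ereal (of_int m * t + c)))"
  proof (cases "e \<in> legs")
    case True
    show ?thesis
    proof (intro exI[of _ "{s e}"] conjI allI impI)
      fix a b assume ab: "0 \<le> a" "a < b" "b \<le> len \<Gamma> e" "{a<..<b} \<inter> {s e} = {}"
      have ext: "extend f k s (edge_at e t) = leg_value f k s e (ereal t)" if "a < ereal t" for t
        by (rule ext_edge_leg[OF True s]) (rule order_trans[OF ab(1) less_imp_le[OF that]])
      have "s e \<le> a \<or> b \<le> s e" using ab by (auto simp: not_less)
      then show "\<exists>(m::int) (c::real). \<forall>t::real. a < ereal t \<longrightarrow> ereal t < b \<longrightarrow>
         extend f k s (edge_at e t) = ereal (of_int m * t + c)"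
      proof
        assume "b \<le> s e"
        then show ?thesis using ext leg_value_affine(1)[of _ s e]
          by (intro exI[of _ "- k e"] exI[of _ "f (Vertex (tail G e))"]) (auto simp del: of_int_minus)
      next
        assume le: "s e \<le> a"
        then obtain r where r: "s e = ereal r" using ab s[of e] by (cases "s e"; cases a) auto
        have "r \<le> t" if "a < ereal t" for t using le that r by (metis ereal_less_eq(3) less_imp_le order_trans)
        then show ?thesis using ext leg_value_affine(2)[of s e, OF r]
          by (intro exI[of _ 0] exI[of _ "f (Vertex (tail G e)) - of_int (k e) * r"]) auto
      qed
    qed simp
  next
    case False
    then have ec: "e \<in> core_arcs" using e arcs_split by auto
    \<comment> \<open>The germwise notion \<open>rat\<close> provides no list of breakpoints; the
      finite support of \<open>ord f\<close> does.\<close>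
    define J where "J = {t. N.ord f (Inner e t) \<noteq> 0}"
    have "inj (Inner e :: real \<Rightarrow> ('v, 'e) point)" by (simp add: inj_def)
    then have "finite (Inner e -` {p. N.ord f p \<noteq> 0})" by (intro finite_vimageI N.finite_ord f)
    then have "finite J" by (simp add: J_def vimage_def)
    show ?thesis
    proof (intro exI[of _ "ereal ` J"] conjI allI impI)
      fix a b assume ab: "0 \<le> a" "a < b" "b \<le> len \<Gamma> e" "{a<..<b} \<inter> ereal ` J = {}"
      obtain a' b' where r: "a = ereal a'" "b = ereal b'"
        using ab len_core[OF ec] by (cases a; cases b) auto
      have ab': "0 \<le> a'" "a' < b'" "b' \<le> arc_length e" using ab r len_core[OF ec] by auto
      have "N.ord f (Inner e x) = 0" if "a' < x" "x < b'" for x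
      proof -
        have "ereal x \<in> {a<..<b}" using that r by simp
        then have "x \<notin> J" using ab(4) by blast
        then show ?thesis by (simp add: J_def)
      qed
      from N.affine_between_kinks[OF f ec ab' this] obtain m :: int and c
        where "\<And>t. a' < t \<Longrightarrow> t < b' \<Longrightarrow> f (N.ep e t) = of_int m * t + c" by blast
      then show "\<exists>(m::int) (c::real). \<forall>t::real. a < ereal t \<longrightarrow> ereal t < b \<longrightarrow>
         extend f k s (edge_at e t) = ereal (of_int m * t + c)"
        using r ab' by (intro exI[of _ m] exI[of _ c]) (auto simp: ext_edge_core[OF ec])
    qed (use \<open>finite J\<close> in simp)
  qed
qed

lemma ext_slope_after_core:
  assumes f: "N.rat f" and e: "e \<in> core_arcs" and t: "0 \<le> t" "t < arc_length e"
  shows "slope_after \<Gamma> (extend f k s) e (ereal t) = N.slope f (e, t, 1)"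
proof (rule slope_after_eqI)
  have v: "N.valid e t 1" using e t by (simp add: N.valid_def)
  have "\<forall>\<^sub>F h in at_right (0::real). N.valid e (t + h) 1" using N.eventually_valid[OF v] by eventually_elim simp
  with N.edge_slopes_fwd[OF f e t]
  show "\<forall>\<^sub>F x in at_right t. extend f k s (edge_at e x)
      = ereal (of_int (N.slope f (e, t, 1)) * x + (f (N.ep e t) - of_int (N.slope f (e, t, 1)) * t))"
    unfolding eventually_at_right_shift[of _ t]
    by eventually_elim (auto simp: ext_edge_core[OF e] N.valid_def algebra_simps)
qed

lemma ext_slope_before_core:
  assumes f: "N.rat f" and e: "e \<in> core_arcs" and t: "0 < t" "t \<le> arc_length e"
  shows "slope_before \<Gamma> (extend f k s) e (ereal t) = - N.slope f (e, t, -1)"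
proof (rule slope_before_eqI)
  have v: "N.valid e t (-1)" using e t by (simp add: N.valid_def)
  have "\<forall>\<^sub>F h in at_right (0::real). N.valid e (t - h) (-1)" using N.eventually_valid[OF v] by eventually_elim simp
  with N.edge_slopes_bwd[OF f e t]
  show "\<forall>\<^sub>F x in at_left t. extend f k s (edge_at e x)
      = ereal (of_int (- N.slope f (e, t, -1)) * x + (f (N.ep e t) + of_int (N.slope f (e, t, -1)) * t))"
    unfolding eventually_at_left_shift[of _ t]
    by eventually_elim (auto simp: ext_edge_core[OF e] N.valid_def algebra_simps)
qed

lemma ext_slope_after_leg:
  assumes e: "e \<in> legs" and s: "0 < s e" and t: "0 \<le> t"
  shows "slope_after \<Gamma> (extend f k s) e (ereal t) = (if ereal t < s e then - k e else 0)"
proof (cases "ereal t < s e")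
  case True
  obtain b where b: "t < b" "ereal b \<le> s e"
    using True by (cases "s e") (auto intro: that[of "t + 1"])
  have "slope_after \<Gamma> (extend f k s) e (ereal t) = - k e"
  proof (rule slope_after_eqI)
    show "\<forall>\<^sub>F x in at_right t. extend f k s (edge_at e x) = ereal (of_int (- k e) * x + f (Vertex (tail G e)))"
      unfolding eventually_at_right_field
    proof (intro exI[of _ b] conjI allI impI)
      fix x assume x: "t < x" "x < b"
      then have "ereal x \<le> s e" using b by (metis ereal_less_eq(3) less_imp_le order_trans)
      then show "extend f k s (edge_at e x) = ereal (of_int (- k e) * x + f (Vertex (tail G e)))"
        using ext_edge_leg[of e s "ereal x" f k, OF e s] leg_value_affine(1) x t by simp
    qed (rule b)
  qed
  then show ?thesis using True by simp
next
  case False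
  then obtain r where r: "s e = ereal r" "r \<le> t" using s by (cases "s e") auto
  have "slope_after \<Gamma> (extend f k s) e (ereal t) = 0"
  proof (rule slope_after_eqI)
    show "\<forall>\<^sub>F x in at_right t. extend f k s (edge_at e x)
        = ereal (of_int 0 * x + (f (Vertex (tail G e)) - of_int (k e) * r))"
      unfolding eventually_at_right_field
      using ext_edge_leg[of e s _ f k, OF e s] leg_value_affine(2)[of s e r, OF r(1)] r(2) t
      by (intro exI[of _ "t + 1"]) auto
  qed
  then show ?thesis using False by simp
qed

lemma ext_slope_before_leg:
  assumes e: "e \<in> legs" and s: "0 < s e" and t: "0 < t"
  shows "slope_before \<Gamma> (extend f k s) e (ereal t) = (if ereal t \<le> s e then - k e else 0)"
proof (cases "ereal t \<le> s e")
  case True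
  have "slope_before \<Gamma> (extend f k s) e (ereal t) = - k e"
  proof (rule slope_before_eqI)
    show "\<forall>\<^sub>F x in at_left t. extend f k s (edge_at e x) = ereal (of_int (- k e) * x + f (Vertex (tail G e)))"
      unfolding eventually_at_left_field
    proof (intro exI[of _ 0] conjI allI impI)
      fix x assume x: "0 < x" "x < t"
      then have "ereal x \<le> s e" using True by (metis ereal_less_eq(3) less_imp_le order_trans)
      then show "extend f k s (edge_at e x) = ereal (of_int (- k e) * x + f (Vertex (tail G e)))"
        using ext_edge_leg[of e s "ereal x" f k, OF e s] leg_value_affine(1) x by simp
    qed (rule t)
  qed
  then show ?thesis using True by simp
next
  case False
  then obtain r where r: "s e = ereal r" "r < t" "0 < r" using s by (cases "s e") auto
  have "slope_before \<Gamma> (extend f k s) e (ereal t) = 0"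
  proof (rule slope_before_eqI)
    show "\<forall>\<^sub>F x in at_left t. extend f k s (edge_at e x)
        = ereal (of_int 0 * x + (f (Vertex (tail G e)) - of_int (k e) * r))"
      unfolding eventually_at_left_field
      using ext_edge_leg[of e s _ f k, OF e s] leg_value_affine(2)[of s e r, OF r(1)] r
      by (intro exI[of _ r]) auto
  qed
  then show ?thesis using False by simp
qed

lemma ext_slope_before_infinity:
  assumes e: "e \<in> legs" and s: "0 < s e"
  shows "slope_before \<Gamma> (extend f k s) e \<infinity> = (if s e = \<infinity> then - k e else 0)"
proof (cases "s e = \<infinity>")
  case True
  have "slope_before \<Gamma> (extend f k s) e \<infinity> = - k e"
  proof (rule slope_before_infinity_eqI)
    show "\<forall>\<^sub>F x in at_top. extend f k s (edge_at e x) = ereal (of_int (- k e) * x + f (Vertex (tail G e)))"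
      using eventually_gt_at_top[of 0]
      by eventually_elim (use ext_edge_leg[of e s _ f k, OF e s] leg_value_affine(1) True in simp)
  qed
  then show ?thesis using True by simp
next
  case False
  then obtain r where r: "s e = ereal r" "0 < r" using s by (cases "s e") auto
  have "slope_before \<Gamma> (extend f k s) e \<infinity> = 0"
  proof (rule slope_before_infinity_eqI)
    show "\<forall>\<^sub>F x in at_top. extend f k s (edge_at e x)
        = ereal (of_int 0 * x + (f (Vertex (tail G e)) - of_int (k e) * r))"
      using eventually_gt_at_top[of r]
      by eventually_elim (use ext_edge_leg[of e s _ f k, OF e s] leg_value_affine(2)[of s e r, OF r(1)] r in simp)
  qed
  then show ?thesis using False by simp
qed

lemma out_arcs_core: "out_arcs G v = {e \<in> core_arcs. tail G e = v} \<union> {e \<in> legs. Vertex (tail G e) = (Vertex v :: ('v, 'e) point)}"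
  using arcs_split by (auto simp: out_arcs_def)

lemma in_arcs_core: "v \<in> core_verts \<Longrightarrow> in_arcs G v = {e \<in> core_arcs. head G e = v}"
  using arcs_split by (auto simp: in_arcs_def core_verts_def)

lemma sum_out_arcs:
  "(\<Sum>e\<in>out_arcs G v. h e) = (\<Sum>e | e \<in> core_arcs \<and> tail G e = v. h e)
     + (\<Sum>e | e \<in> legs \<and> Vertex (tail G e) = (Vertex v :: ('v, 'e) point). h e)"
  unfolding out_arcs_core using arcs_split
  by (intro sum.union_disjoint) (auto simp: core_arcs_def legs_def)

lemma ext_ord_core:
  assumes f: "N.rat f" and s: "\<And>e. 0 < s e" and x: "x \<in> N.pts"
  shows "ord_at \<Gamma> (extend f k s) x = N.ord f x - (\<Sum>e | e \<in> legs \<and> Vertex (tail G e) = x. k e)"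
proof (cases x)
  case (Vertex v)
  then have v: "v \<in> core_verts" using x by simp
  have z: "slope_after \<Gamma> (extend f k s) e 0 = N.slope f (e, 0, 1)" if "e \<in> core_arcs" for e
    using ext_slope_after_core[OF f that, of 0] N.L_pos[OF that] by (simp add: zero_ereal_def)
  have l: "slope_before \<Gamma> (extend f k s) e (len \<Gamma> e) = - N.slope f (e, arc_length e, -1)" if "e \<in> core_arcs" for e
    using ext_slope_before_core[OF f that, of "arc_length e"] N.L_pos[OF that] len_core[OF that] by simp
  have g: "slope_after \<Gamma> (extend f k s) e 0 = - k e" if "e \<in> legs" for e
    using ext_slope_after_leg[of e s 0 f k] that s[of e] by (simp add: zero_ereal_def)
  show ?thesis using z l g
    by (simp add: ord_at_def Vertex sum_out_arcs in_arcs_core[OF v] N.ord_def N.sum_dirs_Vertex sum_negf)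
next
  case (Inner e t)
  then have e: "e \<in> core_arcs" "0 < t" "t < arc_length e" using x by auto
  then show ?thesis using ext_slope_after_core[OF f e(1), of t] ext_slope_before_core[OF f e(1), of t]
    by (simp add: ord_at_def Inner N.ord_def N.sum_dirs_Inner)
qed

text \<open>The slope changes from \<open>- k e\<close> to 0 at \<open>s e\<close>: the
  \<open>k e\<close> chips that \<open>ext_ord_core\<close> takes from the base of the leg reappear
  at that point, possibly at infinity.\<close>

lemma ext_ord_leg:
  assumes e: "e \<in> legs" and s: "0 < s e"
  shows "0 < t \<Longrightarrow> ord_at \<Gamma> (extend f k s) (Inner e t) = (if ereal t = s e then k e else 0)"
    "ord_at \<Gamma> (extend f k s) (Vertex (head G e)) = (if s e = \<infinity> then k e else 0)"
  using ext_slope_after_leg[of e s t f k, OF e s] ext_slope_before_leg[of e s t f k, OF e s]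
    ext_slope_before_infinity[of e s f k, OF e s] leg_head[OF e] len_leg[OF e]
  by (auto simp: ord_at_def)

lemma ext_in_RR:
  assumes f: "N.rat f" and s: "\<And>e. 0 < s e"
    and core: "\<And>x. x \<in> N.pts \<Longrightarrow> 0 \<le> D x + N.ord f x - (\<Sum>e | e \<in> legs \<and> Vertex (tail G e) = x. k e)"
    and leg: "\<And>e t. e \<in> legs \<Longrightarrow> 0 < t \<Longrightarrow> 0 \<le> D (Inner e t) + (if ereal t = s e then k e else 0)"
    and leg_end: "\<And>e. e \<in> legs \<Longrightarrow> 0 \<le> D (Vertex (head G e)) + (if s e = \<infinity> then k e else 0)"
    and out: "\<And>x. x \<notin> points \<Gamma> \<Longrightarrow> 0 \<le> D x"
  shows "extend f k s \<in> RR \<Gamma> D"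
  unfolding RR_def effective_def
proof (intro CollectI conjI allI)
  show "rational_function \<Gamma> (extend f k s)" by (rule ext_rational[OF f s])
  fix x
  show "0 \<le> D x + principal_divisor \<Gamma> (extend f k s) x"
  proof (cases "x \<in> points \<Gamma>")
    case True
    then show ?thesis
    proof (cases rule: points_cases)
      case 1 then show ?thesis using core[OF 1] True by (simp add: principal_divisor_def ext_ord_core[OF f s])
    next
      case (2 e t) then show ?thesis using leg[of e t] True ext_ord_leg(1)[of e s t f k] s[of e]
        by (simp add: principal_divisor_def)
    next
      case (3 e) then show ?thesis using leg_end[of e] True ext_ord_leg(2)[of e s f k] s[of e]
        by (simp add: principal_divisor_def)
    qed
  qed (use out in \<open>simp add: principal_divisor_def\<close>)
qed

end

section \<open>Restricting rational functions to the core\<close>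

context tropical
begin

lemma rational_function_pieces:
  assumes "rational_function \<Gamma> g" "e \<in> arcs G"
  obtains B where "finite B" "\<And>a b. 0 \<le> a \<Longrightarrow> a < b \<Longrightarrow> b \<le> len \<Gamma> e \<Longrightarrow> {a<..<b} \<inter> B = {} \<Longrightarrow>
    \<exists>(m::int) (c::real). \<forall>t::real. a < ereal t \<longrightarrow> ereal t < b \<longrightarrow> g (edge_at e t) = ereal (of_int m * t + c)"
  using assms unfolding rational_function_def by metis

lemma rational_function_near:
  assumes g: "rational_function \<Gamma> g" and e: "e \<in> arcs G"
  obtains d where "0 < d" "\<And>a b. 0 \<le> a \<Longrightarrow> a < b \<Longrightarrow> ereal b \<le> len \<Gamma> e \<Longrightarrow> t - d \<le> a \<Longrightarrow> b \<le> t + d \<Longrightarrow>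
    t \<le> a \<or> b \<le> t \<Longrightarrow> \<exists>(m::int) (c::real). \<forall>u. a < u \<longrightarrow> u < b \<longrightarrow> g (edge_at e u) = ereal (of_int m * u + c)"
proof -
  obtain B where B: "finite B" "\<And>a b. 0 \<le> a \<Longrightarrow> a < b \<Longrightarrow> b \<le> len \<Gamma> e \<Longrightarrow> {a<..<b} \<inter> B = {} \<Longrightarrow>
    \<exists>(m::int) (c::real). \<forall>t::real. a < ereal t \<longrightarrow> ereal t < b \<longrightarrow> g (edge_at e t) = ereal (of_int m * t + c)"
    using rational_function_pieces[OF g e] by metis
  \<comment> \<open>Infinite breakpoints are sent to 0, which can only make the distance
    \<open>d\<close> smaller.\<close>
  have "finite (real_of_ereal ` B)" using B(1) by simp
  from finite_set_avoid[OF this, of t] obtain d where d: "d > 0" "\<forall>x\<in>real_of_ereal ` B. x \<noteq> t \<longrightarrow> d \<le> dist t x" by blast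
  show ?thesis
  proof (rule that[OF d(1)])
    fix a b assume ab: "0 \<le> a" "a < b" "ereal b \<le> len \<Gamma> e" "t - d \<le> a" "b \<le> t + d" "t \<le> a \<or> b \<le> t"
    have "u \<notin> B" if u: "ereal a < u" "u < ereal b" for u
    proof
      assume "u \<in> B"
      then have "real_of_ereal u \<noteq> t \<longrightarrow> d \<le> dist t (real_of_ereal u)" using d(2) by blast
      then show False using u ab by (cases u) (auto simp: dist_real_def)
    qed
    then have "{ereal a<..<ereal b} \<inter> B = {}" by auto
    then show "\<exists>(m::int) (c::real). \<forall>u. a < u \<longrightarrow> u < b \<longrightarrow> g (edge_at e u) = ereal (of_int m * u + c)"
      using B(2)[of "ereal a" "ereal b"] ab by simp
  qed
qed

lemma rational_function_tendsto:
  assumes g: "rational_function \<Gamma> g" and e: "e \<in> arcs G" and t: "0 \<le> t" "ereal t \<le> len \<Gamma> e"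
  shows "((\<lambda>u. g (edge_at e u)) \<longlongrightarrow> g (edge_at e t)) (at t within {u. 0 \<le> u \<and> ereal u \<le> len \<Gamma> e})"
proof -
  have "continuous_on {0..len \<Gamma> e} (\<lambda>s. g (edge_point \<Gamma> e s))"
    using g e unfolding rational_function_def by blast
  moreover have "continuous_on {u. 0 \<le> u \<and> ereal u \<le> len \<Gamma> e} ereal" by (intro continuous_on_ereal continuous_on_id)
  ultimately have "continuous_on {u. 0 \<le> u \<and> ereal u \<le> len \<Gamma> e} (\<lambda>u. g (edge_at e u))"
    by (rule continuous_on_compose2) auto
  then show ?thesis using t by (simp add: continuous_on_def)
qed

text \<open>The definition controls only open subintervals; continuity at \<open>t\<close>
  identifies the constant, so the formula includes \<open>h = 0\<close>.\<close>

lemma rational_function_right: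
  assumes g: "rational_function \<Gamma> g" and e: "e \<in> arcs G" and t: "0 \<le> t" "ereal t < len \<Gamma> e"
  obtains r and m :: int where "0 < r" "\<And>h. 0 \<le> h \<Longrightarrow> h < r \<Longrightarrow>
    g (edge_at e (t + h)) = ereal (real_of_ereal (g (edge_at e t)) + of_int m * h)"
proof -
  obtain d where d: "0 < d" "\<And>a b. 0 \<le> a \<Longrightarrow> a < b \<Longrightarrow> ereal b \<le> len \<Gamma> e \<Longrightarrow> t - d \<le> a \<Longrightarrow> b \<le> t + d \<Longrightarrow>
    t \<le> a \<or> b \<le> t \<Longrightarrow> \<exists>(m::int) (c::real). \<forall>u. a < u \<longrightarrow> u < b \<longrightarrow> g (edge_at e u) = ereal (of_int m * u + c)"
    using rational_function_near[OF g e, of t] by blast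
  obtain b where b: "t < b" "ereal b \<le> len \<Gamma> e" "b \<le> t + d"
  proof (cases "len \<Gamma> e")
    case (real l)
    then show ?thesis using t d(1) by (intro that[of "min l (t + d)"]) (auto simp: min_def)
  qed (use t d(1) that[of "t + d"] in auto)
  obtain m :: int and c where mc: "\<And>u. t < u \<Longrightarrow> u < b \<Longrightarrow> g (edge_at e u) = ereal (of_int m * u + c)"
    using d(2)[of t b] d(1) t b by auto
  have "((\<lambda>u. g (edge_at e u)) \<longlongrightarrow> g (edge_at e t)) (at t within {t..b})"
  proof (rule tendsto_within_subset[OF rational_function_tendsto[OF g e]])
    show "{t..b} \<subseteq> {u. 0 \<le> u \<and> ereal u \<le> len \<Gamma> e}" using t b by (auto intro: order_trans[of _ "ereal b"])
  qed (use t in auto)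
  then have 1: "((\<lambda>u. g (edge_at e u)) \<longlongrightarrow> g (edge_at e t)) (at_right t)"
    using b by (simp add: at_within_Icc_at_right)
  have "((\<lambda>u. ereal (of_int m * u + c)) \<longlongrightarrow> ereal (of_int m * t + c)) (at_right t)" by (intro tendsto_intros)
  moreover have "\<forall>\<^sub>F u in at_right t. ereal (of_int m * u + c) = g (edge_at e u)"
    unfolding eventually_at_right_field using mc b by (intro exI[of _ b]) auto
  ultimately have 2: "((\<lambda>u. g (edge_at e u)) \<longlongrightarrow> ereal (of_int m * t + c)) (at_right t)"
    by (rule Lim_transform_eventually)
  have gt: "g (edge_at e t) = ereal (of_int m * t + c)" by (rule tendsto_unique[OF _ 1 2]) simp
  show ?thesis
  proof (rule that[of "b - t" m])
    show "g (edge_at e (t + h)) = ereal (real_of_ereal (g (edge_at e t)) + of_int m * h)"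
      if "0 \<le> h" "h < b - t" for h
      using that gt mc[of "t + h"] by (cases "h = 0") (auto simp: algebra_simps)
  qed (use b in auto)
qed

lemma rational_function_left:
  assumes g: "rational_function \<Gamma> g" and e: "e \<in> arcs G" and t: "0 < t" "ereal t \<le> len \<Gamma> e"
  obtains r and m :: int where "0 < r" "\<And>h. 0 \<le> h \<Longrightarrow> h < r \<Longrightarrow>
    g (edge_at e (t - h)) = ereal (real_of_ereal (g (edge_at e t)) - of_int m * h)"
proof -
  obtain d where d: "0 < d" "\<And>a b. 0 \<le> a \<Longrightarrow> a < b \<Longrightarrow> ereal b \<le> len \<Gamma> e \<Longrightarrow> t - d \<le> a \<Longrightarrow> b \<le> t + d \<Longrightarrow>
    t \<le> a \<or> b \<le> t \<Longrightarrow> \<exists>(m::int) (c::real). \<forall>u. a < u \<longrightarrow> u < b \<longrightarrow> g (edge_at e u) = ereal (of_int m * u + c)"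
    using rational_function_near[OF g e, of t] by blast
  define b where "b = max 0 (t - d)"
  have b: "b < t" "0 \<le> b" "t - d \<le> b" using t d(1) by (auto simp: b_def)
  obtain m :: int and c where mc: "\<And>u. b < u \<Longrightarrow> u < t \<Longrightarrow> g (edge_at e u) = ereal (of_int m * u + c)"
    using d(2)[of b t] d(1) t b by auto
  have "((\<lambda>u. g (edge_at e u)) \<longlongrightarrow> g (edge_at e t)) (at t within {b..t})"
  proof (rule tendsto_within_subset[OF rational_function_tendsto[OF g e]])
    show "{b..t} \<subseteq> {u. 0 \<le> u \<and> ereal u \<le> len \<Gamma> e}" using t b by (auto intro: order_trans[of _ "ereal t"])
  qed (use t in auto)
  then have 1: "((\<lambda>u. g (edge_at e u)) \<longlongrightarrow> g (edge_at e t)) (at_left t)"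
    using b by (simp add: at_within_Icc_at_left)
  have "((\<lambda>u. ereal (of_int m * u + c)) \<longlongrightarrow> ereal (of_int m * t + c)) (at_left t)" by (intro tendsto_intros)
  moreover have "\<forall>\<^sub>F u in at_left t. ereal (of_int m * u + c) = g (edge_at e u)"
    unfolding eventually_at_left_field using mc b by (intro exI[of _ b]) auto
  ultimately have 2: "((\<lambda>u. g (edge_at e u)) \<longlongrightarrow> ereal (of_int m * t + c)) (at_left t)"
    by (rule Lim_transform_eventually)
  have gt: "g (edge_at e t) = ereal (of_int m * t + c)" by (rule tendsto_unique[OF _ 1 2]) simp
  show ?thesis
  proof (rule that[of "t - b" m])
    show "g (edge_at e (t - h)) = ereal (real_of_ereal (g (edge_at e t)) - of_int m * h)"
      if "0 \<le> h" "h < t - b" for h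
      using that gt mc[of "t - h"] by (cases "h = 0") (auto simp: algebra_simps)
  qed (use b in auto)
qed

text \<open>The same form as \<open>edge_slopes_fwd\<close>, so that the convexity lemma applies to
  arbitrary rational functions on legs.\<close>

lemma slope_after_local:
  assumes g: "rational_function \<Gamma> g" and e: "e \<in> arcs G" and t: "0 \<le> t" "ereal t < len \<Gamma> e"
  shows "\<forall>\<^sub>F h in at_right 0. real_of_ereal (g (edge_at e (t + h)))
      = real_of_ereal (g (edge_at e t)) + real_of_int (slope_after \<Gamma> g e (ereal t)) * h
    \<and> slope_after \<Gamma> g e (ereal (t + h)) = slope_after \<Gamma> g e (ereal t)
    \<and> slope_before \<Gamma> g e (ereal (t + h)) = slope_after \<Gamma> g e (ereal t)"
proof -
  define y where "y = real_of_ereal (g (edge_at e t))"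
  obtain r and m :: int where r: "0 < r" "\<And>h. 0 \<le> h \<Longrightarrow> h < r \<Longrightarrow> g (edge_at e (t + h)) = ereal (y + of_int m * h)"
    using rational_function_right[OF g e t] unfolding y_def by metis
  have val: "g (edge_at e u) = ereal (of_int m * u + (y - of_int m * t))" if "t \<le> u" "u < t + r" for u
    using r(2)[of "u - t"] that by (simp add: algebra_simps)
  have a: "slope_after \<Gamma> g e (ereal u) = m" if "t \<le> u" "u < t + r" for u
    by (rule slope_after_eqI[where c = "y - of_int m * t"], unfold eventually_at_right_field)
      (use that val in \<open>auto intro!: exI[of _ "t + r"]\<close>)
  have b: "slope_before \<Gamma> g e (ereal u) = m" if "t < u" "u < t + r" for u
    by (rule slope_before_eqI[where c = "y - of_int m * t"], unfold eventually_at_left_field)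
      (use that val in \<open>auto intro!: exI[of _ t]\<close>)
  show ?thesis unfolding eventually_at_right_field y_def[symmetric]
    using r a b by (intro exI[of _ r]) auto
qed

lemma slope_before_local:
  assumes g: "rational_function \<Gamma> g" and e: "e \<in> arcs G" and t: "0 < t" "ereal t \<le> len \<Gamma> e"
  shows "\<forall>\<^sub>F h in at_right 0. real_of_ereal (g (edge_at e (t - h)))
      = real_of_ereal (g (edge_at e t)) - real_of_int (slope_before \<Gamma> g e (ereal t)) * h
    \<and> slope_before \<Gamma> g e (ereal (t - h)) = slope_before \<Gamma> g e (ereal t)
    \<and> slope_after \<Gamma> g e (ereal (t - h)) = slope_before \<Gamma> g e (ereal t)"
proof -
  define y where "y = real_of_ereal (g (edge_at e t))"
  obtain r and m :: int where r: "0 < r" "\<And>h. 0 \<le> h \<Longrightarrow> h < r \<Longrightarrow> g (edge_at e (t - h)) = ereal (y - of_int m * h)"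
    using rational_function_left[OF g e t] unfolding y_def by metis
  have val: "g (edge_at e u) = ereal (of_int m * u + (y - of_int m * t))" if "u \<le> t" "t - r < u" for u
    using r(2)[of "t - u"] that by (simp add: algebra_simps)
  have b: "slope_before \<Gamma> g e (ereal u) = m" if "u \<le> t" "t - r < u" for u
    by (rule slope_before_eqI[where c = "y - of_int m * t"], unfold eventually_at_left_field)
      (use that val in \<open>auto intro!: exI[of _ "t - r"]\<close>)
  have a: "slope_after \<Gamma> g e (ereal u) = m" if "u < t" "t - r < u" for u
    by (rule slope_after_eqI[where c = "y - of_int m * t"], unfold eventually_at_right_field)
      (use that val in \<open>auto intro!: exI[of _ t]\<close>)
  show ?thesis unfolding eventually_at_right_field y_def[symmetric]
    using r a b by (intro exI[of _ r]) auto
qed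

text \<open>Beyond the last breakpoint the slope is constant. The slope at the infinite end
  therefore already occurs at a finite parameter, which reduces a leg to a compact interval.\<close>

lemma slope_before_infinity:
  assumes g: "rational_function \<Gamma> g" and e: "e \<in> legs"
  obtains T where "0 < T" "slope_before \<Gamma> g e (ereal T) = slope_before \<Gamma> g e \<infinity>"
proof -
  have a: "e \<in> arcs G" using e by (simp add: legs_def)
  obtain B where B: "finite B" "\<And>a b. 0 \<le> a \<Longrightarrow> a < b \<Longrightarrow> b \<le> len \<Gamma> e \<Longrightarrow> {a<..<b} \<inter> B = {} \<Longrightarrow>
    \<exists>(m::int) (c::real). \<forall>t::real. a < ereal t \<longrightarrow> ereal t < b \<longrightarrow> g (edge_at e t) = ereal (of_int m * t + c)"
    using rational_function_pieces[OF g a] by metis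
  define T where "T = Max (insert 0 (real_of_ereal ` B))"
  have T: "u \<le> T" if "ereal u \<in> B" for u
    unfolding T_def using B(1) that by (intro Max_ge) (auto simp: image_iff intro!: bexI[of _ "ereal u"])
  have T0: "0 \<le> T" unfolding T_def using B(1) by (intro Max_ge) auto
  have "{ereal T<..<\<infinity>} \<inter> B = {}"
  proof -
    have "u \<notin> B" if "ereal T < u" "u < \<infinity>" for u using that T[of "real_of_ereal u"] by (cases u) auto
    then show ?thesis by auto
  qed
  then obtain m :: int and c where mc: "\<And>u. T < u \<Longrightarrow> g (edge_at e u) = ereal (of_int m * u + c)"
    using B(2)[of "ereal T" \<infinity>] T0 len_leg[OF e] by auto
  have "slope_before \<Gamma> g e \<infinity> = m"
  proof (rule slope_before_infinity_eqI)
    show "\<forall>\<^sub>F u in at_top. g (edge_at e u) = ereal (of_int m * u + c)"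
      using eventually_gt_at_top[of T] by eventually_elim (rule mc)
  qed
  moreover have "slope_before \<Gamma> g e (ereal (T + 1)) = m"
    by (rule slope_before_eqI[where c = c], unfold eventually_at_left_field) (use mc in \<open>auto intro!: exI[of _ T]\<close>)
  ultimately show ?thesis using that[of "T + 1"] T0 by simp
qed

text \<open>The function is convex along the leg, and the order at the end is minus its final slope,
  which is therefore nonpositive; so the initial slope is nonpositive too.\<close>

lemma leg_slope_nonpos:
  assumes g: "rational_function \<Gamma> g" and e: "e \<in> legs"
    and inner: "\<And>t. 0 < t \<Longrightarrow> 0 \<le> ord_at \<Gamma> g (Inner e t)" and last: "0 \<le> ord_at \<Gamma> g (Vertex (head G e))"
  shows "slope_after \<Gamma> g e 0 \<le> 0"
proof -
  have a: "e \<in> arcs G" using e by (simp add: legs_def)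
  obtain T where T: "0 < T" "slope_before \<Gamma> g e (ereal T) = slope_before \<Gamma> g e \<infinity>"
    using slope_before_infinity[OF g e] .
  have "slope_after \<Gamma> g e (ereal 0) \<le> - (- slope_before \<Gamma> g e (ereal T)) \<and>
      real_of_ereal (g (edge_at e T)) \<ge> real_of_ereal (g (edge_at e 0)) + real_of_int (slope_after \<Gamma> g e (ereal 0)) * (T - 0)"
  proof (rule convex_supporting_line[where G = "\<lambda>t. real_of_ereal (g (edge_at e t))"
        and R = "\<lambda>t. slope_after \<Gamma> g e (ereal t)" and B = "\<lambda>t. - slope_before \<Gamma> g e (ereal t)"])
    show "0 \<le> slope_after \<Gamma> g e (ereal t) + - slope_before \<Gamma> g e (ereal t)" if "0 < t" "t < T" for t
      using inner[OF that(1)] by (simp add: ord_at_def)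
  qed (use slope_after_local[OF g a] slope_before_local[OF g a] len_leg[OF e] T in auto)
  moreover have "slope_before \<Gamma> g e \<infinity> \<le> 0"
    using last leg_head[OF e] len_leg[OF e] by (simp add: ord_at_def)
  ultimately show ?thesis using T(2) by (simp add: zero_ereal_def)
qed

text \<open>Where \<open>D\<close> has no positive coefficients on legs, all slopes into legs are
  nonpositive. Deleting the legs removes nonpositive summands from the orders at core vertices, and
  the restricted function still makes \<open>D\<close> effective.\<close>

lemma RR_restrict:
  assumes g: "g \<in> RR \<Gamma> D"
    and leg: "\<And>e t. e \<in> legs \<Longrightarrow> 0 < t \<Longrightarrow> D (Inner e t) \<le> 0" "\<And>e. e \<in> legs \<Longrightarrow> D (Vertex (head G e)) \<le> 0"
  shows "N.eq_eff D"
proof -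
  have rg: "rational_function \<Gamma> g" and eff: "\<And>x. x \<in> points \<Gamma> \<Longrightarrow> 0 \<le> D x + ord_at \<Gamma> g x"
  proof -
    show "rational_function \<Gamma> g" using g by (simp add: RR_def)
    show "0 \<le> D x + ord_at \<Gamma> g x" if "x \<in> points \<Gamma>" for x
      using g that unfolding RR_def effective_def principal_divisor_def by (auto dest: spec[of _ x])
  qed
  define f where "f x = real_of_ereal (g x)" for x
  have fwd: "N.has_slope f (e, t, 1) (slope_after \<Gamma> g e (ereal t))" if "e \<in> core_arcs" "0 \<le> t" "t < arc_length e" for e t
  proof -
    have "\<forall>\<^sub>F h in at_right (0::real). f (N.ep e (t + h)) = f (N.ep e t) + real_of_int (slope_after \<Gamma> g e (ereal t)) * h"
      using slope_after_local[OF rg, of e t] that len_core[OF that(1)]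
      by (auto simp: core_arcs_def edge_point_core[OF that(1)] f_def elim: eventually_mono)
    then show ?thesis by (simp add: N.has_slope_def)
  qed
  have bwd: "N.has_slope f (e, t, -1) (real_of_int (- slope_before \<Gamma> g e (ereal t)))" if "e \<in> core_arcs" "0 < t" "t \<le> arc_length e" for e t
  proof -
    have "\<forall>\<^sub>F h in at_right (0::real). f (N.ep e (t - h)) = f (N.ep e t) + real_of_int (- slope_before \<Gamma> g e (ereal t)) * h"
      using slope_before_local[OF rg, of e t] that len_core[OF that(1)]
      by (auto simp: core_arcs_def edge_point_core[OF that(1)] f_def elim: eventually_mono)
    then show ?thesis by (simp add: N.has_slope_def)
  qed
  have rf: "N.rat f" unfolding N.rat_def
  proof (intro allI impI)
    fix e t \<sigma> assume v: "N.valid e t \<sigma>"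
    then consider "\<sigma> = 1" "e \<in> core_arcs" "0 \<le> t" "t < arc_length e" | "\<sigma> = -1" "e \<in> core_arcs" "0 < t" "t \<le> arc_length e"
      by (auto simp: N.valid_def)
    then show "\<exists>m::int. N.has_slope f (e, t, \<sigma>) m" using fwd bwd by cases blast+
  qed
  have "0 \<le> D x + N.ord f x" if x: "x \<in> N.pts" for x
  proof (cases x)
    case (Vertex v)
    then have v: "v \<in> core_verts" using x by simp
    have 1: "slope_after \<Gamma> g e 0 = N.slope f (e, 0, 1)" if "e \<in> core_arcs" for e
      using N.slope_eq[OF fwd[OF that]] N.L_pos[OF that] by (simp add: zero_ereal_def)
    have 2: "slope_before \<Gamma> g e (len \<Gamma> e) = - N.slope f (e, arc_length e, -1)" if "e \<in> core_arcs" for e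
      using N.slope_eq[OF bwd[OF that]] N.L_pos[OF that] len_core[OF that] by simp
    have "slope_after \<Gamma> g e 0 \<le> 0" if e: "e \<in> legs" for e
    proof (rule leg_slope_nonpos[OF rg e])
      show "0 \<le> ord_at \<Gamma> g (Inner e t)" if "0 < t" for t
        using eff[OF leg_in_points(1)[OF e that]] leg(1)[OF e that] by simp
      show "0 \<le> ord_at \<Gamma> g (Vertex (head G e))" using eff[OF leg_in_points(2)[OF e]] leg(2)[OF e] by simp
    qed
    then have "(\<Sum>e | e \<in> legs \<and> Vertex (tail G e) = x. slope_after \<Gamma> g e 0) \<le> 0" by (intro sum_nonpos) auto
    moreover have "ord_at \<Gamma> g x = N.ord f x + (\<Sum>e | e \<in> legs \<and> Vertex (tail G e) = x. slope_after \<Gamma> g e 0)"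
      using 1 2 by (simp add: ord_at_def Vertex sum_out_arcs in_arcs_core[OF v] N.ord_def N.sum_dirs_Vertex sum_negf)
    ultimately show ?thesis using eff[OF core_in_points[OF x]] by simp
  next
    case (Inner e t)
    then have e: "e \<in> core_arcs" "0 < t" "t < arc_length e" using x by auto
    have "ord_at \<Gamma> g x = N.ord f x"
      using N.slope_eq[OF fwd[OF e(1), of t]] N.slope_eq[OF bwd[OF e(1), of t]] e
      by (simp add: ord_at_def Inner N.ord_def N.sum_dirs_Inner)
    then show ?thesis using eff[OF core_in_points[OF x]] by simp
  qed
  then show ?thesis using rf by (auto simp: N.eq_eff_def)
qed

section \<open>Very ampleness and rank on the whole curve\<close>

lemma pt_leg: "x \<in> N.pts \<Longrightarrow> e \<in> legs \<Longrightarrow> N.pt x (Inner e t) = 0" "x \<in> N.pts \<Longrightarrow> e \<in> legs \<Longrightarrow> N.pt x (Vertex (head G e)) = 0"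
  using core_not_infinity[of x] arcs_split by (auto simp: N.pt_def points_at_infinity_eq)

text \<open>The coefficient -1 at an infinite end forces \<open>k e\<close> to be at least 1. The
  leg itself contributes one chip at its base through the valence, so only \<open>k e - 1\<close>
  chips are charged to the core.\<close>

lemma canonical_ext_in_RR:
  assumes f: "N.rat f" and k: "\<And>e. e \<in> legs \<Longrightarrow> 1 \<le> k e"
    and core: "\<And>x. x \<in> N.pts \<Longrightarrow> (\<Sum>e | e \<in> legs \<and> Vertex (tail G e) = x. k e - 1) \<le> N.K x + N.ord f x"
  shows "extend f k (\<lambda>_. \<infinity>) \<in> RR \<Gamma> (canonical \<Gamma>)"
proof (rule ext_in_RR[OF f])
  show "0 \<le> canonical \<Gamma> x + N.ord f x - (\<Sum>e | e \<in> legs \<and> Vertex (tail G e) = x. k e)" if "x \<in> N.pts" for x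
    using core[OF that] canonical_core[OF that] by (simp add: sum_subtractf)
  show "0 \<le> canonical \<Gamma> x" if "x \<notin> points \<Gamma>" for x using that by (simp add: canonical_def)
  show "0 \<le> canonical \<Gamma> (Vertex (head G e)) + (if \<infinity> = (\<infinity> :: ereal) then k e else 0)" if "e \<in> legs" for e
    using k[OF that] canonical_leg[OF that] by simp
qed (auto simp: canonical_leg)

text \<open>Subtracting the leg slopes before extending gives a value also at infinite ends, where
  both functions may be \<open>-\<infinity>\<close>.\<close>

lemma ext_difference:
  assumes f: "N.rat f" and g: "N.rat g"
  shows "is_difference \<Gamma> (extend f k (\<lambda>_. \<infinity>)) (extend g l (\<lambda>_. \<infinity>)) (extend (\<lambda>x. f x - g x) (\<lambda>e. k e - l e) (\<lambda>_. \<infinity>))"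
  unfolding is_difference_def
proof (intro conjI ballI)
  have "N.rat (\<lambda>x. f x - g x)" using N.rat_add[OF f N.rat_uminus[OF g]] by simp
  then show "rational_function \<Gamma> (extend (\<lambda>x. f x - g x) (\<lambda>e. k e - l e) (\<lambda>_. \<infinity>))"
    by (rule ext_rational) simp
  fix y assume y: "y \<in> points \<Gamma> - points_at_infinity \<Gamma>"
  then have "y \<in> points \<Gamma>" by simp
  then show "extend (\<lambda>x. f x - g x) (\<lambda>e. k e - l e) (\<lambda>_. \<infinity>) y = extend f k (\<lambda>_. \<infinity>) y - extend g l (\<lambda>_. \<infinity>) y"
  proof (cases rule: points_cases)
    case 1 then show ?thesis by (simp add: ext_core)
  next
    case (2 e t) then show ?thesis by (simp add: ext_leg leg_value_def algebra_simps)
  next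
    case (3 e) then show ?thesis using y by (auto simp: points_at_infinity_eq)
  qed
qed

text \<open>One core function is extended twice: with slope -1 on all legs, and with slope -2 on
  \<open>e\<close> only, paid for by the spare chip at the base. The difference is the distance
  along \<open>e\<close> and 0 elsewhere, so it separates every point of the leg beyond its base
  from all other points.\<close>

lemma separated_on_leg:
  assumes e: "e \<in> legs" and ne: "N.eq_eff (\<lambda>p. N.K p - N.pt (Vertex (tail G e)) p)"
    and x: "x = edge_point \<Gamma> e t" "0 < t" and x': "x' \<in> points \<Gamma>" "x \<noteq> x'"
  shows "\<exists>f \<in> RR \<Gamma> (canonical \<Gamma>). \<exists>f' \<in> RR \<Gamma> (canonical \<Gamma>). \<exists>h. is_difference \<Gamma> f f' h \<and> h x \<noteq> h x'"
proof -
  let ?b = "Vertex (tail G e) :: ('v, 'e) point"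
  obtain f where f: "N.rat f" "\<And>p. p \<in> N.pts \<Longrightarrow> 0 \<le> N.K p - N.pt ?b p + N.ord f p"
    using ne by (auto simp: N.eq_eff_def)
  define l where "l e' = (if e' = e then 2 else 1 :: int)" for e'
  let ?s = "\<lambda>_. \<infinity> :: ereal"
  let ?h = "extend (\<lambda>x. f x - f x) (\<lambda>e'. 1 - l e') ?s"
  have F: "extend f (\<lambda>_. 1) ?s \<in> RR \<Gamma> (canonical \<Gamma>)"
  proof (rule canonical_ext_in_RR[OF f(1)])
    fix p assume "p \<in> N.pts"
    from f(2)[OF this] show "(\<Sum>e' | e' \<in> legs \<and> Vertex (tail G e') = p. 1 - 1) \<le> N.K p + N.ord f p"
      by (simp add: N.pt_def split: if_splits)
  qed simp
  have F': "extend f l ?s \<in> RR \<Gamma> (canonical \<Gamma>)"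
  proof (rule canonical_ext_in_RR[OF f(1)])
    fix p assume p: "p \<in> N.pts"
    have "finite {e' \<in> legs. Vertex (tail G e') = p}" by (simp add: legs_def)
    then have "(\<Sum>e' | e' \<in> legs \<and> Vertex (tail G e') = p. if e' = e then 1 else 0) = N.pt ?b p"
      using e by (auto simp: N.pt_def sum.delta')
    moreover have "l e' - 1 = (if e' = e then 1 else 0)" for e' by (simp add: l_def)
    ultimately have "(\<Sum>e' | e' \<in> legs \<and> Vertex (tail G e') = p. l e' - 1) = N.pt ?b p" by simp
    then show "(\<Sum>e' | e' \<in> legs \<and> Vertex (tail G e') = p. l e' - 1) \<le> N.K p + N.ord f p"
      using f(2)[OF p] by simp
  qed (simp add: l_def)
  have val: "?h (edge_point \<Gamma> e u) = u" if "0 \<le> u" for u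
    using ext_edge_leg[OF e _ that, of ?s "\<lambda>x. f x - f x" "\<lambda>e'. 1 - l e'"]
    by (simp add: leg_value_def l_def min_def one_ereal_def[symmetric])
  have "?h x \<noteq> ?h x'"
    using x'(1)
  proof (cases rule: points_cases)
    case 1
    then show ?thesis using x val[of t] by (simp add: ext_core zero_ereal_def[symmetric])
  next
    case (2 e' t')
    show ?thesis
    proof (cases "e' = e")
      case True
      then have "x' = edge_point \<Gamma> e (ereal t')" using 2 edge_point_leg(1)[OF e] by simp
      then show ?thesis using x val[of t] val[of "ereal t'"] x'(2) 2 by auto
    next
      case False
      then show ?thesis using x val[of t] 2 ext_leg[of e'] by (simp add: leg_value_def l_def zero_ereal_def[symmetric])
    qed
  next
    case (3 e')
    show ?thesis
    proof (cases "e' = e")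
      case True
      then have "x' = edge_point \<Gamma> e \<infinity>" using 3 edge_point_leg(2)[OF e] by simp
      then show ?thesis using x val[of t] val[of \<infinity>] x'(2) by auto
    next
      case False
      then show ?thesis using x val[of t] 3 ext_leg_end[of e'] by (simp add: leg_value_def l_def zero_ereal_def[symmetric])
    qed
  qed
  then show ?thesis using F F' ext_difference[OF f(1) f(1)] by blast
qed

lemma leg_point_cases:
  assumes "x \<in> points \<Gamma>" "x \<notin> N.pts"
  obtains e t where "e \<in> legs" "x = edge_point \<Gamma> e t" "0 < t"
  using assms(1)
proof (cases rule: points_cases)
  case (2 e t)
  then show ?thesis using that[of e "ereal t"] edge_point_leg(1)[of e t] by simp
next
  case (3 e)
  then show ?thesis using that[of e \<infinity>] edge_point_leg(2)[of e] by simp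
qed (use assms in simp)

lemma canonical_very_ample:
  assumes sp: "\<And>x x'. x \<in> N.pts \<Longrightarrow> x' \<in> N.pts \<Longrightarrow>
      \<exists>y\<in>N.pts. \<not> N.eq_eff (\<lambda>p. N.pt x p + N.pt x' p - N.pt y p)"
  shows "very_ample \<Gamma> (canonical \<Gamma>)"
  unfolding very_ample_def
proof (intro ballI impI)
  \<comment> \<open>The hypothesis is used with both points equal to \<open>b\<close>.\<close>
  have off: "N.eq_eff (\<lambda>p. N.K p - N.pt b p)" if "b \<in> N.pts" for b
    using sp[OF that that] N.canonical_minus_point[OF that] by blast
  fix x x' assume x: "x \<in> points \<Gamma>" "x' \<in> points \<Gamma>" "x \<noteq> x'"
  let ?S = "\<lambda>x x'. \<exists>f \<in> RR \<Gamma> (canonical \<Gamma>). \<exists>f' \<in> RR \<Gamma> (canonical \<Gamma>). \<exists>h. is_difference \<Gamma> f f' h \<and> h x \<noteq> h x'"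
  have leg: "?S z z'" if z: "z \<in> points \<Gamma>" "z \<notin> N.pts" "z' \<in> points \<Gamma>" "z \<noteq> z'" for z z'
  proof -
    obtain e t where e: "e \<in> legs" "z = edge_point \<Gamma> e t" "0 < t" using leg_point_cases[OF z(1,2)] .
    have "Vertex (tail G e) \<in> N.pts" using e by (intro tail_core_pt) (simp add: legs_def)
    then show ?thesis using separated_on_leg[OF e(1) off e(2,3) z(3,4)] by blast
  qed
  show "?S x x'"
  proof (cases "x \<in> N.pts \<and> x' \<in> N.pts")
    case True
    obtain y where y: "y \<in> N.pts" "\<not> N.eq_eff (\<lambda>p. N.pt x p + N.pt x' p - N.pt y p)" using sp True by blast
    obtain f g where fg: "N.rat f \<and> N.rat g \<and> (\<forall>p\<in>N.pts. 0 \<le> N.K p + N.ord f p) \<and>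
        (\<forall>p\<in>N.pts. 0 \<le> N.K p + N.ord g p) \<and> f x - f x' \<noteq> g x - g x'"
      using N.canonical_separates[OF conjunct1[OF True] conjunct2[OF True] y(1) x(3) y(2)] by (elim exE)
    then have f: "N.rat f" and g: "N.rat g" and ne: "f x - f x' \<noteq> g x - g x'" by simp_all
    let ?s = "\<lambda>_. \<infinity> :: ereal"
    have "extend f (\<lambda>_. 1) ?s \<in> RR \<Gamma> (canonical \<Gamma>)" "extend g (\<lambda>_. 1) ?s \<in> RR \<Gamma> (canonical \<Gamma>)"
      using fg by (auto intro!: canonical_ext_in_RR)
    moreover have "extend (\<lambda>x. f x - g x) (\<lambda>e. 1 - 1) ?s x \<noteq> extend (\<lambda>x. f x - g x) (\<lambda>e. 1 - 1) ?s x'"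
      using True ne by (simp add: ext_core)
    ultimately show ?thesis using ext_difference[OF f g, of "\<lambda>_. 1" "\<lambda>_. 1"] by blast
  next
    case False
    then show ?thesis using leg[of x x'] leg[of x' x] x by metis
  qed
qed

lemma effective_degree_1:
  fixes E :: "('v, 'e) point \<Rightarrow> int"
  assumes "divisor \<Gamma> E" "effective E" "divisor_degree E = 1"
  obtains y where "y \<in> points \<Gamma>" "E = N.pt y"
proof -
  have fin: "finite {x. E x \<noteq> 0}" "{x. E x \<noteq> 0} \<subseteq> points \<Gamma>" using assms(1) by (auto simp: divisor_def)
  have "divisor_degree E \<noteq> 0" using assms(3) by simp
  then have "\<exists>y. E y \<noteq> 0" by (rule contrapos_np) (simp add: divisor_degree_def)
  then obtain y where y: "E y \<noteq> 0" by blast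
  have "E p - N.pt y p = 0" for p
  proof (rule divisor_degree_eq_0D)
    show "divisor_degree (\<lambda>p. E p - N.pt y p) = 0"
      using divisor_degree_diff[OF fin(1) N.finite_pt] assms(3) by (simp add: N.degree_pt)
    show "finite {p. E p - N.pt y p \<noteq> 0}" by (rule finite_support_diff[OF fin(1) N.finite_pt])
    have "0 \<le> E p" for p using assms(2) by (simp add: effective_def)
    then show "0 \<le> E p - N.pt y p" for p using y by (smt (verit) N.pt_def)
  qed
  then have "E = N.pt y" by (intro ext) simp
  then show ?thesis using that y fin(2) by blast
qed

text \<open>For \<open>y\<close> on a leg, the core theory first produces a chip at the base of the
  leg. The extension with slope -1 up to the parameter of \<open>y\<close> then carries this chip to
  \<open>y\<close>, which may lie at infinity.\<close>

lemma minus_point_nonempty: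
  assumes x: "x \<in> N.pts" "x' \<in> N.pts" and y: "y \<in> points \<Gamma>"
    and all: "\<And>y. y \<in> N.pts \<Longrightarrow> N.eq_eff (\<lambda>p. N.pt x p + N.pt x' p - N.pt y p)"
  shows "RR \<Gamma> (\<lambda>p. N.pt x p + N.pt x' p - N.pt y p) \<noteq> {}"
proof (cases "y \<in> N.pts")
  case True
  obtain f where f: "N.rat f" "\<And>p. p \<in> N.pts \<Longrightarrow> 0 \<le> N.pt x p + N.pt x' p - N.pt y p + N.ord f p"
    using all[OF True] by (auto simp: N.eq_eff_def)
  have "extend f (\<lambda>_. 0) (\<lambda>_. \<infinity>) \<in> RR \<Gamma> (\<lambda>p. N.pt x p + N.pt x' p - N.pt y p)"
  proof (rule ext_in_RR[OF f(1)])
    show "0 \<le> N.pt x p + N.pt x' p - N.pt y p" if "p \<notin> points \<Gamma>" for p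
      using that y by (auto simp: N.pt_def)
  qed (use f(2) in \<open>simp_all add: pt_leg x True\<close>)
  then show ?thesis by blast
next
  case False
  obtain e t where e: "e \<in> legs" "y = edge_point \<Gamma> e t" "0 < t" using leg_point_cases[OF y False] .
  let ?b = "Vertex (tail G e) :: ('v, 'e) point"
  have b: "?b \<in> N.pts" using e by (intro tail_core_pt) (simp add: legs_def)
  obtain f where f: "N.rat f" "\<And>p. p \<in> N.pts \<Longrightarrow> 0 \<le> N.pt x p + N.pt x' p - N.pt ?b p + N.ord f p"
    using all[OF b] by (auto simp: N.eq_eff_def)
  define k where "k e' = (if e' = e then 1 else 0 :: int)" for e'
  define s where "s e' = (if e' = e then t else \<infinity>)" for e'
  have "extend f k s \<in> RR \<Gamma> (\<lambda>p. N.pt x p + N.pt x' p - N.pt y p)"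
  proof (rule ext_in_RR[OF f(1)])
    show "0 < s e'" for e' using e by (simp add: s_def)
    fix p
    show "0 \<le> N.pt x p + N.pt x' p - N.pt y p + N.ord f p - (\<Sum>e' | e' \<in> legs \<and> Vertex (tail G e') = p. k e')"
      if p: "p \<in> N.pts"
    proof -
      have "finite {e' \<in> legs. Vertex (tail G e') = p}" by (simp add: legs_def)
      then have "(\<Sum>e' | e' \<in> legs \<and> Vertex (tail G e') = p. k e') = N.pt ?b p"
        using e by (auto simp: k_def N.pt_def sum.delta')
      moreover have "N.pt y p = 0" using p False by (auto simp: N.pt_def)
      ultimately show ?thesis using f(2)[OF p] by simp
    qed
    show "0 \<le> N.pt x p + N.pt x' p - N.pt y p" if "p \<notin> points \<Gamma>"
      using that y by (auto simp: N.pt_def)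
  next
    fix e' t' assume e': "e' \<in> legs" "0 < (t' :: real)"
    have "Inner e' t' = y \<longleftrightarrow> e' = e \<and> ereal t' = t"
      using e e' edge_point_leg[OF e(1)] by (cases t) auto
    then show "0 \<le> N.pt x (Inner e' t') + N.pt x' (Inner e' t') - N.pt y (Inner e' t') + (if ereal t' = s e' then k e' else 0)"
      using pt_leg(1)[OF x(1) e'(1)] pt_leg(1)[OF x(2) e'(1)] by (auto simp: N.pt_def k_def s_def)
  next
    fix e' assume e': "e' \<in> legs"
    have "Vertex (head G e') = y \<longleftrightarrow> e' = e \<and> t = \<infinity>"
      using e e' edge_point_leg[OF e(1)] leg_head_inj[OF e(1), of e'] by (cases t) (auto simp: legs_def)
    then show "0 \<le> N.pt x (Vertex (head G e')) + N.pt x' (Vertex (head G e')) - N.pt y (Vertex (head G e'))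
        + (if s e' = \<infinity> then k e' else 0)"
      using pt_leg(2)[OF x(1) e'] pt_leg(2)[OF x(2) e'] by (auto simp: N.pt_def k_def s_def)
  qed
  then show ?thesis by blast
qed

lemma hyperelliptic_of_pencil:
  assumes x: "x \<in> N.pts" "x' \<in> N.pts"
    and all: "\<And>y. y \<in> N.pts \<Longrightarrow> N.eq_eff (\<lambda>p. N.pt x p + N.pt x' p - N.pt y p)"
  shows "hyperelliptic \<Gamma>"
proof -
  let ?D = "\<lambda>p. N.pt x p + N.pt x' p"
  let ?P = "\<lambda>r::nat. \<forall>E. divisor \<Gamma> E \<longrightarrow> effective E \<longrightarrow> divisor_degree E = int r \<longrightarrow>
      linear_system \<Gamma> (\<lambda>p. ?D p - E p) \<noteq> {}"
  have LS: "linear_system \<Gamma> D \<noteq> {} \<longleftrightarrow> RR \<Gamma> D \<noteq> {}" for D by (simp add: linear_system_def)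
  have div: "divisor \<Gamma> ?D" unfolding divisor_def
    using core_in_points[OF x(1)] core_in_points[OF x(2)] finite_support_add[OF N.finite_pt N.finite_pt]
    by (auto simp: N.pt_def split: if_splits)
  have deg: "divisor_degree ?D = 2"
    using divisor_degree_add[OF N.finite_pt[of x] N.finite_pt[of x']] by (simp add: N.degree_pt)
  have P1: "?P 1"
  proof (intro allI impI)
    fix E :: "('v, 'e) point \<Rightarrow> int" assume "divisor \<Gamma> E" "effective E" "divisor_degree E = int 1"
    then obtain y where "y \<in> points \<Gamma>" "E = N.pt y" using effective_degree_1[of E] by auto
    then show "linear_system \<Gamma> (\<lambda>p. ?D p - E p) \<noteq> {}"
      using minus_point_nonempty[OF x _ all] by (simp add: LS)
  qed
  have P_le: "r \<le> 1" if r: "?P r" for r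
  proof (rule ccontr)
    assume "\<not> r \<le> 1"
    obtain y z where yz: "y \<in> N.pts" "z \<in> N.pts" and no: "\<not> N.eq_eff (\<lambda>p. ?D p - N.pt y p - N.pt z p)"
      using N.degree_2_rank_le_1[OF card_core x] by blast
    \<comment> \<open>The rank condition concerns degree exactly \<open>r\<close>, so
      \<open>y\<close> is repeated until \<open>y + z\<close> has that degree; the surplus is
      dropped again by monotonicity.\<close>
    define E where "E p = (int r - 1) * N.pt y p + N.pt z p" for p
    have fy: "finite {p. (int r - 1) * N.pt y p \<noteq> 0}"
      by (rule finite_subset[of _ "{y}"]) (auto simp: N.pt_def)
    have "divisor \<Gamma> E" unfolding divisor_def E_def
      using core_in_points[OF yz(1)] core_in_points[OF yz(2)] finite_support_add[OF fy N.finite_pt]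
      by (auto simp: N.pt_def split: if_splits)
    moreover have "effective E" using \<open>\<not> r \<le> 1\<close> by (simp add: effective_def E_def N.pt_def)
    moreover have "divisor_degree E = int r"
    proof -
      have "divisor_degree (\<lambda>p. (int r - 1) * N.pt y p) = int r - 1"
        by (subst divisor_degree_eq_sum[of "{y}"]) (auto simp: N.pt_def)
      then show ?thesis unfolding E_def
        using divisor_degree_add[OF fy N.finite_pt] by (simp add: N.degree_pt)
    qed
    ultimately obtain g where g: "g \<in> RR \<Gamma> (\<lambda>p. ?D p - E p)" using r LS by blast
    have "N.eq_eff (\<lambda>p. ?D p - E p)"
      by (rule RR_restrict[OF g]) (use x yz in \<open>auto simp: pt_leg E_def\<close>)
    then have "N.eq_eff (\<lambda>p. ?D p - N.pt y p - N.pt z p)"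
      by (rule N.eq_eff_mono) (use \<open>\<not> r \<le> 1\<close> in \<open>auto simp: E_def N.pt_def\<close>)
    then show False using no by simp
  qed
  have "(GREATEST r. ?P r) = 1" by (rule Greatest_equality) (rule P1, rule P_le)
  moreover have "linear_system \<Gamma> ?D \<noteq> {}"
  proof -
    obtain g where "g \<in> RR \<Gamma> (\<lambda>p. N.pt x p + N.pt x' p - N.pt x p)"
      using minus_point_nonempty[OF x core_in_points[OF x(1)] all] by blast
    then have "g \<in> RR \<Gamma> ?D" by (auto simp: RR_def effective_def N.pt_def intro: order_trans split: if_splits)
    then show ?thesis using LS by blast
  qed
  ultimately have "divisor_rank \<Gamma> ?D = 1" by (simp add: divisor_rank_def)
  then show ?thesis using div deg unfolding hyperelliptic_def by blast
qed

end

theorem theorem46: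
  fixes \<Gamma> :: "('v, 'e) metric_graph"
  assumes "tropical_curve \<Gamma>"
    and "1 \<le> genus \<Gamma>"
    and "\<not> very_ample \<Gamma> (canonical \<Gamma>)"
  shows "hyperelliptic \<Gamma>"
proof -
  interpret tropical \<Gamma> using assms(1,2) by unfold_locales
  show ?thesis
  proof (rule ccontr)
    assume "\<not> hyperelliptic \<Gamma>"
    then have "very_ample \<Gamma> (canonical \<Gamma>)"
      using hyperelliptic_of_pencil by (intro canonical_very_ample) blast
    then show False using assms(3) by simp
  qed
qed

end
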